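(* Assume that $\int_0^\infty w^{d/2}\,P_{\rm mix}(dw)<\infty$. Let $\bm k$ be a missing structure. Suppose that there is a missing structure $\bm k'$ and a realized value $\bm z$ of $\bm Y_{(\bm k')}$ such that $\bm k'\prec\bm k$ and such that $\pi_{\bm k'}(\cdot\mid\bm z)$, the conditional density of $(\bm B,\bm\Sigma)$ given $\bm Y_{(\bm k')}=\bm z$, is proper. Then, for Lebesgue almost every $\bm z'$ in the range of $\bm Y_{(\bm k-\bm k')}$, the posterior density $\pi_{\bm k}(\cdot\mid\bm y_{(\bm k)})$, where $\bm y$ satisfies $\bm y_{(\bm k')}=\bm z$ and $\bm y_{(\bm k-\bm k')}=\bm z'$, is proper, and any DAI chain targeting this posterior is Harris recurrent.
   Context: Setting. Fix positive integers $n,p,d$; a design matrix $\bm x\in\mathbb R^{n\times p}$ with $i$th row $\bm x_i^\top$; $m\in\mathbb R$; a symmetric positive semi-definite $\bm a\in\mathbb R^{d\times d}$; and a probability measure $P_{\rm mix}$ on $(0,\infty)$. Let $S$ be the set of symmetric positive definite real $d\times d$ matrices. Integrals $d\bm\beta$ and $d\bm\varsigma$ are with respect to Lebesgue measure on $\mathbb R^{p\times d}$ and on (the free entries of) $S$. Model. The (improper) prior density is $p_{\rm prior}(\bm\beta,\bm\varsigma)\propto|\bm\varsigma|^{-(m+1)/2}\exp\{-\frac12\operatorname{tr}(\bm\varsigma^{-1}\bm a)\}$ on $\mathbb R^{p\times d}\times S$. The joint measure of $(\bm Y,\bm W,\bm B,\bm\Sigma)$ on $\mathbb R^{n\times d}\times(0,\infty)^n\times\mathbb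 R^{p\times d}\times S$ is $p_{\rm joint}(\bm y,\bm w,\bm\beta,\bm\varsigma)\,d\bm y\,\prod_iP_{\rm mix}(dw_i)\,d\bm\beta\,d\bm\varsigma$, where, with $\bm y_i^\top$ the $i$th row of $\bm y$, $$p_{\rm joint}\propto p_{\rm prior}(\bm\beta,\bm\varsigma)\prod_{i=1}^n\frac{w_i^{d/2}}{|\bm\varsigma|^{1/2}}\exp\Big\{-\frac{w_i}{2}(\bm y_i-\bm\beta^\top\bm x_i)^\top\bm\varsigma^{-1}(\bm y_i-\bm\beta^\top\bm x_i)\Big\}.$$ All conditional distributions are defined through $p_{\rm joint}$. Missing data. A missing structure is $\bm k=(k_{i,j})\in\{0,1\}^{n\times d}$ each of whose rows has at least one $1$; $k_{i,j}=1$ means $Y_{i,j}$ is observed. For any $\bm k\in\{0,1\}^{n\times d}$, $\bm y_{(\bm k)}=(y_{i,j})_{k_{i,j}=1}$, and likewise $\bm Y_{(\bm k)}$. Write $\bm k\prec\bm k'$ if $\bm k\ne\bm k'$ and $k'_{i,j}=1$ whenever $k_{i,j}=1$; then $\bm k'-\bm k$ indicates the entries observed under $\bm k'$ but not under $\bm k$. $\bm k$ is monotone if (i) $k_{i,j}=1$ implies $k_{i',j'}=1$ for all $i'\le i$, $j'\ge j$, and (ii) $k_{i,d}=1$ for all $i$. If the $1$'s in row $i$ of $\bm k$ are at positions $j_1<\dots<j_{d_i}$, $\bm c_{i,(\bm k)}$ is the $d_i\times d$ matrix whose $\ell$th row has a $1$ in position $j_\ell$ and $0$ elsewhere; $\bm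 y_{i,(\bm k)}=\bm c_{i,(\bm k)}\bm y_i$. Put $$r_{i,(\bm k)}=(\bm y_{i,(\bm k)}-\bm c_{i,(\bm k)}\bm\beta^\top\bm x_i)^\top(\bm c_{i,(\bm k)}\bm\varsigma\bm c_{i,(\bm k)}^\top)^{-1}(\bm y_{i,(\bm k)}-\bm c_{i,(\bm k)}\bm\beta^\top\bm x_i).$$ Posterior. For a missing structure $\bm k$, the conditional density of $(\bm B,\bm\Sigma)$ given $\bm Y_{(\bm k)}=\bm y_{(\bm k)}$ is $$\pi_{\bm k}(\bm\beta,\bm\varsigma\mid\bm y_{(\bm k)})\propto p_{\rm prior}(\bm\beta,\bm\varsigma)\prod_{i=1}^n\int_0^\infty\frac{w^{d_i/2}}{|\bm c_{i,(\bm k)}\bm\varsigma\bm c_{i,(\bm k)}^\top|^{1/2}}\exp\Big(-\frac{r_{i,(\bm k)}w}{2}\Big)P_{\rm mix}(dw);$$ it is proper if the right-hand side has finite integral over $\mathbb R^{p\times d}\times S$. DAI chain. A DAI chain targeting $\pi_{\bm k}(\cdot\mid\bm y_{(\bm k)})$ is determined by a monotone missing structure $\tilde{\bm k}$ with $\bm k\prec\tilde{\bm k}$. It is the Markov chain $(\bm B(t),\bm\Sigma(t))_{t\ge0}$ on $\mathbb R^{p\times d}\times S$ which, from $(\bm B(t),\bm\Sigma(t))=(\bm\beta,\bm\varsigma)$, moves as follows. I1: draw $\bm w$ from the conditional distribution of $\bm W$ given $(\bm B,\bm\Sigma,\bm Y_{(\bm k)})=(\bm\beta,\bm\varsigma,\bm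 y_{(\bm k)})$, which is $\propto\prod_iw_i^{d_i/2}\exp(-r_{i,(\bm k)}w_i/2)P_{\rm mix}(dw_i)$. I2: draw $\bm u$ from the (normal) conditional distribution of $\bm Y_{(\tilde{\bm k}-\bm k)}$ given $(\bm Y_{(\bm k)},\bm W,\bm B,\bm\Sigma)=(\bm y_{(\bm k)},\bm w,\bm\beta,\bm\varsigma)$, where given $(\bm W,\bm B,\bm\Sigma)=(\bm w,\bm\beta,\bm\varsigma)$ the rows of $\bm Y$ are independent with $\bm Y_i\sim N_d(\bm\beta^\top\bm x_i,w_i^{-1}\bm\varsigma)$. P: draw $(\bm B(t+1),\bm\Sigma(t+1))$ from the conditional distribution of $(\bm B,\bm\Sigma)$ given $(\bm W,\bm Y_{(\bm k)},\bm Y_{(\tilde{\bm k}-\bm k)})=(\bm w,\bm y_{(\bm k)},\bm u)$. The conditional in the P step need only be proper for $P_{\rm mix}^{\otimes n}\times$Lebesgue-almost every $(\bm w,\bm u)$; its value on the exceptional null set is immaterial. Harris recurrent: there is a nonzero $\sigma$-finite measure $\phi$ on the state space such that, from every starting point, the chain hits every measurable set $A$ with $\phi(A)>0$ with probability one. *)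

theory Defs
  imports
    "HOL-Probability.Probability"
    "Jordan_Normal_Form.Determinant"
    "Jordan_Normal_Form.Gauss_Jordan_Elimination"
begin

hide_const (open) Determinants.det Finite_Cartesian_Product.mat Finite_Cartesian_Product.row
  Finite_Cartesian_Product.vec Finite_Cartesian_Product.transpose
hide_type (open) Finite_Cartesian_Product.vec

text \<open>Matrices of varying size are those of Jordan_Normal_Form; all indices are 0-based.\<close>

definition psd_mats :: "nat \<Rightarrow> real mat set" where
  "psd_mats d = {A \<in> carrier_mat d d. transpose_mat A = A \<and>
     (\<forall>v \<in> carrier_vec d. scalar_prod v (A *\<^sub>v v) \<ge> 0)}"

definition spd_mats :: "nat \<Rightarrow> real mat set" where
  "spd_mats d = {A \<in> carrier_mat d d. transpose_mat A = A \<and>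
     (\<forall>v \<in> carrier_vec d. v \<noteq> 0\<^sub>v d \<longrightarrow> scalar_prod v (A *\<^sub>v v) > 0)}"

definition mat_trace :: "real mat \<Rightarrow> real" where
  "mat_trace A = (\<Sum>i<dim_row A. A $$ (i, i))"

text \<open>Only used for invertible matrices.\<close>
definition inv_mat :: "real mat \<Rightarrow> real mat" where
  "inv_mat A = the (mat_inverse A)"

definition lebesgue_mat :: "nat \<Rightarrow> nat \<Rightarrow> real mat measure" where
  "lebesgue_mat p d = embed_measure (Pi\<^sub>M ({..<p} \<times> {..<d}) (\<lambda>_. lborel)) (mat p d)"

text \<open>Lebesgue measure on the free entries \<open>(i, j)\<close>, \<open>i \<le> j\<close>, carried to the symmetric matrices
  and restricted to the positive definite ones.\<close>
definition lebesgue_spd :: "nat \<Rightarrow> real mat measure" where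
  "lebesgue_spd d = restrict_space
     (embed_measure (Pi\<^sub>M {(i, j). i \<le> j \<and> j < d} (\<lambda>_. lborel))
        (\<lambda>f. mat d d (\<lambda>(i, j). f (min i j, max i j))))
     (spd_mats d)"

definition param_space :: "nat \<Rightarrow> nat \<Rightarrow> (real mat \<times> real mat) measure" where
  "param_space p d = lebesgue_mat p d \<Otimes>\<^sub>M lebesgue_spd d"

text \<open>An element of \<open>{0,1}\<^sup>n\<^sup>\<times>\<^sup>d\<close> is represented by the set of positions of its ones. So
  \<open>k \<prec> k'\<close> is \<open>K \<subset> K'\<close>, and \<open>k' - k\<close> is \<open>K' - K\<close>. A value of \<open>Y\<^sub>(\<^sub>k\<^sub>)\<close> is a point of
  \<open>data_space K\<close>.\<close>

definition missing_structure :: "nat \<Rightarrow> nat \<Rightarrow> (nat \<times> nat) set \<Rightarrow> bool" where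
  "missing_structure n d K \<longleftrightarrow> K \<subseteq> {..<n} \<times> {..<d} \<and> (\<forall>i<n. \<exists>j<d. (i, j) \<in> K)"

definition monotone_structure :: "nat \<Rightarrow> nat \<Rightarrow> (nat \<times> nat) set \<Rightarrow> bool" where
  "monotone_structure n d K \<longleftrightarrow>
     (\<forall>i j i' j'. (i, j) \<in> K \<and> i' \<le> i \<and> j \<le> j' \<and> j' < d \<longrightarrow> (i', j') \<in> K) \<and>
     (\<forall>i<n. (i, d - 1) \<in> K)"

definition data_space :: "(nat \<times> nat) set \<Rightarrow> ((nat \<times> nat) \<Rightarrow> real) measure" where
  "data_space K = Pi\<^sub>M K (\<lambda>_. lborel)"

definition obs_cols :: "(nat \<times> nat) set \<Rightarrow> nat \<Rightarrow> nat list" where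
  "obs_cols K i = sorted_list_of_set {j. (i, j) \<in> K}"

definition obs_dim :: "(nat \<times> nat) set \<Rightarrow> nat \<Rightarrow> nat" where
  "obs_dim K i = length (obs_cols K i)"

definition c_mat :: "nat \<Rightarrow> (nat \<times> nat) set \<Rightarrow> nat \<Rightarrow> real mat" where
  "c_mat d K i = mat (obs_dim K i) d (\<lambda>(l, j). if j = obs_cols K i ! l then 1 else 0)"

definition data_row :: "nat \<Rightarrow> ((nat \<times> nat) \<Rightarrow> real) \<Rightarrow> nat \<Rightarrow> real vec" where
  "data_row d y i = vec d (\<lambda>j. y (i, j))"

text \<open>Here \<open>P\<close> is the law, on the path space, of a Markov chain started at \<open>x\<close> with transition
  kernel \<open>\<kappa>\<close>.\<close>
definition markov_chain_law ::
  "'s measure \<Rightarrow> ('s \<Rightarrow> 's measure) \<Rightarrow> 's \<Rightarrow> (nat \<Rightarrow> 's) measure \<Rightarrow> bool" where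
  "markov_chain_law M \<kappa> x P \<longleftrightarrow>
     prob_space P \<and> sets P = sets (Pi\<^sub>M UNIV (\<lambda>_. M)) \<and>
     distr P M (\<lambda>\<omega>. \<omega> 0) = return M x \<and>
     (\<forall>t. \<forall>B \<in> sets (Pi\<^sub>M {..t} (\<lambda>_. M)). \<forall>A \<in> sets M.
        emeasure P {\<omega> \<in> space P. restrict \<omega> {..t} \<in> B \<and> \<omega> (Suc t) \<in> A} =
        (\<integral>\<^sup>+ \<omega>. indicator B (restrict \<omega> {..t}) * emeasure (\<kappa> (\<omega> t)) A \<partial>P))"

text \<open>Hitting is at a time \<open>t \<ge> 1\<close>. For a fixed \<open>x\<close> the law \<open>P\<close> exists and is unique because
  \<open>\<kappa>\<close> is a Markov kernel.\<close>
definition Harris_recurrent :: "'s measure \<Rightarrow> ('s \<Rightarrow> 's measure) \<Rightarrow> bool" where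
  "Harris_recurrent M \<kappa> \<longleftrightarrow>
     \<kappa> \<in> M \<rightarrow>\<^sub>M prob_algebra M \<and>
     (\<exists>\<phi>. sets \<phi> = sets M \<and> sigma_finite_measure \<phi> \<and> emeasure \<phi> (space \<phi>) \<noteq> 0 \<and>
       (\<forall>x \<in> space M. \<forall>P. markov_chain_law M \<kappa> x P \<longrightarrow>
         (\<forall>A \<in> sets M. emeasure \<phi> A > 0 \<longrightarrow> (AE \<omega> in P. \<exists>t\<ge>1. \<omega> t \<in> A))))"

text \<open>Meaningful only when \<open>M\<close> has total mass in \<open>(0, \<infinity>)\<close>.\<close>
definition normalized :: "'a measure \<Rightarrow> 'a measure" where
  "normalized M = scale_measure (inverse (emeasure M (space M))) M"

text \<open>Densities are written without their normalizing constants throughout.\<close>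

context
  fixes n p d :: nat and x a :: "real mat" and m :: real and Pmix :: "real measure"
begin

definition prior_density :: "real mat \<times> real mat \<Rightarrow> real" where
  "prior_density = (\<lambda>(\<beta>, \<sigma>).
     det \<sigma> powr (- (m + 1) / 2) * exp (- (1 / 2) * mat_trace (inv_mat \<sigma> * a)))"

definition joint_density ::
  "((nat \<times> nat) \<Rightarrow> real) \<Rightarrow> (nat \<Rightarrow> real) \<Rightarrow> real mat \<times> real mat \<Rightarrow> real" where
  "joint_density y w = (\<lambda>(\<beta>, \<sigma>). prior_density (\<beta>, \<sigma>) *
     (\<Prod>i<n. w i powr (d / 2) / sqrt (det \<sigma>) *
        (let e = data_row d y i - transpose_mat \<beta> *\<^sub>v row x i
         in exp (- (w i / 2) * scalar_prod e (inv_mat \<sigma> *\<^sub>v e)))))"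

definition obs_joint_density ::
  "(nat \<times> nat) set \<Rightarrow> ((nat \<times> nat) \<Rightarrow> real) \<Rightarrow> (nat \<Rightarrow> real) \<Rightarrow> real mat \<times> real mat \<Rightarrow> ennreal"
  where
  "obs_joint_density K y w \<theta> =
     (let K\<^sub>c = {..<n} \<times> {..<d} - K
      in \<integral>\<^sup>+ v. ennreal (joint_density (merge K K\<^sub>c (y, v)) w \<theta>) \<partial>data_space K\<^sub>c)"

definition obs_cov :: "(nat \<times> nat) set \<Rightarrow> nat \<Rightarrow> real mat \<Rightarrow> real mat" where
  "obs_cov K i \<sigma> = c_mat d K i * \<sigma> * transpose_mat (c_mat d K i)"

text \<open>The quantity \<open>r\<^sub>i\<^sub>,\<^sub>(\<^sub>k\<^sub>)\<close>; it depends on \<open>y\<close> only through its entries in \<open>K\<close>.\<close>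
definition resid ::
  "(nat \<times> nat) set \<Rightarrow> ((nat \<times> nat) \<Rightarrow> real) \<Rightarrow> nat \<Rightarrow> real mat \<times> real mat \<Rightarrow> real" where
  "resid K y i = (\<lambda>(\<beta>, \<sigma>).
     let e = c_mat d K i *\<^sub>v data_row d y i - c_mat d K i *\<^sub>v (transpose_mat \<beta> *\<^sub>v row x i)
     in scalar_prod e (inv_mat (obs_cov K i \<sigma>) *\<^sub>v e))"

definition posterior_density ::
  "(nat \<times> nat) set \<Rightarrow> ((nat \<times> nat) \<Rightarrow> real) \<Rightarrow> real mat \<times> real mat \<Rightarrow> ennreal" where
  "posterior_density K y = (\<lambda>(\<beta>, \<sigma>). ennreal (prior_density (\<beta>, \<sigma>)) *
     (\<Prod>i<n. \<integral>\<^sup>+ w. ennreal (w powr (obs_dim K i / 2) / sqrt (det (obs_cov K i \<sigma>)) *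
        exp (- (resid K y i (\<beta>, \<sigma>) * w / 2))) \<partial>Pmix))"

definition posterior_proper :: "(nat \<times> nat) set \<Rightarrow> ((nat \<times> nat) \<Rightarrow> real) \<Rightarrow> bool" where
  "posterior_proper K y \<longleftrightarrow> (\<integral>\<^sup>+ \<theta>. posterior_density K y \<theta> \<partial>param_space p d) < \<infinity>"

definition weight_space :: "(nat \<Rightarrow> real) measure" where
  "weight_space = Pi\<^sub>M {..<n} (\<lambda>_. Pmix)"

definition I1_step ::
  "(nat \<times> nat) set \<Rightarrow> ((nat \<times> nat) \<Rightarrow> real) \<Rightarrow> real mat \<times> real mat \<Rightarrow> (nat \<Rightarrow> real) measure" where
  "I1_step K y \<theta> = normalized (density weight_space
     (\<lambda>w. \<Prod>i<n. ennreal (w i powr (obs_dim K i / 2) * exp (- (resid K y i \<theta> * w i / 2)))))"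

definition I2_step ::
  "(nat \<times> nat) set \<Rightarrow> (nat \<times> nat) set \<Rightarrow> ((nat \<times> nat) \<Rightarrow> real) \<Rightarrow> real mat \<times> real mat \<Rightarrow>
   (nat \<Rightarrow> real) \<Rightarrow> ((nat \<times> nat) \<Rightarrow> real) measure" where
  "I2_step K Kt y \<theta> w = normalized (density (data_space (Kt - K))
     (\<lambda>u. obs_joint_density Kt (merge K (Kt - K) (y, u)) w \<theta>))"

definition P_measure ::
  "(nat \<times> nat) set \<Rightarrow> (nat \<times> nat) set \<Rightarrow> ((nat \<times> nat) \<Rightarrow> real) \<Rightarrow>
   (nat \<Rightarrow> real) \<Rightarrow> ((nat \<times> nat) \<Rightarrow> real) \<Rightarrow> (real mat \<times> real mat) measure" where
  "P_measure K Kt y w u = density (param_space p d)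
     (obs_joint_density Kt (merge K (Kt - K) (y, u)) w)"

text \<open>\<open>Q\<close> is a version of the P step: it is prescribed where the conditional is proper and is an
  arbitrary measurable choice of distributions elsewhere.\<close>
definition P_step_version ::
  "(nat \<times> nat) set \<Rightarrow> (nat \<times> nat) set \<Rightarrow> ((nat \<times> nat) \<Rightarrow> real) \<Rightarrow>
   ((nat \<Rightarrow> real) \<times> ((nat \<times> nat) \<Rightarrow> real) \<Rightarrow> (real mat \<times> real mat) measure) \<Rightarrow> bool" where
  "P_step_version K Kt y Q \<longleftrightarrow>
     Q \<in> weight_space \<Otimes>\<^sub>M data_space (Kt - K) \<rightarrow>\<^sub>M prob_algebra (param_space p d) \<and>
     (\<forall>w \<in> space weight_space. \<forall>u \<in> space (data_space (Kt - K)).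
        emeasure (P_measure K Kt y w u) (space (param_space p d)) < \<infinity> \<longrightarrow>
        Q (w, u) = normalized (P_measure K Kt y w u))"

definition DAI_kernel ::
  "(nat \<times> nat) set \<Rightarrow> (nat \<times> nat) set \<Rightarrow> ((nat \<times> nat) \<Rightarrow> real) \<Rightarrow>
   ((nat \<Rightarrow> real) \<times> ((nat \<times> nat) \<Rightarrow> real) \<Rightarrow> (real mat \<times> real mat) measure) \<Rightarrow>
   real mat \<times> real mat \<Rightarrow> (real mat \<times> real mat) measure" where
  "DAI_kernel K Kt y Q \<theta> =
     I1_step K y \<theta> \<bind> (\<lambda>w. I2_step K Kt y \<theta> w \<bind> (\<lambda>u. Q (w, u)))"

text \<open>\<open>\<kappa>\<close> is the transition kernel of a DAI chain targeting the posterior given \<open>y\<^sub>(\<^sub>k\<^sub>)\<close>.\<close>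
definition DAI_chain ::
  "(nat \<times> nat) set \<Rightarrow> ((nat \<times> nat) \<Rightarrow> real) \<Rightarrow>
   (real mat \<times> real mat \<Rightarrow> (real mat \<times> real mat) measure) \<Rightarrow> bool" where
  "DAI_chain K y \<kappa> \<longleftrightarrow> (\<exists>Kt Q. missing_structure n d Kt \<and> monotone_structure n d Kt \<and> K \<subset> Kt \<and>
     P_step_version K Kt y Q \<and> \<kappa> = DAI_kernel K Kt y Q)"

end

end

theory Submission
  imports Defs
begin

text \<open>Integrating a Gaussian density over one coordinate at a time gives the density of
  \<open>(Y\<^sub>(\<^sub>k\<^sub>), W, B, \<Sigma>)\<close> for every \<open>k\<close>. Integrated over the weights it is the posterior density given
  \<open>y\<^sub>(\<^sub>k\<^sub>)\<close>, so by Tonelli the integral over \<open>z'\<close> of the total posterior mass for \<open>k\<close> is, up to a power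
  of \<open>2 * pi\<close>, the total posterior mass for \<open>k'\<close>. This is finite, hence the inner mass is finite for
  almost every \<open>z'\<close>. A proper posterior is a finite invariant measure of the DAI chain, all transition
  probabilities have the same null sets because the joint density is positive, and such a chain is
  Harris recurrent.\<close>

section \<open>Recurrence from an invariant measure\<close>

text \<open>Harris recurrence concerns every starting point, whereas properness only makes the
  normalizing constant of I1 finite for almost every parameter. The moment hypothesis closes this
  gap: a row has at most \<open>d\<close> observed entries, and lower moments are dominated by that
  of order \<open>d / 2\<close>, so the posterior density is finite at every \<theta> and the chain
  is a Markov kernel everywhere. For the P step almost everywhere is enough, because
  \<open>\<kappa> \<theta>\<close> averages \<open>Q\<close> against a density over the augmented
  data: values of \<open>Q\<close> on a null set affect neither invariance nor the null sets of the
  kernel. The Gaussian computation that removes one cell serves for \<open>K - K'\<close> in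
  properness, for \<open>Kt - K\<close> in the chain, and for the cells outside \<open>Kt\<close> in
  I2 and P. To make it an induction step, selection matrices are replaced by principal submatrices
  indexed by sets, so that removing a cell deletes one row and one column. The definitions omit the
  powers of \<open>2 * pi\<close>; hence each removed cell leaves \<open>sqrt (2 * pi)\<close>, a
  constant that normalization cancels.\<close>

lemma markov_chain_law_nn_integral_step:
  assumes law: "markov_chain_law M \<kappa> x P" and \<kappa>: "\<kappa> \<in> M \<rightarrow>\<^sub>M prob_algebra M"
    and B: "B \<in> sets (Pi\<^sub>M {..t} (\<lambda>_. M))" and f: "f \<in> borel_measurable M"
  shows "(\<integral>\<^sup>+ \<omega>. indicator B (restrict \<omega> {..t}) * f (\<omega> (Suc t)) \<partial>P) =
    (\<integral>\<^sup>+ \<omega>. indicator B (restrict \<omega> {..t}) * (\<integral>\<^sup>+ y. f y \<partial>\<kappa> (\<omega> t)) \<partial>P)"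
proof -
  have sP: "sets P = sets (Pi\<^sub>M UNIV (\<lambda>_. M))"
    and step: "\<And>A. A \<in> sets M \<Longrightarrow>
        emeasure P {\<omega> \<in> space P. restrict \<omega> {..t} \<in> B \<and> \<omega> (Suc t) \<in> A} =
        (\<integral>\<^sup>+ \<omega>. indicator B (restrict \<omega> {..t}) * emeasure (\<kappa> (\<omega> t)) A \<partial>P)"
    using law B unfolding markov_chain_law_def by auto
  have [measurable]: "\<kappa> \<in> M \<rightarrow>\<^sub>M subprob_algebra M" by (rule measurable_prob_algebraD[OF \<kappa>])
  have coord[measurable]: "(\<lambda>\<omega>. \<omega> s) \<in> P \<rightarrow>\<^sub>M M" for s
    unfolding measurable_cong_sets[OF sP refl] by measurable
  have [measurable]: "(\<lambda>\<omega>. restrict \<omega> {..t}) \<in> P \<rightarrow>\<^sub>M Pi\<^sub>M {..t} (\<lambda>_. M)"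
    unfolding measurable_cong_sets[OF sP refl] by (rule measurable_restrict_subset) auto
  note B[measurable]
  have B': "(\<lambda>\<omega>. indicator B (restrict \<omega> {..t}) :: ennreal) \<in> borel_measurable P" by measurable
  \<comment> \<open>\<open>D\<close> is the path law restricted to the event that the past lies in
    \<open>B\<close>. The defining property of the chain then becomes an equality of two measures on
    the state space, against which any \<open>f\<close> can be integrated.\<close>
  define D where "D = density P (\<lambda>\<omega>. indicator B (restrict \<omega> {..t}))"
  have sD[measurable_cong]: "sets D = sets P" by (simp add: D_def)
  have K[measurable]: "(\<lambda>\<omega>. \<kappa> (\<omega> t)) \<in> D \<rightarrow>\<^sub>M subprob_algebra M" by measurable
  have ne: "space P \<noteq> {}"
    using law prob_space.not_empty unfolding markov_chain_law_def by blast
  have eq: "distr D M (\<lambda>\<omega>. \<omega> (Suc t)) = D \<bind> (\<lambda>\<omega>. \<kappa> (\<omega> t))"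
  proof (rule measure_eqI)
    show "sets (distr D M (\<lambda>\<omega>. \<omega> (Suc t))) = sets (D \<bind> (\<lambda>\<omega>. \<kappa> (\<omega> t)))"
      using ne by (subst sets_bind[where N=M]) (auto simp: D_def sets_kernel[OF K, simplified D_def])
    fix A assume "A \<in> sets (distr D M (\<lambda>\<omega>. \<omega> (Suc t)))"
    then have A[measurable]: "A \<in> sets M" by simp
    have "emeasure (distr D M (\<lambda>\<omega>. \<omega> (Suc t))) A = emeasure D ((\<lambda>\<omega>. \<omega> (Suc t)) -` A \<inter> space D)"
      by (subst emeasure_distr) auto
    also have "\<dots> = (\<integral>\<^sup>+ \<omega>. indicator B (restrict \<omega> {..t}) * indicator ((\<lambda>\<omega>. \<omega> (Suc t)) -` A \<inter> space D) \<omega> \<partial>P)"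
      unfolding D_def by (subst emeasure_density) auto
    also have "\<dots> = (\<integral>\<^sup>+ \<omega>. indicator {\<omega> \<in> space P. restrict \<omega> {..t} \<in> B \<and> \<omega> (Suc t) \<in> A} \<omega> \<partial>P)"
      by (intro nn_integral_cong) (auto simp: indicator_def D_def)
    also have "\<dots> = emeasure P {\<omega> \<in> space P. restrict \<omega> {..t} \<in> B \<and> \<omega> (Suc t) \<in> A}"
      by (rule nn_integral_indicator) measurable
    also have "\<dots> = (\<integral>\<^sup>+ \<omega>. emeasure (\<kappa> (\<omega> t)) A \<partial>D)"
      unfolding step[OF A] D_def by (subst nn_integral_density) auto
    also have "\<dots> = emeasure (D \<bind> (\<lambda>\<omega>. \<kappa> (\<omega> t))) A"
      using ne by (subst emeasure_bind[OF _ K A]) (auto simp: D_def)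
    finally show "emeasure (distr D M (\<lambda>\<omega>. \<omega> (Suc t))) A = emeasure (D \<bind> (\<lambda>\<omega>. \<kappa> (\<omega> t))) A" .
  qed
  have "(\<integral>\<^sup>+ \<omega>. indicator B (restrict \<omega> {..t}) * f (\<omega> (Suc t)) \<partial>P) = (\<integral>\<^sup>+ \<omega>. f (\<omega> (Suc t)) \<partial>D)"
    unfolding D_def using f by (subst nn_integral_density) auto
  also have "\<dots> = (\<integral>\<^sup>+ y. f y \<partial>distr D M (\<lambda>\<omega>. \<omega> (Suc t)))"
    using f by (subst nn_integral_distr) auto
  also have "\<dots> = (\<integral>\<^sup>+ \<omega>. (\<integral>\<^sup>+ y. f y \<partial>\<kappa> (\<omega> t)) \<partial>D)"
    unfolding eq by (rule nn_integral_bind[OF f K])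
  also have "\<dots> = (\<integral>\<^sup>+ \<omega>. indicator B (restrict \<omega> {..t}) * (\<integral>\<^sup>+ y. f y \<partial>\<kappa> (\<omega> t)) \<partial>P)"
    unfolding D_def using f by (subst nn_integral_density) auto
  finally show ?thesis .
qed

text \<open>The iterated taboo kernel: the probability that a chain started at \<open>x\<close>
  stays outside \<open>A\<close> at the times 1 to \<open>t\<close>. The start itself is not tested,
  in agreement with hitting at times \<open>t \<ge> 1\<close>.\<close>

definition avoid_prob :: "('s \<Rightarrow> 's measure) \<Rightarrow> 's set \<Rightarrow> nat \<Rightarrow> 's \<Rightarrow> ennreal" where
  "avoid_prob \<kappa> A t = ((\<lambda>f x. \<integral>\<^sup>+ y. indicator (- A) y * f y \<partial>\<kappa> x) ^^ t) (\<lambda>_. 1)"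

lemma avoid_prob_0: "avoid_prob \<kappa> A 0 x = 1"
  by (simp add: avoid_prob_def)

lemma avoid_prob_Suc:
  "avoid_prob \<kappa> A (Suc t) x = (\<integral>\<^sup>+ y. indicator (- A) y * avoid_prob \<kappa> A t y \<partial>\<kappa> x)"
  by (simp add: avoid_prob_def)

lemma borel_measurable_indicator_Compl[measurable]:
  "A \<in> sets M \<Longrightarrow> (indicator (- A) :: _ \<Rightarrow> ennreal) \<in> borel_measurable M"
  by (subst measurable_cong[where g="\<lambda>x. 1 - indicator A x"]) (auto simp: indicator_def)

lemma markov_chain_law_avoid:
  assumes law: "markov_chain_law M \<kappa> x P" and \<kappa>: "\<kappa> \<in> M \<rightarrow>\<^sub>M prob_algebra M"
    and x: "x \<in> space M" and A[measurable]: "A \<in> sets M"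
  shows "emeasure P {\<omega> \<in> space P. \<forall>s\<in>{1..t}. \<omega> s \<notin> A} = avoid_prob \<kappa> A t x"
proof -
  have sP: "sets P = sets (Pi\<^sub>M UNIV (\<lambda>_. M))" and init: "distr P M (\<lambda>\<omega>. \<omega> 0) = return M x"
    using law unfolding markov_chain_law_def by auto
  have [measurable]: "\<kappa> \<in> M \<rightarrow>\<^sub>M subprob_algebra M" by (rule measurable_prob_algebraD[OF \<kappa>])
  have [measurable]: "(\<lambda>\<omega>. \<omega> s) \<in> P \<rightarrow>\<^sub>M M" for s
    unfolding measurable_cong_sets[OF sP refl] by measurable
  have in_M: "\<omega> \<in> space P \<Longrightarrow> \<omega> s \<in> space M" for \<omega> s
    using sets_eq_imp_space_eq[OF sP] by (auto simp: space_PiM)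
  \<comment> \<open>The induction peels off the last transition, which replaces the terminal
    function \<open>f\<close> by its image under the taboo operator; hence \<open>f\<close> is
    arbitrary. The new application is innermost, so the iterate is unfolded from the right.\<close>
  have gen: "(\<integral>\<^sup>+ \<omega>. indicator {\<omega>. \<forall>s\<in>{1..t}. \<omega> s \<notin> A} \<omega> * f (\<omega> t) \<partial>P) =
      ((\<lambda>f x. \<integral>\<^sup>+ y. indicator (- A) y * f y \<partial>\<kappa> x) ^^ t) f x"
    if f: "f \<in> borel_measurable M" for f t
    using f
  proof (induction t arbitrary: f)
    case 0
    have "(\<integral>\<^sup>+ \<omega>. f (\<omega> 0) \<partial>P) = (\<integral>\<^sup>+ y. f y \<partial>distr P M (\<lambda>\<omega>. \<omega> 0))"
      using 0 by (subst nn_integral_distr) auto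
    also have "\<dots> = f x" unfolding init using 0 x by (simp add: nn_integral_return)
    finally show ?case by simp
  next
    case (Suc t)
    note [measurable] = Suc.prems
    define B where "B = {\<omega> \<in> space (Pi\<^sub>M {..t} (\<lambda>_. M)). \<forall>s\<in>{1..t}. \<omega> s \<notin> A}"
    have "\<And>s. s \<in> {1..t} \<Longrightarrow> (\<lambda>\<omega>. \<omega> s) \<in> Pi\<^sub>M {..t} (\<lambda>_. M) \<rightarrow>\<^sub>M M" by measurable
    then have B: "B \<in> sets (Pi\<^sub>M {..t} (\<lambda>_. M))" unfolding B_def
      by (intro sets.sets_Collect_finite_All sets.sets_Collect_neg) (auto intro: measurable_sets_Collect)
    have mB: "restrict \<omega> {..t} \<in> B \<longleftrightarrow> (\<forall>s\<in>{Suc 0..t}. \<omega> s \<notin> A)" 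
      if "\<omega> \<in> space P" for \<omega>
      using in_M[OF that] by (auto simp: B_def space_PiM)
    have iB: "indicator B (restrict \<omega> {..t}) = indicator {\<omega>. \<forall>s\<in>{1..t}. \<omega> s \<notin> A} \<omega>" 
      if "\<omega> \<in> space P" for \<omega>
      using mB[OF that] by (auto simp: indicator_def)
    have f': "(\<lambda>y. indicator (- A) y * f y) \<in> borel_measurable M" by measurable
    have "(\<integral>\<^sup>+ \<omega>. indicator {\<omega>. \<forall>s\<in>{1..Suc t}. \<omega> s \<notin> A} \<omega> * f (\<omega> (Suc t)) \<partial>P) =
       (\<integral>\<^sup>+ \<omega>. indicator B (restrict \<omega> {..t}) * (indicator (- A) (\<omega> (Suc t)) * f (\<omega> (Suc t))) \<partial>P)"
      by (intro nn_integral_cong) (auto simp: mB indicator_def atLeastAtMostSuc_conv)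
    also have "\<dots> = (\<integral>\<^sup>+ \<omega>. indicator {\<omega>. \<forall>s\<in>{1..t}. \<omega> s \<notin> A} \<omega> * 
         (\<integral>\<^sup>+ y. indicator (- A) y * f y \<partial>\<kappa> (\<omega> t)) \<partial>P)"
      unfolding markov_chain_law_nn_integral_step[OF law \<kappa> B f']
      by (intro nn_integral_cong) (auto simp: iB)
    also have "\<dots> = ((\<lambda>f x. \<integral>\<^sup>+ y. indicator (- A) y * f y \<partial>\<kappa> x) ^^ t)
        (\<lambda>x. \<integral>\<^sup>+ y. indicator (- A) y * f y \<partial>\<kappa> x) x"
      by (rule Suc.IH) measurable
    also have "\<dots> = ((\<lambda>f x. \<integral>\<^sup>+ y. indicator (- A) y * f y \<partial>\<kappa> x) ^^ Suc t) f x"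
      by (subst funpow_Suc_right) simp
    finally show ?case .
  qed
  have "emeasure P {\<omega> \<in> space P. \<forall>s\<in>{1..t}. \<omega> s \<notin> A} =
      (\<integral>\<^sup>+ \<omega>. indicator {\<omega> \<in> space P. \<forall>s\<in>{1..t}. \<omega> s \<notin> A} \<omega> \<partial>P)"
    by (rule nn_integral_indicator[symmetric]) measurable
  also have "\<dots> = (\<integral>\<^sup>+ \<omega>. indicator {\<omega>. \<forall>s\<in>{1..t}. \<omega> s \<notin> A} \<omega> * 1 \<partial>P)"
    by (intro nn_integral_cong) (auto simp: indicator_def)
  also have "\<dots> = avoid_prob \<kappa> A t x"
    unfolding avoid_prob_def by (rule gen) simp
  finally show ?thesis .
qed

text \<open>The probability \<open>h\<close> of never visiting \<open>A\<close> satisfies \<open>h x = \<integral> 1\<^sub>-\<^sub>A h d\<kappa> x\<close>, so invariance forces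
  \<open>\<integral>\<^sub>A h d\<pi> = 0\<close>. A single zero of \<open>h\<close> then makes \<open>1\<^sub>-\<^sub>A h\<close> vanish almost everywhere for all the
  mutually absolutely continuous transition probabilities.\<close>
theorem Harris_recurrent_if_invariant:
  assumes \<kappa>: "\<kappa> \<in> M \<rightarrow>\<^sub>M prob_algebra M" and x0: "x0 \<in> space M"
    and ac: "\<And>x y A. x \<in> space M \<Longrightarrow> y \<in> space M \<Longrightarrow> A \<in> sets M \<Longrightarrow> emeasure (\<kappa> x) A = 0 \<Longrightarrow> emeasure (\<kappa> y) A = 0"
    and sets_\<pi>: "sets \<pi> = sets M" and fin: "emeasure \<pi> (space M) < \<infinity>" and nz: "emeasure \<pi> (space M) \<noteq> 0"
    and inv: "\<And>A. A \<in> sets M \<Longrightarrow> (\<integral>\<^sup>+ x. emeasure (\<kappa> x) A \<partial>\<pi>) = emeasure \<pi> A"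
  shows "Harris_recurrent M \<kappa>"
proof -
  have ks: "\<kappa> \<in> M \<rightarrow>\<^sub>M subprob_algebra M" by (rule measurable_prob_algebraD[OF \<kappa>])
  note [measurable] = ks
  note [measurable_cong] = sets_\<pi>
  have sp\<pi>: "space \<pi> = space M" by (rule sets_eq_imp_space_eq[OF sets_\<pi>])
  have pk: "prob_space (\<kappa> x)" and sk: "sets (\<kappa> x) = sets M" if "x \<in> space M" for x
    using measurable_space[OF \<kappa> that] by (auto simp: space_prob_algebra)
  have ac0: "emeasure (\<kappa> y) A = 0 \<longleftrightarrow> emeasure (\<kappa> x0) A = 0" if "y \<in> space M" "A \<in> sets M" for y A
    using ac x0 that by blast
  have ks\<pi>: "\<kappa> \<in> \<pi> \<rightarrow>\<^sub>M subprob_algebra M" using ks by (simp cong: measurable_cong_sets)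
  have bind: "\<pi> \<bind> \<kappa> = \<pi>"
  proof (rule measure_eqI)
    show "sets (\<pi> \<bind> \<kappa>) = sets \<pi>" using x0 sk
      by (subst sets_bind[where N=M]) (auto simp: sp\<pi> sets_\<pi>)
    fix A assume "A \<in> sets (\<pi> \<bind> \<kappa>)"
    then have A: "A \<in> sets M" using x0 sk by (subst (asm) sets_bind[where N=M]) (auto simp: sp\<pi>)
    show "emeasure (\<pi> \<bind> \<kappa>) A = emeasure \<pi> A"
      using x0 by (subst emeasure_bind[OF _ ks\<pi> A]) (auto simp: sp\<pi> inv[OF A])
  qed
  have inv_f: "(\<integral>\<^sup>+ x. (\<integral>\<^sup>+ y. f y \<partial>\<kappa> x) \<partial>\<pi>) = (\<integral>\<^sup>+ x. f x \<partial>\<pi>)" if f: "f \<in> borel_measurable M" for f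
    using nn_integral_bind[OF f ks\<pi>] bind by simp
  \<comment> \<open>The measure \<phi> of Harris recurrence is the transition probability
    \<open>\<kappa> x0\<close>. Any other base point gives the same null sets.\<close>
  have hit: "AE \<omega> in P. \<exists>t\<ge>1. \<omega> t \<in> A"
    if x: "x \<in> space M" and law: "markov_chain_law M \<kappa> x P"
      and A[measurable]: "A \<in> sets M" and pos: "emeasure (\<kappa> x0) A > 0" for x P A
  proof -
    have apm[measurable]: "avoid_prob \<kappa> A t \<in> borel_measurable M" for t
    proof (induction t)
      case 0 then show ?case by (simp add: avoid_prob_0 cong: measurable_cong)
    next
      case (Suc t)
      note [measurable] = Suc
      show ?case unfolding avoid_prob_Suc[abs_def] by measurable
    qed
    have ap_le: "avoid_prob \<kappa> A t y \<le> 1" if "y \<in> space M" for t y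
      using that
    proof (induction t arbitrary: y)
      case (Suc t)
      have "avoid_prob \<kappa> A (Suc t) y \<le> (\<integral>\<^sup>+ y. 1 \<partial>\<kappa> y)"
        unfolding avoid_prob_Suc using Suc.IH sets_eq_imp_space_eq[OF sk[OF Suc.prems]]
        by (intro nn_integral_mono) (auto simp: indicator_def)
      also have "\<dots> = 1" using prob_space.emeasure_space_1[OF pk[OF Suc.prems]] by simp
      finally show ?case .
    qed (simp add: avoid_prob_0)
    have dec: "avoid_prob \<kappa> A (Suc t) y \<le> avoid_prob \<kappa> A t y" if "y \<in> space M" for t y
      using that
    proof (induction t arbitrary: y)
      case 0 then show ?case using ap_le[OF 0] by (simp add: avoid_prob_0)
    next
      case (Suc t)
      show ?case unfolding avoid_prob_Suc[of _ _ "Suc t"] avoid_prob_Suc[of _ _ t y]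
        using Suc.IH sets_eq_imp_space_eq[OF sk[OF Suc.prems]]
        by (intro nn_integral_mono) (auto simp: indicator_def)
    qed
    define h where "h y = (INF t. avoid_prob \<kappa> A t y)" for y
    have hm[measurable]: "h \<in> borel_measurable M" unfolding h_def by measurable
    \<comment> \<open>The recursion passes to the limit by monotone convergence from above, for
      which the first integral must be finite; \<open>ap_le\<close> bounds it by 1.\<close>
    have h_eq: "h y = (\<integral>\<^sup>+ u. indicator (- A) u * h u \<partial>\<kappa> y)" if y: "y \<in> space M" for y
    proof -
      have spk: "space (\<kappa> y) = space M" by (rule sets_eq_imp_space_eq[OF sk[OF y]])
      have [measurable]: "avoid_prob \<kappa> A t \<in> borel_measurable (\<kappa> y)" for t
        using apm unfolding measurable_cong_sets[OF sk[OF y] refl] .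
      have [measurable]: "A \<in> sets (\<kappa> y)" using A sk[OF y] by simp
      have decI: "decseq (\<lambda>t. avoid_prob \<kappa> A t y)" using dec[OF y] by (rule decseq_SucI)
      have "h y = (INF t. avoid_prob \<kappa> A (Suc t) y)"
        unfolding h_def
        by (rule INF_eq) (use decI ap_le[OF y] in \<open>auto simp: decseq_def\<close>, meson le_SucI order_refl)
      also have "\<dots> = (INF t. \<integral>\<^sup>+ u. indicator (- A) u * avoid_prob \<kappa> A t u \<partial>\<kappa> y)"
        by (simp add: avoid_prob_Suc)
      also have "\<dots> = (\<integral>\<^sup>+ u. (INF t. indicator (- A) u * avoid_prob \<kappa> A t u) \<partial>\<kappa> y)"
      proof (rule nn_integral_monotone_convergence_INF_AE'[symmetric])
        show "AE u in \<kappa> y. indicator (- A) u * avoid_prob \<kappa> A (Suc i) u \<le> indicator (- A) u * avoid_prob \<kappa> A i u" for i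
          using dec by (intro AE_I2) (auto simp: spk indicator_def)
        have "(\<integral>\<^sup>+ u. indicator (- A) u * avoid_prob \<kappa> A 0 u \<partial>\<kappa> y) = avoid_prob \<kappa> A 1 y"
          by (simp add: avoid_prob_Suc)
        also have "\<dots> < \<infinity>" using ap_le[OF y, of 1] by (auto simp: less_top[symmetric] top_unique)
        finally show "(\<integral>\<^sup>+ u. indicator (- A) u * avoid_prob \<kappa> A 0 u \<partial>\<kappa> y) < \<infinity>" .
      qed measurable
      also have "\<dots> = (\<integral>\<^sup>+ u. indicator (- A) u * h u \<partial>\<kappa> y)"
        by (intro nn_integral_cong) (auto simp: h_def indicator_def)
      finally show ?thesis .
    qed
    have h_le: "h y \<le> 1" if "y \<in> space M" for y
      unfolding h_def using ap_le[OF that, of 0] by (rule INF_lower2[rotated]) simp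
    have "(\<integral>\<^sup>+ y. h y \<partial>\<pi>) = (\<integral>\<^sup>+ y. (\<integral>\<^sup>+ u. indicator (- A) u * h u \<partial>\<kappa> y) \<partial>\<pi>)"
      by (intro nn_integral_cong) (simp add: sp\<pi> h_eq[symmetric])
    also have "\<dots> = (\<integral>\<^sup>+ y. indicator (- A) y * h y \<partial>\<pi>)" by (rule inv_f) measurable
    finally have e1: "(\<integral>\<^sup>+ y. h y \<partial>\<pi>) = (\<integral>\<^sup>+ y. indicator (- A) y * h y \<partial>\<pi>)" .
    have "(\<integral>\<^sup>+ y. h y \<partial>\<pi>) \<le> (\<integral>\<^sup>+ y. 1 \<partial>\<pi>)" using h_le by (intro nn_integral_mono) (simp add: sp\<pi>)
    \<comment> \<open>Finiteness of the invariant measure is what permits cancelling this integral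
      in \<open>ennreal\<close>.\<close>
    then have fin_h: "(\<integral>\<^sup>+ y. indicator (- A) y * h y \<partial>\<pi>) \<noteq> \<infinity>" using fin e1 by (auto simp: sp\<pi> top_unique)
    have "(\<integral>\<^sup>+ y. h y \<partial>\<pi>) = (\<integral>\<^sup>+ y. indicator A y * h y + indicator (- A) y * h y \<partial>\<pi>)"
      by (intro nn_integral_cong) (auto simp: indicator_def)
    also have "\<dots> = (\<integral>\<^sup>+ y. indicator A y * h y \<partial>\<pi>) + (\<integral>\<^sup>+ y. indicator (- A) y * h y \<partial>\<pi>)"
      by (rule nn_integral_add) measurable
    finally have "(\<integral>\<^sup>+ y. indicator A y * h y \<partial>\<pi>) = 0"
      using e1 fin_h ennreal_add_left_cancel[of "\<integral>\<^sup>+ y. indicator (- A) y * h y \<partial>\<pi>" _ 0]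
      by (simp add: add.commute)
    then have ae0: "AE y in \<pi>. indicator A y * h y = 0" by (subst (asm) nn_integral_0_iff_AE) auto
    \<comment> \<open>A set charged by \<open>\<kappa> x0\<close> is charged from every state, so
      invariance gives it positive \<pi>-measure. Since \<open>h\<close> vanishes \<pi>-almost
      everywhere on \<open>A\<close>, it then has an actual zero there.\<close>
    have "emeasure \<pi> A \<noteq> 0"
    proof
      assume "emeasure \<pi> A = 0"
      then have "(\<integral>\<^sup>+ y. emeasure (\<kappa> y) A \<partial>\<pi>) = 0" by (simp add: inv)
      then have "AE y in \<pi>. emeasure (\<kappa> y) A = 0"
        by (subst (asm) nn_integral_0_iff_AE) auto
      then have "AE y in \<pi>. False"
        by (rule AE_mp) (use ac0[OF _ A] pos in \<open>auto simp: sp\<pi> intro!: AE_I2\<close>)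
      then show False using nz by (subst (asm) AE_iff_measurable[where N="space \<pi>"]) (auto simp: sp\<pi>)
    qed
    then have "\<exists>y\<in>A. h y = 0"
    proof (rule contrapos_np)
      assume "\<not> (\<exists>y\<in>A. h y = 0)"
      then have "AE y in \<pi>. y \<notin> A" using ae0 by (auto elim!: AE_mp simp: indicator_def intro!: AE_I2)
      then show "emeasure \<pi> A = 0"
        using sets.sets_into_space[OF A] by (subst (asm) AE_iff_measurable[where N=A]) (auto simp: sp\<pi>)
    qed
    then obtain y where y: "y \<in> A" "h y = 0" by auto
    then have yM: "y \<in> space M" using sets.sets_into_space[OF A] by auto
    have zero: "(\<integral>\<^sup>+ u. indicator (- A) u * h u \<partial>\<kappa> v) = 0 \<longleftrightarrow>
       emeasure (\<kappa> v) {u \<in> space M. indicator (- A) u * h u \<noteq> 0} = 0" if v: "v \<in> space M" for v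
    proof -
      have "(\<lambda>u. indicator (- A) u * h u) \<in> borel_measurable M" by measurable
      then have "(\<lambda>u. indicator (- A) u * h u) \<in> borel_measurable (\<kappa> v)"
        unfolding measurable_cong_sets[OF sk[OF v] refl] .
      then show ?thesis using sets_eq_imp_space_eq[OF sk[OF v]] by (subst nn_integral_0_iff) auto
    qed
    have "emeasure (\<kappa> y) {u \<in> space M. indicator (- A) u * h u \<noteq> 0} = 0"
      using zero[OF yM] h_eq[OF yM] y by simp
    then have "emeasure (\<kappa> x) {u \<in> space M. indicator (- A) u * h u \<noteq> 0} = 0"
      by (intro ac[OF yM x]) measurable
    then have hx: "h x = 0" using zero[OF x] h_eq[OF x] by simp
    have sP: "sets P = sets (Pi\<^sub>M UNIV (\<lambda>_. M))" using law unfolding markov_chain_law_def by auto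
    have [measurable]: "(\<lambda>\<omega>. \<omega> s) \<in> P \<rightarrow>\<^sub>M M" for s
      unfolding measurable_cong_sets[OF sP refl] by measurable
    have "emeasure P {\<omega> \<in> space P. \<not> (\<exists>t\<ge>1. \<omega> t \<in> A)} \<le> avoid_prob \<kappa> A t x" for t
      unfolding markov_chain_law_avoid[OF law \<kappa> x A, symmetric]
      by (rule emeasure_mono) auto
    then have "emeasure P {\<omega> \<in> space P. \<not> (\<exists>t\<ge>1. \<omega> t \<in> A)} \<le> h x"
      unfolding h_def by (rule INF_greatest)
    then have "emeasure P {\<omega> \<in> space P. \<not> (\<exists>t\<ge>1. \<omega> t \<in> A)} = 0" using hx by simp
    then show ?thesis by (subst AE_iff_measurable[OF _ refl]) auto
  qed
  have "sigma_finite_measure (\<kappa> x0)"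
    using pk[OF x0] by (simp add: prob_space_def finite_measure.sigma_finite_measure)
  moreover have "emeasure (\<kappa> x0) (space (\<kappa> x0)) \<noteq> 0"
    using prob_space.emeasure_space_1[OF pk[OF x0]] by simp
  ultimately show ?thesis unfolding Harris_recurrent_def
    using \<kappa> sk[OF x0] hit by blast
qed

section \<open>Normalized kernels and data augmentation\<close>

lemma sets_normalized[simp, measurable_cong]: "sets (normalized N) = sets N"
  and space_normalized[simp]: "space (normalized N) = space N"
  by (simp_all add: normalized_def space_scale_measure)

lemma nn_integral_normalized_density:
  assumes f: "f \<in> borel_measurable N" and g: "g \<in> borel_measurable N"
  shows "(\<integral>\<^sup>+ x. g x \<partial>normalized (density N f)) = inverse (\<integral>\<^sup>+ x. f x \<partial>N) * (\<integral>\<^sup>+ x. f x * g x \<partial>N)"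
proof -
  have "emeasure (density N f) (space (density N f)) = (\<integral>\<^sup>+ x. f x \<partial>N)"
    using f by (simp add: emeasure_density cong: nn_integral_cong)
  then show ?thesis
    using f g by (simp add: normalized_def nn_integral_scale_measure nn_integral_density)
qed

lemma emeasure_normalized_density:
  assumes f: "f \<in> borel_measurable N" and A: "A \<in> sets N"
  shows "emeasure (normalized (density N f)) A = inverse (\<integral>\<^sup>+ x. f x \<partial>N) * (\<integral>\<^sup>+ x. f x * indicator A x \<partial>N)"
  using nn_integral_normalized_density[OF f, of "indicator A"] A by simp

lemma ennreal_inverse_mult_self: "0 < k \<Longrightarrow> k < \<infinity> \<Longrightarrow> inverse k * k = (1 :: ennreal)"
  by (metis divide_ennreal_def ennreal_divide_self infinity_ennreal_def mult.commute less_irrefl order.strict_implies_not_eq)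

text \<open>Through this the powers of \<open>2 * pi\<close>, the prior and the determinants
  disappear from the conditional distributions of the chain.\<close>

lemma normalized_density_cmult:
  assumes f: "f \<in> borel_measurable N" and k: "0 < k" "k < \<infinity>"
  shows "normalized (density N (\<lambda>x. k * f x)) = normalized (density N f)"
proof (rule measure_eqI)
  fix A assume "A \<in> sets (normalized (density N (\<lambda>x. k * f x)))"
  then have A: "A \<in> sets N" by simp
  have k': "inverse k * k = 1" by (rule ennreal_inverse_mult_self[OF k])
  have "emeasure (normalized (density N (\<lambda>x. k * f x))) A =
    inverse (k * (\<integral>\<^sup>+ x. f x \<partial>N)) * (k * (\<integral>\<^sup>+ x. f x * indicator A x \<partial>N))"
    using f A k by (simp add: emeasure_normalized_density nn_integral_cmult mult.assoc)
  also have "inverse (k * (\<integral>\<^sup>+ x. f x \<partial>N)) = inverse k * inverse (\<integral>\<^sup>+ x. f x \<partial>N)"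
    using k by (intro ennreal_inverse_mult') auto
  also have "\<dots> * (k * (\<integral>\<^sup>+ x. f x * indicator A x \<partial>N)) =
     (inverse k * k) * (inverse (\<integral>\<^sup>+ x. f x \<partial>N) * (\<integral>\<^sup>+ x. f x * indicator A x \<partial>N))"
    by (simp add: mult_ac)
  also have "\<dots> = emeasure (normalized (density N f)) A"
    using f A by (simp add: k' emeasure_normalized_density)
  finally show "emeasure (normalized (density N (\<lambda>x. k * f x))) A = emeasure (normalized (density N f)) A" .
qed simp

text \<open>The bounds on the mass are required at every point of \<open>M\<close>, since each value
  of the kernel must be a probability measure. Measurability comes from writing the mass of a set as
  a quotient of two parameter integrals.\<close>

lemma measurable_normalized_density:
  assumes "sigma_finite_measure N"
    and f: "(\<lambda>(x, y). f x y) \<in> borel_measurable (M \<Otimes>\<^sub>M N)"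
    and pos: "\<And>x. x \<in> space M \<Longrightarrow> 0 < (\<integral>\<^sup>+ y. f x y \<partial>N)"
    and fin: "\<And>x. x \<in> space M \<Longrightarrow> (\<integral>\<^sup>+ y. f x y \<partial>N) < \<infinity>"
  shows "(\<lambda>x. normalized (density N (f x))) \<in> M \<rightarrow>\<^sub>M prob_algebra N"
proof (rule measurable_prob_algebra_generated[where \<Omega>="space N" and G="sets N"])
  interpret N: sigma_finite_measure N by fact
  note [measurable] = f
  have fx: "f x \<in> borel_measurable N" if "x \<in> space M" for x
    using measurable_compose[OF measurable_Pair1'[OF that] f] by simp
  show "sets N = sigma_sets (space N) (sets N)" by (simp add: sets.sigma_sets_eq)
  show "Int_stable (sets N)" by (simp add: Int_stable_def sets.Int)
  show "sets N \<subseteq> Pow (space N)" using sets.sets_into_space by auto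
  fix x assume x: "x \<in> space M"
  show "sets (normalized (density N (f x))) = sets N" by simp
  show "prob_space (normalized (density N (f x)))"
  proof
    have "emeasure (normalized (density N (f x))) (space N) = inverse (\<integral>\<^sup>+ y. f x y \<partial>N) * (\<integral>\<^sup>+ y. f x y \<partial>N)"
      using fx[OF x] by (simp add: emeasure_normalized_density cong: nn_integral_cong)
    then show "emeasure (normalized (density N (f x))) (space (normalized (density N (f x)))) = 1"
      using ennreal_inverse_mult_self[OF pos[OF x] fin[OF x]] by simp
  qed
next
  interpret N: sigma_finite_measure N by fact
  note [measurable] = f
  fix A assume A[measurable]: "A \<in> sets N"
  have fx: "f x \<in> borel_measurable N" if "x \<in> space M" for x
    using measurable_compose[OF measurable_Pair1'[OF that] f] by simp
  have "(\<lambda>x. inverse (\<integral>\<^sup>+ y. f x y \<partial>N) * (\<integral>\<^sup>+ y. f x y * indicator A y \<partial>N)) \<in> borel_measurable M"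
    by measurable
  then show "(\<lambda>x. emeasure (normalized (density N (f x))) A) \<in> borel_measurable M"
    by (rule measurable_cong[THEN iffD1, rotated]) (simp add: emeasure_normalized_density fx)
qed

text \<open>Here \<open>f\<close> is the joint density of the parameter and the augmented data \<open>v\<close>; the chain draws \<open>v\<close>
  given the parameter and then the parameter given \<open>v\<close> by \<open>Q v\<close>. Its invariant measure is the first
  marginal of \<open>f\<close>, and the null sets of \<open>\<kappa> \<theta>\<close> do not depend on \<open>\<theta>\<close> because \<open>f > 0\<close>.\<close>
theorem data_augmentation_Harris_recurrent:
  fixes f :: "'s \<Rightarrow> 'v \<Rightarrow> ennreal"
  assumes M: "sigma_finite_measure M" and V: "sigma_finite_measure V" and v0: "space V \<noteq> {}"
    and f[measurable]: "(\<lambda>(\<theta>, v). f \<theta> v) \<in> borel_measurable (M \<Otimes>\<^sub>M V)"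
    and f_pos: "\<And>\<theta> v. \<theta> \<in> space M \<Longrightarrow> v \<in> space V \<Longrightarrow> f \<theta> v > 0"
    and T_pos: "\<And>\<theta>. \<theta> \<in> space M \<Longrightarrow> 0 < (\<integral>\<^sup>+ v. f \<theta> v \<partial>V)"
    and T_fin: "\<And>\<theta>. \<theta> \<in> space M \<Longrightarrow> (\<integral>\<^sup>+ v. f \<theta> v \<partial>V) < \<infinity>"
    and total: "(\<integral>\<^sup>+ \<theta>. (\<integral>\<^sup>+ v. f \<theta> v \<partial>V) \<partial>M) < \<infinity>"
    and Q: "Q \<in> V \<rightarrow>\<^sub>M prob_algebra M"
    and Q_eq: "\<And>v. v \<in> space V \<Longrightarrow> (\<integral>\<^sup>+ \<theta>. f \<theta> v \<partial>M) < \<infinity> \<Longrightarrow> Q v = normalized (density M (\<lambda>\<theta>. f \<theta> v))"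
    and \<kappa>: "\<kappa> \<in> M \<rightarrow>\<^sub>M prob_algebra M"
    and \<kappa>_eq: "\<And>\<theta> A. \<theta> \<in> space M \<Longrightarrow> A \<in> sets M \<Longrightarrow>
      emeasure (\<kappa> \<theta>) A = inverse (\<integral>\<^sup>+ v. f \<theta> v \<partial>V) * (\<integral>\<^sup>+ v. f \<theta> v * emeasure (Q v) A \<partial>V)"
  shows "Harris_recurrent M \<kappa>"
proof -
  interpret M: sigma_finite_measure M by fact
  interpret V: sigma_finite_measure V by fact
  interpret MV: pair_sigma_finite M V ..
  have Qs[measurable]: "Q \<in> V \<rightarrow>\<^sub>M subprob_algebra M" by (rule measurable_prob_algebraD[OF Q])
  have fV[measurable]: "f \<theta> \<in> borel_measurable V" if "\<theta> \<in> space M" for \<theta>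
    using measurable_compose[OF measurable_Pair1'[OF that] f] by simp
  have fM[measurable]: "(\<lambda>\<theta>. f \<theta> v) \<in> borel_measurable M" if "v \<in> space V" for v
    using measurable_compose[OF measurable_Pair2'[OF that] f] by simp
  have QA[measurable]: "(\<lambda>v. emeasure (Q v) A) \<in> borel_measurable V" if "A \<in> sets M" for A
    using that by measurable
  \<comment> \<open>\<open>T\<close> is the normalizing constant for the draw of \<open>v\<close>
    and also the density of the invariant measure; \<open>S\<close> is the constant for the draw of
    \<theta>. Both have the same total integral, so \<open>S\<close> is finite almost everywhere,
    though it may be infinite somewhere.\<close>
  define T where "T \<theta> = (\<integral>\<^sup>+ v. f \<theta> v \<partial>V)" for \<theta>
  define S where "S v = (\<integral>\<^sup>+ \<theta>. f \<theta> v \<partial>M)" for v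
  have T[measurable]: "T \<in> borel_measurable M" unfolding T_def by measurable
  have S[measurable]: "S \<in> borel_measurable V" unfolding S_def by measurable
  define \<pi> where "\<pi> = density M T"
  \<comment> \<open>The state space is nonempty because it carries the probability measure
    \<open>Q v\<close>.\<close>
  obtain v where v: "v \<in> space V" using v0 by auto
  have "prob_space (Q v)" "sets (Q v) = sets M" using measurable_space[OF Q v] by (auto simp: space_prob_algebra)
  then obtain \<theta>0 where \<theta>0: "\<theta>0 \<in> space M" using prob_space.not_empty sets_eq_imp_space_eq by blast
  have ST: "(\<integral>\<^sup>+ v. S v \<partial>V) = (\<integral>\<^sup>+ \<theta>. T \<theta> \<partial>M)"
    unfolding S_def T_def by (rule MV.Fubini') measurable
  have S_fin: "AE v in V. S v < \<infinity>"
    using nn_integral_PInf_AE[OF S] ST total by (auto simp: T_def less_top[symmetric])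
  \<comment> \<open>If \<open>S v\<close> were 0, then \<open>Q v\<close> would be the zero measure:
    in \<open>ennreal\<close>, \<open>inverse 0\<close> is infinite and its product with 0 is
    0.\<close>
  have S_pos: "S v > 0" if v: "v \<in> space V" and fin: "S v < \<infinity>" for v
  proof (rule ccontr)
    assume "\<not> S v > 0"
    then have z: "(\<integral>\<^sup>+ \<theta>. f \<theta> v \<partial>M) = 0" by (simp add: S_def)
    have "emeasure (Q v) (space M) = 1"
      using measurable_space[OF Q v] prob_space.emeasure_space_1[of "Q v"] sets_eq_imp_space_eq[of "Q v" M]
      by (auto simp: space_prob_algebra)
    moreover have "emeasure (Q v) (space M) = inverse (\<integral>\<^sup>+ \<theta>. f \<theta> v \<partial>M) * (\<integral>\<^sup>+ \<theta>. f \<theta> v \<partial>M)"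
      using Q_eq[OF v] fin fM[OF v] by (simp add: S_def emeasure_normalized_density cong: nn_integral_cong)
    ultimately show False using z by simp
  qed
  show ?thesis
  proof (rule Harris_recurrent_if_invariant[OF \<kappa> \<theta>0, of \<pi>])
    fix \<theta> \<theta>' A assume \<theta>: "\<theta> \<in> space M" "\<theta>' \<in> space M" and A[measurable]: "A \<in> sets M" and z: "emeasure (\<kappa> \<theta>) A = 0"
    have iff: "emeasure (\<kappa> t) A = 0 \<longleftrightarrow> (AE v in V. emeasure (Q v) A = 0)" if t: "t \<in> space M" for t
    proof -
      note [measurable] = fV[OF t]
      have "inverse (\<integral>\<^sup>+ v. f t v \<partial>V) \<noteq> 0" using T_fin[OF t] by simp
      then have "emeasure (\<kappa> t) A = 0 \<longleftrightarrow> (\<integral>\<^sup>+ v. f t v * emeasure (Q v) A \<partial>V) = 0"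
        unfolding \<kappa>_eq[OF t A] by simp
      also have "\<dots> \<longleftrightarrow> (AE v in V. f t v * emeasure (Q v) A = 0)"
        by (rule nn_integral_0_iff_AE) measurable
      also have "\<dots> \<longleftrightarrow> (AE v in V. emeasure (Q v) A = 0)"
        by (rule AE_cong) (use f_pos[OF t] in \<open>metis less_irrefl mult_eq_0_iff\<close>)
      finally show ?thesis .
    qed
    show "emeasure (\<kappa> \<theta>') A = 0" using z iff \<theta> by blast
  next
    show "sets \<pi> = sets M" by (simp add: \<pi>_def)
    have \<pi>sp: "emeasure \<pi> (space M) = (\<integral>\<^sup>+ \<theta>. T \<theta> \<partial>M)"
      by (simp add: \<pi>_def emeasure_density cong: nn_integral_cong)
    then show "emeasure \<pi> (space M) < \<infinity>" using total by (simp add: T_def)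
    \<comment> \<open>\<open>S\<close> is positive wherever it is finite, hence almost everywhere.
      It can vanish almost everywhere only if \<open>V\<close> is the null measure, which
      \<open>T_pos\<close> excludes.\<close>
    show "emeasure \<pi> (space M) \<noteq> 0"
    proof
      assume "emeasure \<pi> (space M) = 0"
      then have "(\<integral>\<^sup>+ v. S v \<partial>V) = 0" using \<pi>sp ST by simp
      then have "AE v in V. S v = 0" by (subst (asm) nn_integral_0_iff_AE) auto
      then have "AE v in V. False" using S_fin AE_space
        by eventually_elim (use S_pos in force)
      then have "AE v in V. f \<theta>0 v = 0" by auto
      then have "(\<integral>\<^sup>+ v. f \<theta>0 v \<partial>V) = 0" using fV[OF \<theta>0] by (subst nn_integral_0_iff_AE) auto
      then show False using T_pos[OF \<theta>0] by simp
    qed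
    fix A assume A[measurable]: "A \<in> sets M"
    have Aeq: "T \<theta> * emeasure (\<kappa> \<theta>) A = (\<integral>\<^sup>+ v. f \<theta> v * emeasure (Q v) A \<partial>V)" if t: "\<theta> \<in> space M" for \<theta>
    proof -
      have "T \<theta> * inverse (T \<theta>) = 1"
        using ennreal_inverse_mult_self[of "T \<theta>"] T_pos[OF t] T_fin[OF t] by (simp add: T_def mult.commute)
      then show ?thesis unfolding \<kappa>_eq[OF t A] T_def[symmetric] by (simp flip: mult.assoc)
    qed
    have [measurable]: "\<kappa> \<in> M \<rightarrow>\<^sub>M subprob_algebra M" by (rule measurable_prob_algebraD[OF \<kappa>])
    have "(\<integral>\<^sup>+ \<theta>. emeasure (\<kappa> \<theta>) A \<partial>\<pi>) = (\<integral>\<^sup>+ \<theta>. T \<theta> * emeasure (\<kappa> \<theta>) A \<partial>M)"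
      unfolding \<pi>_def by (rule nn_integral_density) measurable
    also have "\<dots> = (\<integral>\<^sup>+ \<theta>. (\<integral>\<^sup>+ v. f \<theta> v * emeasure (Q v) A \<partial>V) \<partial>M)"
      by (rule nn_integral_cong) (rule Aeq)
    also have "\<dots> = (\<integral>\<^sup>+ v. (\<integral>\<^sup>+ \<theta>. f \<theta> v * emeasure (Q v) A \<partial>M) \<partial>V)"
      by (rule MV.Fubini'[symmetric]) measurable
    \<comment> \<open>Where \<open>S\<close> is finite, \<open>Q v\<close> is the normalized
      conditional and its constant cancels \<open>S v\<close>. The arbitrary values of
      \<open>Q\<close> sit on a null set and do not enter the integral.\<close>
    also have "\<dots> = (\<integral>\<^sup>+ v. (\<integral>\<^sup>+ \<theta>. f \<theta> v * indicator A \<theta> \<partial>M) \<partial>V)"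
    proof (rule nn_integral_cong_AE, rule AE_mp[OF S_fin], rule AE_I2, rule impI)
      fix v assume v: "v \<in> space V" and fin: "S v < \<infinity>"
      note [measurable] = fM[OF v]
      have "(\<integral>\<^sup>+ \<theta>. f \<theta> v * emeasure (Q v) A \<partial>M) = S v * emeasure (Q v) A"
        unfolding S_def by (rule nn_integral_multc) measurable
      also have "\<dots> = (inverse (S v) * S v) * (\<integral>\<^sup>+ \<theta>. f \<theta> v * indicator A \<theta> \<partial>M)"
        using Q_eq[OF v] fin by (simp add: S_def emeasure_normalized_density mult_ac)
      also have "inverse (S v) * S v = 1" by (rule ennreal_inverse_mult_self[OF S_pos[OF v fin] fin])
      finally show "(\<integral>\<^sup>+ \<theta>. f \<theta> v * emeasure (Q v) A \<partial>M) = (\<integral>\<^sup>+ \<theta>. f \<theta> v * indicator A \<theta> \<partial>M)" by simp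
    qed
    also have "\<dots> = (\<integral>\<^sup>+ \<theta>. (\<integral>\<^sup>+ v. f \<theta> v * indicator A \<theta> \<partial>V) \<partial>M)"
      by (rule MV.Fubini') measurable
    also have "\<dots> = (\<integral>\<^sup>+ \<theta>. T \<theta> * indicator A \<theta> \<partial>M)"
      unfolding T_def by (intro nn_integral_cong nn_integral_multc fV)
    also have "\<dots> = emeasure \<pi> A" unfolding \<pi>_def by (rule emeasure_density[symmetric]) measurable
    finally show "(\<integral>\<^sup>+ \<theta>. emeasure (\<kappa> \<theta>) A \<partial>\<pi>) = emeasure \<pi> A" .
  qed
qed

section \<open>Principal submatrices of positive definite matrices\<close>

lemma spd_mats_det_nonzero: assumes A: "A \<in> spd_mats k" shows "det A \<noteq> 0"
proof
  have c: "A \<in> carrier_mat k k" using A by (simp add: spd_mats_def)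
  assume "det A = 0"
  then obtain v where v: "v \<in> carrier_vec k" "v \<noteq> 0\<^sub>v k" "A *\<^sub>v v = 0\<^sub>v k"
    using det_0_iff_vec_prod_zero_field[OF c] by blast
  then have "scalar_prod v (A *\<^sub>v v) > 0" using A unfolding spd_mats_def by blast
  then show False using v by simp
qed

text \<open>\<open>inv_mat\<close> comes from elimination, which succeeds because the adjugate
  divided by the determinant is an inverse; uniqueness of inverses identifies the two. The adjugate
  form makes every entry a rational function of the entries of \<open>A\<close>, as measurability
  requires, and exhibits the diagonal entries as ratios of determinants.\<close>

lemma inv_mat_eq_adj_mat:
  assumes A: "A \<in> carrier_mat k k" and d: "det A \<noteq> 0"
  shows "inv_mat A = (1 / det A) \<cdot>\<^sub>m adj_mat A"
    and "inv_mat A \<in> carrier_mat k k" and "A * inv_mat A = 1\<^sub>m k" and "inv_mat A * A = 1\<^sub>m k"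
proof -
  define B where "B = (1 / det A) \<cdot>\<^sub>m adj_mat A"
  note adj = adj_mat[OF A]
  have B: "B \<in> carrier_mat k k" using adj by (simp add: B_def)
  have AB: "A * B = 1\<^sub>m k" unfolding B_def mult_smult_distrib[OF A adj(1)] adj(2) using d by auto
  have BA: "B * A = 1\<^sub>m k" unfolding B_def mult_smult_assoc_mat[OF adj(1) A] adj(3) using d by auto
  have "A \<in> Units (ring_mat TYPE(real) k ())"
    unfolding Units_def using A B AB BA by (auto simp: ring_mat_simps)
  then obtain C where C: "mat_inverse A = Some C" using mat_inverse(1)[OF A, of "()"] by (cases "mat_inverse A") auto
  then have C': "A * C = 1\<^sub>m k" "C * A = 1\<^sub>m k" "C \<in> carrier_mat k k" using mat_inverse(2)[OF A] by auto
  have "C = B * (A * C)"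
    using BA B A C' by (metis assoc_mult_mat left_mult_one_mat)
  also have "\<dots> = B" using C' B by simp
  finally show "inv_mat A = (1 / det A) \<cdot>\<^sub>m adj_mat A" using C by (simp add: inv_mat_def B_def)
  show "inv_mat A \<in> carrier_mat k k" "A * inv_mat A = 1\<^sub>m k" "inv_mat A * A = 1\<^sub>m k"
    using C' C by (simp_all add: inv_mat_def)
qed

lemma spd_mats_inv_mat:
  assumes "A \<in> spd_mats k"
  shows "inv_mat A \<in> carrier_mat k k" and "A * inv_mat A = 1\<^sub>m k" and "inv_mat A * A = 1\<^sub>m k"
  using inv_mat_eq_adj_mat[OF _ spd_mats_det_nonzero[OF assms]] assms by (auto simp: spd_mats_def)

section \<open>Inserting and deleting one coordinate\<close>

definition insert_vec :: "nat \<Rightarrow> real \<Rightarrow> real vec \<Rightarrow> real vec" where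
  "insert_vec r t u = vec (Suc (dim_vec u)) (\<lambda>i. if i = r then t else u $ delete_index r i)"

definition delete_vec :: "nat \<Rightarrow> real vec \<Rightarrow> real vec" where
  "delete_vec r v = vec (dim_vec v - 1) (\<lambda>a. v $ insert_index r a)"

lemma dim_insert_vec[simp]: "dim_vec (insert_vec r t u) = Suc (dim_vec u)"
  and dim_delete_vec[simp]: "dim_vec (delete_vec r v) = dim_vec v - 1"
  by (simp_all add: insert_vec_def delete_vec_def)

lemma insert_index_less: "a < k \<Longrightarrow> insert_index r a < Suc k"
  by (simp add: insert_index_def)

lemma insert_vec_index[simp]:
  "r < Suc (dim_vec u) \<Longrightarrow> insert_vec r t u $ r = t"
  "a < dim_vec u \<Longrightarrow> insert_vec r t u $ insert_index r a = u $ a"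
  by (simp_all add: insert_vec_def insert_index_less)

lemma sum_insert_index:
  fixes f :: "nat \<Rightarrow> real"
  assumes "r < Suc k"
  shows "sum f {0..<Suc k} = f r + (\<Sum>a\<in>{0..<k}. f (insert_index r a))"
proof -
  have "sum f {0..<Suc k} = f r + sum f ({0..<Suc k} - {r})"
    using assms by (intro sum.remove) auto
  also have "{0..<Suc k} - {r} = insert_index r ` {0..<k}"
    using insert_index_image[OF assms] by simp
  also have "sum f \<dots> = (\<Sum>a\<in>{0..<k}. f (insert_index r a))"
    by (subst sum.reindex) (auto simp: insert_index_inj_on)
  finally show ?thesis .
qed

lemma scalar_prod_insert_vec:
  assumes "r < Suc (dim_vec u)" "dim_vec w = Suc (dim_vec u)"
  shows "scalar_prod (insert_vec r t u) w = t * w $ r + scalar_prod u (delete_vec r w)"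
  unfolding scalar_prod_def assms(2) sum_insert_index[OF assms(1)]
  using assms by (simp add: delete_vec_def)

lemma mat_delete_mult_insert_vec:
  assumes A: "A \<in> carrier_mat (Suc k) (Suc k)" and r: "r < Suc k" and u: "u \<in> carrier_vec k"
  shows "delete_vec r (A *\<^sub>v insert_vec r 0 u) = mat_delete A r r *\<^sub>v u"
proof (rule eq_vecI)
  show "dim_vec (delete_vec r (A *\<^sub>v insert_vec r 0 u)) = dim_vec (mat_delete A r r *\<^sub>v u)"
    using A by simp
  fix a assume "a < dim_vec (mat_delete A r r *\<^sub>v u)"
  then have a: "a < k" using A by simp
  have "delete_vec r (A *\<^sub>v insert_vec r 0 u) $ a = scalar_prod (insert_vec r 0 u) (Matrix.row A (insert_index r a))"
  proof -
    have "delete_vec r (A *\<^sub>v insert_vec r 0 u) $ a = scalar_prod (Matrix.row A (insert_index r a)) (insert_vec r 0 u)"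
      using A a insert_index_less[OF a, of r] by (simp add: delete_vec_def)
    also have "\<dots> = scalar_prod (insert_vec r 0 u) (Matrix.row A (insert_index r a))"
      using A u by (intro comm_scalar_prod[of _ "Suc k"]) (auto intro: carrier_vecI)
    finally show ?thesis .
  qed
  also have "\<dots> = scalar_prod u (delete_vec r (Matrix.row A (insert_index r a)))"
    using A a u r by (subst scalar_prod_insert_vec) auto
  also have "delete_vec r (Matrix.row A (insert_index r a)) = Matrix.row (mat_delete A r r) a"
    using A a r mat_delete_index[OF A r r a] insert_index_less[OF a, of r] insert_index_less[of _ k r]
    by (intro eq_vecI) (auto simp: delete_vec_def)
  also have "scalar_prod u \<dots> = (mat_delete A r r *\<^sub>v u) $ a"
    using A a u by (subst comm_scalar_prod[of _ k]) (auto intro: carrier_vecI)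
  finally show "delete_vec r (A *\<^sub>v insert_vec r 0 u) $ a = (mat_delete A r r *\<^sub>v u) $ a" .
qed

text \<open>The form of the smaller matrix at \<open>v\<close> is the form of \<open>A\<close> at
  \<open>v\<close> with a zero inserted in position \<open>r\<close>.\<close>

lemma spd_mats_mat_delete:
  assumes A: "A \<in> spd_mats (Suc k)" and r: "r < Suc k"
  shows "mat_delete A r r \<in> spd_mats k"
proof -
  have c: "A \<in> carrier_mat (Suc k) (Suc k)" and sym: "transpose_mat A = A" using A by (auto simp: spd_mats_def)
  have "mat_delete A r r \<in> carrier_mat k k" using mat_delete_carrier[OF c] by simp
  moreover have "transpose_mat (mat_delete A r r) = mat_delete A r r"
  proof (rule eq_matI)
    fix i j assume ij: "i < dim_row (mat_delete A r r)" "j < dim_col (mat_delete A r r)"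
    then have ij: "i < k" "j < k" using c by auto
    have "A $$ (insert_index r j, insert_index r i) = A $$ (insert_index r i, insert_index r j)"
      using arg_cong[OF sym, of "\<lambda>A. A $$ (insert_index r i, insert_index r j)"]
        c insert_index_less[OF ij(1), of r] insert_index_less[OF ij(2), of r] by simp
    then show "transpose_mat (mat_delete A r r) $$ (i, j) = mat_delete A r r $$ (i, j)"
      using ij c mat_delete_index[OF c r r] by simp
  qed (use c in auto)
  moreover have "scalar_prod v (mat_delete A r r *\<^sub>v v) > 0" if v: "v \<in> carrier_vec k" "v \<noteq> 0\<^sub>v k" for v
  proof -
    have "insert_vec r 0 v \<noteq> 0\<^sub>v (Suc k)"
    proof
      assume eq: "insert_vec r 0 v = 0\<^sub>v (Suc k)"
      have "v = 0\<^sub>v k"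
      proof (rule eq_vecI)
        fix a assume "a < dim_vec (0\<^sub>v k)"
        then have "a < k" by simp
        then show "v $ a = 0\<^sub>v k $ a"
          using arg_cong[OF eq, of "\<lambda>u. u $ insert_index r a"] v insert_index_less[of a k r] by simp
      qed (use v in auto)
      then show False using v by simp
    qed
    then have "scalar_prod (insert_vec r 0 v) (A *\<^sub>v insert_vec r 0 v) > 0"
      using A v unfolding spd_mats_def by (auto intro!: carrier_vecI)
    then show ?thesis using v c r
      by (subst (asm) scalar_prod_insert_vec) (auto simp: mat_delete_mult_insert_vec)
  qed
  ultimately show ?thesis by (auto simp: spd_mats_def)
qed

section \<open>The quadratic form of the inverse\<close>

definition inv_form :: "real mat \<Rightarrow> real vec \<Rightarrow> real" where
  "inv_form A v = scalar_prod v (inv_mat A *\<^sub>v v)"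

lemma spd_mats_solve:
  assumes A: "A \<in> spd_mats k" and v: "v \<in> carrier_vec k"
  shows "A *\<^sub>v (inv_mat A *\<^sub>v v) = v" and "inv_mat A *\<^sub>v (A *\<^sub>v v) = v"
proof -
  have c: "A \<in> carrier_mat k k" using A by (simp add: spd_mats_def)
  note i = spd_mats_inv_mat[OF A]
  show "A *\<^sub>v (inv_mat A *\<^sub>v v) = v"
    using assoc_mult_mat_vec[OF c i(1) v] i v by simp
  show "inv_mat A *\<^sub>v (A *\<^sub>v v) = v"
    using assoc_mult_mat_vec[OF i(1) c v] i v by simp
qed

lemma symmetric_scalar_prod:
  fixes A :: "real mat"
  assumes "A \<in> carrier_mat k k" "transpose_mat A = A" "u \<in> carrier_vec k" "v \<in> carrier_vec k"
  shows "scalar_prod u (A *\<^sub>v v) = scalar_prod v (A *\<^sub>v u)"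
proof -
  have "scalar_prod u (A *\<^sub>v v) = scalar_prod (transpose_mat A *\<^sub>v u) v"
    using transpose_vec_mult_scalar[OF assms(1,4,3)] by simp
  then show ?thesis using assms by (simp add: comm_scalar_prod[of _ k])
qed

text \<open>Substituting \<open>v = A u\<close> exchanges the form of the inverse for the form of
  \<open>A\<close>, to which positive definiteness applies directly.\<close>

lemma inv_form_eq:
  assumes A: "A \<in> spd_mats k" and u: "u \<in> carrier_vec k"
  shows "inv_form A (A *\<^sub>v u) = scalar_prod u (A *\<^sub>v u)"
proof -
  have c: "A \<in> carrier_mat k k" using A by (simp add: spd_mats_def)
  show ?thesis using c u by (simp add: inv_form_def spd_mats_solve[OF A u] comm_scalar_prod[of _ k])
qed

lemma inv_form_nonneg:
  assumes A: "A \<in> spd_mats k" and v: "v \<in> carrier_vec k"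
  shows "inv_form A v \<ge> 0"
proof -
  have c: "A \<in> carrier_mat k k" using A by (simp add: spd_mats_def)
  define u where "u = inv_mat A *\<^sub>v v"
  have u: "u \<in> carrier_vec k" using spd_mats_inv_mat[OF A] v by (simp add: u_def)
  have "inv_form A v = scalar_prod u (A *\<^sub>v u)"
    using inv_form_eq[OF A u] spd_mats_solve[OF A v] by (simp add: u_def)
  then show ?thesis using A u c unfolding spd_mats_def
    by (cases "u = 0\<^sub>v k") (auto intro: less_imp_le)
qed

lemma cofactor_diag: "cofactor A r r = det (mat_delete A r r)"
  by (simp add: cofactor_def power_add)

text \<open>The form picks out a diagonal entry of the inverse, given by Cramer's rule. In Gaussian
  terms it is the reciprocal of the conditional variance of coordinate \<open>r\<close> given the
  others.\<close>

lemma inv_form_unit_vec: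
  assumes A: "A \<in> spd_mats k" and r: "r < k"
  shows "inv_form A (unit_vec k r) = det (mat_delete A r r) / det A" and "inv_form A (unit_vec k r) > 0"
proof -
  have c: "A \<in> carrier_mat k k" using A by (simp add: spd_mats_def)
  note i = spd_mats_inv_mat[OF A]
  have "inv_form A (unit_vec k r) = inv_mat A $$ (r, r)"
    using i r by (simp add: inv_form_def scalar_prod_left_unit[of _ k] Matrix.row_def scalar_prod_right_unit)
  then show "inv_form A (unit_vec k r) = det (mat_delete A r r) / det A"
    using r c by (simp add: inv_mat_eq_adj_mat(1)[OF c spd_mats_det_nonzero[OF A]] adj_mat_def cofactor_diag)
  define u where "u = inv_mat A *\<^sub>v unit_vec k r"
  have u: "u \<in> carrier_vec k" using i by (simp add: u_def)
  have Au: "A *\<^sub>v u = unit_vec k r" unfolding u_def by (rule spd_mats_solve[OF A]) simp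
  have "u \<noteq> 0\<^sub>v k"
  proof
    assume "u = 0\<^sub>v k"
    then have "(A *\<^sub>v u) $ r = 0" using c r by simp
    then show False using r Au by simp
  qed
  then show "inv_form A (unit_vec k r) > 0"
    using inv_form_eq[OF A u] Au u A by (auto simp: spd_mats_def)
qed

text \<open>A diagonal entry of the inverse is positive and equals a minor divided by the
  determinant, so the determinant inherits its sign from the smaller matrix.\<close>

lemma spd_mats_det_pos: "A \<in> spd_mats k \<Longrightarrow> det A > 0"
proof (induction k arbitrary: A)
  case 0
  then have "A \<in> carrier_mat 0 0" by (simp add: spd_mats_def)
  then show ?case by (simp add: det_def')
next
  case (Suc k)
  have "det (mat_delete A 0 0) > 0" using Suc.IH[OF spd_mats_mat_delete[OF Suc.prems]] by simp
  then show ?case using inv_form_unit_vec[OF Suc.prems, of 0] by (simp add: zero_less_divide_iff)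
qed

text \<open>Completing the square in one coordinate: the minimum over \<open>t\<close> is attained where the solution
  of \<open>A u = insert_vec r t v\<close> has \<open>u\<^sub>r = 0\<close>, and there it solves the system with \<open>r\<close> deleted.\<close>
lemma inv_form_insert_vec:
  assumes A: "A \<in> spd_mats (Suc k)" and r: "r < Suc k" and v: "v \<in> carrier_vec k"
  obtains c where "\<And>t. inv_form A (insert_vec r t v) =
    inv_form (mat_delete A r r) v + det (mat_delete A r r) / det A * (t - c)\<^sup>2"
proof -
  have ca: "A \<in> carrier_mat (Suc k) (Suc k)" and sym: "transpose_mat A = A" using A by (auto simp: spd_mats_def)
  define A' where "A' = mat_delete A r r"
  have A': "A' \<in> spd_mats k" unfolding A'_def by (rule spd_mats_mat_delete[OF A r])
  define u' where "u' = inv_mat A' *\<^sub>v v"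
  have u': "u' \<in> carrier_vec k" using spd_mats_inv_mat[OF A'] v by (simp add: u'_def)
  have A'u': "A' *\<^sub>v u' = v" unfolding u'_def by (rule spd_mats_solve[OF A' v])
  define u where "u = insert_vec r 0 u'"
  \<comment> \<open>The value of \<open>t\<close> at the minimum: for a centred Gaussian vector with
    covariance \<open>A\<close>, the conditional mean of coordinate \<open>r\<close> when the others
    equal \<open>v\<close>.\<close>
  define c where "c = (A *\<^sub>v u) $ r"
  define e :: "real vec" where "e = unit_vec (Suc k) r"
  \<comment> \<open>The preimage of the unit vector, hence the direction in which the solution moves
    when only \<open>t\<close> changes.\<close>
  define f where "f = inv_mat A *\<^sub>v e"
  have u: "u \<in> carrier_vec (Suc k)" using u' by (auto simp: u_def intro!: carrier_vecI)
  have e: "e \<in> carrier_vec (Suc k)" by (simp add: e_def)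
  have f: "f \<in> carrier_vec (Suc k)" using spd_mats_inv_mat[OF A] by (simp add: e_def f_def)
  have Af: "A *\<^sub>v f = e" unfolding f_def by (rule spd_mats_solve[OF A e])
  have del: "delete_vec r (A *\<^sub>v u) = v"
    unfolding u_def mat_delete_mult_insert_vec[OF ca r u'] using A'u' by (simp add: A'_def)
  have ins: "insert_vec r t v = A *\<^sub>v (u + (t - c) \<cdot>\<^sub>v f)" for t
  proof -
    have "insert_vec r t v = A *\<^sub>v u + (t - c) \<cdot>\<^sub>v e"
    proof (rule eq_vecI)
      fix i assume "i < dim_vec (A *\<^sub>v u + (t - c) \<cdot>\<^sub>v e)"
      then have i: "i < Suc k" using ca by (simp add: e_def)
      show "insert_vec r t v $ i = (A *\<^sub>v u + (t - c) \<cdot>\<^sub>v e) $ i"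
      proof (cases "i = r")
        case True then show ?thesis using v r ca by (simp add: c_def e_def)
      next
        case False
        then have "i \<in> insert_index r ` {0..<k}" using i insert_index_image[OF r] by auto
        then obtain a where a: "a < k" "i = insert_index r a" by auto
        have "(A *\<^sub>v u) $ i = delete_vec r (A *\<^sub>v u) $ a" using a ca by (simp add: delete_vec_def)
        then show ?thesis using a v r ca del False i by (simp add: e_def)
      qed
    qed (use v in \<open>simp add: e_def\<close>)
    then show ?thesis using Af
      by (simp add: mult_add_distrib_mat_vec[OF ca u] mult_mat_vec[OF ca f] f)
  qed
  \<comment> \<open>There is no cross term: \<open>A f\<close> is the unit vector \<open>e\<close>,
    and coordinate \<open>r\<close> of \<open>u\<close> is 0.\<close>
  have fAu: "scalar_prod f (A *\<^sub>v u) = 0"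
    unfolding symmetric_scalar_prod[OF ca sym f u] Af e_def
    using u r u' by (simp add: scalar_prod_right_unit u_def)
  have uAu: "scalar_prod u (A *\<^sub>v u) = inv_form A' v"
    using u' r ca scalar_prod_insert_vec[of r u' "A *\<^sub>v u" 0] inv_form_eq[OF A' u'] A'u' del
    by (simp add: u_def)
  have fAf: "scalar_prod f (A *\<^sub>v f) = det A' / det A"
    using inv_form_eq[OF A f] inv_form_unit_vec[OF A r] by (simp add: Af e_def A'_def)
  have uAf: "scalar_prod u (A *\<^sub>v f) = 0" using symmetric_scalar_prod[OF ca sym f u] fAu by simp
  have "inv_form A (insert_vec r t v) = inv_form A' v + det A' / det A * (t - c)\<^sup>2" for t
  proof -
    define s where "s = t - c"
    have sf: "s \<cdot>\<^sub>v f \<in> carrier_vec (Suc k)" using f by simp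
    have "inv_form A (insert_vec r t v) = scalar_prod (u + s \<cdot>\<^sub>v f) (A *\<^sub>v (u + s \<cdot>\<^sub>v f))"
      unfolding ins s_def[symmetric] using inv_form_eq[OF A, of "u + s \<cdot>\<^sub>v f"] u f by simp
    also have "A *\<^sub>v (u + s \<cdot>\<^sub>v f) = A *\<^sub>v u + s \<cdot>\<^sub>v (A *\<^sub>v f)"
      using mult_add_distrib_mat_vec[OF ca u sf] mult_mat_vec[OF ca f] by simp
    also have "scalar_prod (u + s \<cdot>\<^sub>v f) \<dots> = inv_form A' v + s * (s * (det A' / det A))"
      using u f sf ca fAu uAu fAf uAf
      by (simp add: add_scalar_prod_distrib[of _ "Suc k"] scalar_prod_add_distrib[of _ "Suc k"])
    finally show ?thesis by (simp add: s_def power2_eq_square mult_ac)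
  qed
  then show ?thesis by (intro that[of c]) (simp add: A'_def)
qed

section \<open>Principal submatrices indexed by sets\<close>

definition principal_mat :: "real mat \<Rightarrow> nat set \<Rightarrow> real mat" where
  "principal_mat A S = mat (card S) (card S) (\<lambda>(a, b). A $$ (sorted_list_of_set S ! a, sorted_list_of_set S ! b))"

definition subvec :: "(nat \<Rightarrow> real) \<Rightarrow> nat set \<Rightarrow> real vec" where
  "subvec e S = vec (card S) (\<lambda>a. e (sorted_list_of_set S ! a))"

lemma principal_mat_carrier[simp]: "principal_mat A S \<in> carrier_mat (card S) (card S)"
  and subvec_carrier[simp]: "subvec e S \<in> carrier_vec (card S)"
  by (simp_all add: principal_mat_def subvec_def)

text \<open>The witness is the number of elements of \<open>S\<close> below \<open>j\<close>;
  \<open>insert_index\<close> skips this position in the longer list.\<close>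

lemma sorted_list_of_set_insert_index:
  assumes S: "finite S" and j: "j \<notin> S"
  obtains r where "r < Suc (card S)" "sorted_list_of_set (insert j S) ! r = j"
    "\<And>a. a < card S \<Longrightarrow> sorted_list_of_set (insert j S) ! insert_index r a = sorted_list_of_set S ! a"
proof -
  have "j \<in> set (sorted_list_of_set (insert j S))" using S by (subst set_sorted_list_of_set) auto
  then obtain xs ys where l: "sorted_list_of_set (insert j S) = xs @ j # ys" and x: "j \<notin> set xs"
    using split_list_first by metis
  have "sorted_list_of_set S = sorted_list_of_set (insert j S - {j})" using j by simp
  also have "\<dots> = remove1 j (xs @ j # ys)"
    using S by (subst sorted_list_of_set_remove) (auto simp: l)
  also have "\<dots> = xs @ ys" using x by (simp add: remove1_append)
  finally have l': "sorted_list_of_set S = xs @ ys" .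
  have "length (sorted_list_of_set S) = card S" by simp
  then have len: "length xs + length ys = card S" by (simp add: l')
  show ?thesis
    by (rule that[of "length xs"]) (use len in \<open>auto simp: l l' nth_append insert_index_def not_less Suc_diff_le\<close>)
qed

text \<open>Translates sets into positions. The same \<open>r\<close> serves the matrix and all
  vectors, so that adjoining a column to the observed set becomes the situation of
  \<open>inv_form_insert_vec\<close>.\<close>

lemma principal_mat_insert:
  assumes S: "finite S" and j: "j \<notin> S"
  obtains r where "r < Suc (card S)" "principal_mat A S = mat_delete (principal_mat A (insert j S)) r r"
    "\<And>e t. subvec (e(j := t)) (insert j S) = insert_vec r t (subvec e S)"
proof -
  from sorted_list_of_set_insert_index[OF S j] obtain r where r: "r < Suc (card S)"
    and rj: "sorted_list_of_set (insert j S) ! r = j"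
    and ra: "\<And>a. a < card S \<Longrightarrow> sorted_list_of_set (insert j S) ! insert_index r a = sorted_list_of_set S ! a"
    by metis
  have card: "card (insert j S) = Suc (card S)" using S j by simp
  have "principal_mat A S = mat_delete (principal_mat A (insert j S)) r r"
  proof (rule eq_matI)
    fix a b assume "a < dim_row (mat_delete (principal_mat A (insert j S)) r r)"
      "b < dim_col (mat_delete (principal_mat A (insert j S)) r r)"
    then have ab: "a < card S" "b < card S" by (simp_all add: card principal_mat_def)
    have ca: "principal_mat A (insert j S) \<in> carrier_mat (Suc (card S)) (Suc (card S))"
      using principal_mat_carrier[of A "insert j S"] by (simp add: card)
    show "principal_mat A S $$ (a, b) = mat_delete (principal_mat A (insert j S)) r r $$ (a, b)"
      unfolding mat_delete_index[OF ca r r ab, symmetric]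
      using ab by (simp add: principal_mat_def card ra insert_index_less)
  qed (simp_all add: principal_mat_def card)
  moreover have "subvec (e(j := t)) (insert j S) = insert_vec r t (subvec e S)" for e t
  proof (rule eq_vecI)
    fix i assume "i < dim_vec (insert_vec r t (subvec e S))"
    then have i: "i < Suc (card S)" by (simp add: subvec_def)
    show "subvec (e(j := t)) (insert j S) $ i = insert_vec r t (subvec e S) $ i"
    proof (cases "i = r")
      case True then show ?thesis using r rj by (simp add: subvec_def card)
    next
      case False
      then have "i \<in> insert_index r ` {0..<card S}" using i insert_index_image[OF r] by auto
      then obtain a where a: "a < card S" "i = insert_index r a" by auto
      have "sorted_list_of_set S ! a \<in> S" using a S by (metis nth_mem length_sorted_list_of_set set_sorted_list_of_set)
      then have "sorted_list_of_set S ! a \<noteq> j" using j by auto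
      then show ?thesis using a i by (simp add: subvec_def card ra)
    qed
  qed (simp add: subvec_def card)
  ultimately show ?thesis using that r by blast
qed

lemma principal_mat_full: "A \<in> carrier_mat d d \<Longrightarrow> principal_mat A {..<d} = A"
  by (rule eq_matI) (auto simp: principal_mat_def lessThan_atLeast0)

text \<open>Definiteness is inherited downwards, so the induction runs over the complement of
  \<open>S\<close> and deletes one index at a time from the full matrix.\<close>

lemma spd_mats_principal_mat:
  assumes A: "A \<in> spd_mats d" and S: "S \<subseteq> {..<d}"
  shows "principal_mat A S \<in> spd_mats (card S)"
proof -
  have "principal_mat A ({..<d} - T) \<in> spd_mats (card ({..<d} - T))" if "finite T" "T \<subseteq> {..<d}" for T
    using that
  proof (induction T rule: finite_induct)
    case empty
    have "A \<in> carrier_mat d d" using A by (simp add: spd_mats_def)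
    then show ?case using A by (simp add: principal_mat_full)
  next
    case (insert j T)
    let ?S = "{..<d} - insert j T"
    have eq: "insert j ?S = {..<d} - T" using insert by auto
    have "card ({..<d} - T) = Suc (card ?S)"
      unfolding eq[symmetric] by (subst card_insert_disjoint) auto
    with insert have "principal_mat A (insert j ?S) \<in> spd_mats (Suc (card ?S))" by (simp add: eq)
    moreover have "finite ?S" "j \<notin> ?S" by auto
    ultimately show ?case using principal_mat_insert[of ?S j A] spd_mats_mat_delete by metis
  qed
  from this[of "{..<d} - S"] S show ?thesis by (simp add: double_diff finite_subset)
qed

section \<open>Integrating out one coordinate of a Gaussian density\<close>

lemma nn_integral_gaussian:
  fixes a c :: real
  assumes "a > 0"
  shows "(\<integral>\<^sup>+ t. ennreal (exp (- (a * (t - c)\<^sup>2 / 2))) \<partial>lborel) = ennreal (sqrt (2 * pi / a))"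
proof -
  define s where "s = 1 / sqrt a"
  have s: "s > 0" "s\<^sup>2 = 1 / a" using assms by (auto simp: s_def power_divide)
  have nd: "normal_density c s t = 1 / sqrt (2 * pi / a) * exp (- (a * (t - c)\<^sup>2 / 2))" for t
    by (simp add: normal_density_def s(2) mult.commute)
  have "(\<integral>\<^sup>+ t. ennreal (normal_density c s t) \<partial>lborel) = 1"
    using prob_space.emeasure_space_1[OF prob_space_normal_density[OF s(1), of c]]
    by (simp add: emeasure_density)
  then have 1: "ennreal (1 / sqrt (2 * pi / a)) * (\<integral>\<^sup>+ t. ennreal (exp (- (a * (t - c)\<^sup>2 / 2))) \<partial>lborel) = 1"
    unfolding nd using assms by (subst (asm) ennreal_mult) (auto simp: nn_integral_cmult)
  have "(\<integral>\<^sup>+ t. ennreal (exp (- (a * (t - c)\<^sup>2 / 2))) \<partial>lborel) =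
     ennreal (sqrt (2 * pi / a)) * (ennreal (1 / sqrt (2 * pi / a)) * (\<integral>\<^sup>+ t. ennreal (exp (- (a * (t - c)\<^sup>2 / 2))) \<partial>lborel))"
    using assms by (simp flip: mult.assoc ennreal_mult)
  then show ?thesis unfolding 1 by simp
qed

text \<open>The density at \<open>e\<close> of the coordinates in \<open>S\<close> of a centred
  Gaussian vector with covariance \<open>A / w\<close>, without its power of
  \<open>2 * pi\<close>.\<close>

definition row_density :: "real mat \<Rightarrow> nat set \<Rightarrow> (nat \<Rightarrow> real) \<Rightarrow> real \<Rightarrow> real" where
  "row_density A S e w = w powr (card S / 2) / sqrt (det (principal_mat A S)) *
     exp (- (inv_form (principal_mat A S) (subvec e S) * w / 2))"

text \<open>Completing the square leaves a one-dimensional Gaussian integral. The shift by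
  \<open>b\<close> lets the integration variable be a datum although \<open>e\<close> holds
  residuals.\<close>

lemma nn_integral_row_density:
  assumes A: "A \<in> spd_mats d" and S: "S \<subseteq> {..<d}" and j: "j \<notin> S" "j < d" and w: "w > 0"
  shows "(\<integral>\<^sup>+ t. ennreal (row_density A (insert j S) (e(j := t - b)) w) \<partial>lborel) =
    ennreal (sqrt (2 * pi)) * ennreal (row_density A S e w)"
proof -
  have fS: "finite S" using S finite_subset by blast
  from principal_mat_insert[OF fS j(1)] obtain r where r: "r < Suc (card S)"
    and del: "principal_mat A S = mat_delete (principal_mat A (insert j S)) r r"
    and vec: "\<And>e t. subvec (e(j := t)) (insert j S) = insert_vec r t (subvec e S)" by metis
  define B where "B = principal_mat A (insert j S)"
  define B' where "B' = principal_mat A S"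
  have cd: "card (insert j S) = Suc (card S)" using fS j by simp
  have B: "B \<in> spd_mats (Suc (card S))"
    using spd_mats_principal_mat[OF A, of "insert j S"] S j by (simp add: B_def cd)
  have B': "B' \<in> spd_mats (card S)" unfolding B'_def by (rule spd_mats_principal_mat[OF A S])
  have p: "det B > 0" "det B' > 0" using B B' spd_mats_det_pos by auto
  have BB': "mat_delete B r r = B'" by (simp add: B_def B'_def del)
  from inv_form_insert_vec[OF B r subvec_carrier[of e S], unfolded BB'] obtain c where
    c: "\<And>t. inv_form B (insert_vec r t (subvec e S)) = inv_form B' (subvec e S) + det B' / det B * (t - c)\<^sup>2"
    by metis
  \<comment> \<open>\<open>L\<close> is the conditional precision of the new coordinate. Its
    Gaussian integral \<open>sqrt (2 * pi / L)\<close> turns \<open>det B\<close> into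
    \<open>det B'\<close> and absorbs the extra factor \<open>sqrt w\<close>.\<close>
  define L where "L = w * (det B' / det B)"
  define C where "C = w powr (card S / 2) * sqrt w / sqrt (det B) * exp (- (inv_form B' (subvec e S) * w / 2))"
  have rd: "row_density A (insert j S) (e(j := t - b)) w = C * exp (- (L * (t - (b + c))\<^sup>2 / 2))" for t
  proof -
    have "w powr (card (insert j S) / 2) = w powr (card S / 2) * sqrt w"
      using w by (simp add: cd powr_half_sqrt[symmetric] powr_add[symmetric] add_divide_distrib add.commute)
    then show ?thesis
      by (simp add: row_density_def vec B_def[symmetric] c C_def L_def exp_add[symmetric] algebra_simps add_divide_distrib)
  qed
  have L: "L > 0" using w p by (simp add: L_def)
  have C: "C \<ge> 0" using w p by (simp add: C_def)
  have "(\<integral>\<^sup>+ t. ennreal (row_density A (insert j S) (e(j := t - b)) w) \<partial>lborel) =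
     (\<integral>\<^sup>+ t. ennreal C * ennreal (exp (- (L * (t - (b + c))\<^sup>2 / 2))) \<partial>lborel)"
    unfolding rd by (subst ennreal_mult[OF C]) auto
  also have "\<dots> = ennreal C * ennreal (sqrt (2 * pi / L))"
    by (subst nn_integral_cmult) (simp_all add: nn_integral_gaussian[OF L])
  also have "\<dots> = ennreal (C * sqrt (2 * pi / L))"
    using C L by (subst ennreal_mult) auto
  also have "C * sqrt (2 * pi / L) = sqrt (2 * pi) * row_density A S e w"
  proof -
    have "sqrt w / sqrt (det B) * sqrt (2 * pi / L) = sqrt (2 * pi) / sqrt (det B')"
      using w p by (simp add: L_def real_sqrt_divide real_sqrt_mult)
    then have "w powr (card S / 2) * exp (- (inv_form B' (subvec e S) * w / 2)) * (sqrt w / sqrt (det B) * sqrt (2 * pi / L)) =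
      w powr (card S / 2) * exp (- (inv_form B' (subvec e S) * w / 2)) * (sqrt (2 * pi) / sqrt (det B'))" by simp
    then show ?thesis by (simp add: row_density_def B'_def[symmetric] C_def mult_ac)
  qed
  also have "ennreal \<dots> = ennreal (sqrt (2 * pi)) * ennreal (row_density A S e w)"
    by (simp add: ennreal_mult')
  finally show ?thesis .
qed

section \<open>Measurability on spaces of matrices\<close>

text \<open>Injectivity is asked on the space only: \<open>mat p d\<close> forgets values outside
  the index range, and it is injective on the extensional functions that make up a product
  space.\<close>

lemma sigma_finite_embed_measure_inj_on:
  assumes "sigma_finite_measure M" and inj: "inj_on f (space M)"
  shows "sigma_finite_measure (embed_measure M f)"
proof -
  from assms(1) interpret sigma_finite_measure M .
  from sigma_finite_countable obtain A where
    A: "countable A" "A \<subseteq> sets M" "\<Union>A = space M" "\<And>X. X \<in> A \<Longrightarrow> emeasure M X \<noteq> \<infinity>" by blast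
  show ?thesis
  proof
    show "\<exists>B. countable B \<and> B \<subseteq> sets (embed_measure M f) \<and> \<Union>B = space (embed_measure M f) \<and>
      (\<forall>b\<in>B. emeasure (embed_measure M f) b \<noteq> \<infinity>)"
    proof (intro exI[of _ "(`) f ` A"] conjI ballI)
      show "(`) f ` A \<subseteq> sets (embed_measure M f)" using A in_sets_embed_measure by blast
      show "\<Union>((`) f ` A) = space (embed_measure M f)" using A(3) by (auto simp: space_embed_measure)
      fix b assume "b \<in> (`) f ` A"
      then show "emeasure (embed_measure M f) b \<noteq> \<infinity>"
        using A by (auto simp: emeasure_embed_measure_image'[OF inj] subset_iff)
    qed (use A in auto)
  qed
qed

abbreviation upper_ix :: "nat \<Rightarrow> (nat \<times> nat) set" where
  "upper_ix d \<equiv> {(i, j). i \<le> j \<and> j < d}"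

abbreviation sym_mat :: "nat \<Rightarrow> (nat \<times> nat \<Rightarrow> real) \<Rightarrow> real mat" where
  "sym_mat d f \<equiv> mat d d (\<lambda>(i, j). f (min i j, max i j))"

lemma finite_upper_ix: "finite (upper_ix d)"
  by (rule finite_subset[of _ "{..<d} \<times> {..<d}"]) auto

lemma sigma_finite_PiM_lborel:
  "finite I \<Longrightarrow> sigma_finite_measure (Pi\<^sub>M I (\<lambda>_. lborel :: real measure))"
  by (rule product_sigma_finite.sigma_finite) (simp_all add: product_sigma_finite_def lborel.sigma_finite_measure_axioms)

lemma inj_on_mat: "inj_on (mat p d) (space (Pi\<^sub>M ({..<p} \<times> {..<d}) (\<lambda>_. lborel :: real measure)))"
proof (rule inj_onI)
  fix f g :: "nat \<times> nat \<Rightarrow> real"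
  assume fg: "f \<in> space (Pi\<^sub>M ({..<p} \<times> {..<d}) (\<lambda>_. lborel))" "g \<in> space (Pi\<^sub>M ({..<p} \<times> {..<d}) (\<lambda>_. lborel))"
    and eq: "mat p d f = mat p d g"
  show "f = g"
  proof
    fix ij
    show "f ij = g ij"
    proof (cases "ij \<in> {..<p} \<times> {..<d}")
      case True
      then show ?thesis using arg_cong[OF eq, of "\<lambda>A. A $$ ij"] by auto
    next
      case False then show ?thesis using fg by (cases ij) (auto simp: space_PiM PiE_def extensional_def)
    qed
  qed
qed

lemma inj_on_sym_mat: "inj_on (sym_mat d) (space (Pi\<^sub>M (upper_ix d) (\<lambda>_. lborel :: real measure)))"
proof (rule inj_onI)
  fix f g :: "nat \<times> nat \<Rightarrow> real"
  assume fg: "f \<in> space (Pi\<^sub>M (upper_ix d) (\<lambda>_. lborel))" "g \<in> space (Pi\<^sub>M (upper_ix d) (\<lambda>_. lborel))"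
    and eq: "sym_mat d f = sym_mat d g"
  show "f = g"
  proof
    fix ij
    show "f ij = g ij"
    proof (cases "ij \<in> upper_ix d")
      case True
      then show ?thesis using arg_cong[OF eq, of "\<lambda>A. A $$ ij"] by (auto simp: min_def max_def)
    next
      case False then show ?thesis using fg by (cases ij) (auto simp: space_PiM PiE_def extensional_def)
    qed
  qed
qed

lemma sigma_finite_lebesgue_mat: "sigma_finite_measure (lebesgue_mat p d)"
  unfolding lebesgue_mat_def
  by (intro sigma_finite_embed_measure_inj_on sigma_finite_PiM_lborel inj_on_mat) auto

lemma space_lebesgue_mat: "space (lebesgue_mat p d) \<subseteq> carrier_mat p d"
  by (auto simp: lebesgue_mat_def space_embed_measure)

lemma measurable_lebesgue_mat_entry:
  assumes "i < p" "j < d"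
  shows "(\<lambda>A. A $$ (i, j)) \<in> borel_measurable (lebesgue_mat p d)"
  unfolding lebesgue_mat_def
  by (rule measurable_embed_measure1) (use assms in simp)

abbreviation lebesgue_sym :: "nat \<Rightarrow> real mat measure" where
  "lebesgue_sym d \<equiv> embed_measure (Pi\<^sub>M (upper_ix d) (\<lambda>_. lborel)) (sym_mat d)"

lemma measurable_lebesgue_sym_entry:
  assumes "i < d" "j < d"
  shows "(\<lambda>A. A $$ (i, j)) \<in> borel_measurable (lebesgue_sym d)"
proof (rule measurable_embed_measure1)
  have "(min i j, max i j) \<in> upper_ix d" using assms by auto
  then show "(\<lambda>f. sym_mat d f $$ (i, j)) \<in> borel_measurable (Pi\<^sub>M (upper_ix d) (\<lambda>_. lborel))"
    using assms by simp
qed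

text \<open>Entries are enough to test, since determinants, inverses and quadratic forms are
  polynomial or rational in them. The size is part of the notion because the type contains matrices
  of all sizes.\<close>

definition mat_measurable :: "'w measure \<Rightarrow> nat \<Rightarrow> nat \<Rightarrow> ('w \<Rightarrow> real mat) \<Rightarrow> bool" where
  "mat_measurable M k l A \<longleftrightarrow> (\<forall>\<omega>\<in>space M. A \<omega> \<in> carrier_mat k l) \<and>
     (\<forall>i<k. \<forall>j<l. (\<lambda>\<omega>. A \<omega> $$ (i, j)) \<in> borel_measurable M)"

lemma mat_measurable_entry:
  "mat_measurable M k l A \<Longrightarrow> i < k \<Longrightarrow> j < l \<Longrightarrow> (\<lambda>\<omega>. A \<omega> $$ (i, j)) \<in> borel_measurable M"
  by (simp add: mat_measurable_def)

lemma mat_measurable_compose: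
  assumes "mat_measurable N k l A" "f \<in> M \<rightarrow>\<^sub>M N"
  shows "mat_measurable M k l (\<lambda>\<omega>. A (f \<omega>))"
proof -
  have "(\<lambda>\<omega>. A (f \<omega>) $$ (i, j)) \<in> borel_measurable M" if "i < k" "j < l" for i j
    by (rule measurable_compose[OF assms(2) mat_measurable_entry[OF assms(1) that]])
  then show ?thesis using assms(1) measurable_space[OF assms(2)] by (auto simp: mat_measurable_def)
qed

lemma borel_measurable_det:
  assumes A: "mat_measurable M k k A"
  shows "(\<lambda>\<omega>. det (A \<omega>)) \<in> borel_measurable M"
proof -
  have "(\<lambda>\<omega>. \<Sum>p\<in>{p. p permutes {0..<k}}. signof p * (\<Prod>i = 0..<k. A \<omega> $$ (i, p i))) \<in> borel_measurable M"
  proof (intro borel_measurable_sum borel_measurable_times borel_measurable_prod borel_measurable_const)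
    fix p i assume "p \<in> {p. p permutes {0..<k}}" "i \<in> {0..<k}"
    then have "i < k" "p i < k" using permutes_in_image[of p "{0..<k}" i] by auto
    then show "(\<lambda>\<omega>. A \<omega> $$ (i, p i)) \<in> borel_measurable M" by (rule mat_measurable_entry[OF A])
  qed
  then show ?thesis
    by (rule measurable_cong[THEN iffD1, rotated]) (use A in \<open>auto simp: mat_measurable_def det_def'\<close>)
qed

lemma mat_measurable_mat_delete:
  assumes A: "mat_measurable M k k A" and "i < k" "j < k"
  shows "mat_measurable M (k - 1) (k - 1) (\<lambda>\<omega>. mat_delete (A \<omega>) i j)"
proof -
  obtain k' where k: "k = Suc k'" using assms by (cases k) auto
  have c: "\<And>\<omega>. \<omega> \<in> space M \<Longrightarrow> A \<omega> \<in> carrier_mat (Suc k') (Suc k')" using A by (simp add: mat_measurable_def k)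
  have "(\<lambda>\<omega>. mat_delete (A \<omega>) i j $$ (i', j')) \<in> borel_measurable M" if "i' < k'" "j' < k'" for i' j'
  proof -
    have "(\<lambda>\<omega>. A \<omega> $$ (insert_index i i', insert_index j j')) \<in> borel_measurable M"
      using that by (intro mat_measurable_entry[OF A]) (auto simp: k insert_index_def)
    then show ?thesis
      by (rule measurable_cong[THEN iffD1, rotated]) (use mat_delete_index[OF c _ _ that] assms in \<open>simp add: k\<close>)
  qed
  then show ?thesis using mat_delete_carrier[OF c] by (simp add: mat_measurable_def k)
qed

lemma mat_measurable_inv_mat:
  assumes A: "mat_measurable M k k A" and d: "\<And>\<omega>. \<omega> \<in> space M \<Longrightarrow> det (A \<omega>) \<noteq> 0"
  shows "mat_measurable M k k (\<lambda>\<omega>. inv_mat (A \<omega>))"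
proof -
  have c: "\<And>\<omega>. \<omega> \<in> space M \<Longrightarrow> A \<omega> \<in> carrier_mat k k" using A by (simp add: mat_measurable_def)
  have "(\<lambda>\<omega>. inv_mat (A \<omega>) $$ (i, j)) \<in> borel_measurable M" if ij: "i < k" "j < k" for i j
  proof -
    note [measurable] = borel_measurable_det[OF A] borel_measurable_det[OF mat_measurable_mat_delete[OF A ij(2,1)]]
    have "(\<lambda>\<omega>. 1 / det (A \<omega>) * ((-1) ^ (j + i) * det (mat_delete (A \<omega>) j i))) \<in> borel_measurable M" by measurable
    then show ?thesis
      by (rule measurable_cong[THEN iffD1, rotated])
         (use ij c in \<open>simp add: inv_mat_eq_adj_mat(1)[OF c d] adj_mat_def cofactor_def carrier_matD[OF c]\<close>)
  qed
  then show ?thesis using inv_mat_eq_adj_mat(2)[OF c d] by (simp add: mat_measurable_def)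
qed

lemma quadratic_form_sum:
  fixes A :: "real mat" and v :: "real vec"
  assumes "A \<in> carrier_mat k k" "v \<in> carrier_vec k"
  shows "scalar_prod v (A *\<^sub>v v) = (\<Sum>a\<in>{0..<k}. v $ a * (\<Sum>b\<in>{0..<k}. A $$ (a, b) * v $ b))"
proof -
  have "dim_row A = k" "dim_col A = k" "dim_vec v = k" using assms by auto
  then show ?thesis by (simp add: scalar_prod_def)
qed

lemma borel_measurable_quadratic_form:
  fixes e :: "'w \<Rightarrow> real vec"
  assumes A: "mat_measurable M k k A" and e: "\<And>a. a < k \<Longrightarrow> (\<lambda>\<omega>. e \<omega> $ a) \<in> borel_measurable M"
    and ec: "\<And>\<omega>. \<omega> \<in> space M \<Longrightarrow> e \<omega> \<in> carrier_vec k"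
  shows "(\<lambda>\<omega>. scalar_prod (e \<omega>) (A \<omega> *\<^sub>v e \<omega>)) \<in> borel_measurable M"
proof -
  have "(\<lambda>\<omega>. \<Sum>a\<in>{0..<k}. e \<omega> $ a * (\<Sum>b\<in>{0..<k}. A \<omega> $$ (a, b) * e \<omega> $ b)) \<in> borel_measurable M"
    using e mat_measurable_entry[OF A]
    by (intro borel_measurable_sum borel_measurable_times) auto
  then show ?thesis
    by (rule measurable_cong[THEN iffD1, rotated])
       (use A ec in \<open>auto simp: mat_measurable_def quadratic_form_sum[of _ k]\<close>)
qed

lemma mat_measurable_principal_mat:
  assumes A: "mat_measurable M d d A" and S: "S \<subseteq> {..<d}"
  shows "mat_measurable M (card S) (card S) (\<lambda>\<omega>. principal_mat (A \<omega>) S)"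
proof -
  have fS: "finite S" using S finite_subset by blast
  have "sorted_list_of_set S ! a < d" if "a < card S" for a
  proof -
    have "sorted_list_of_set S ! a \<in> S"
      using that fS by (metis nth_mem length_sorted_list_of_set set_sorted_list_of_set)
    then show ?thesis using S by auto
  qed
  then show ?thesis using mat_measurable_entry[OF A]
    by (auto simp: mat_measurable_def principal_mat_def)
qed

lemma borel_measurable_row_density:
  assumes A: "mat_measurable M d d A" and spd: "\<And>\<omega>. \<omega> \<in> space M \<Longrightarrow> A \<omega> \<in> spd_mats d"
    and S: "S \<subseteq> {..<d}" and e: "\<And>j. j \<in> S \<Longrightarrow> (\<lambda>\<omega>. e \<omega> j) \<in> borel_measurable M"
    and w[measurable]: "w \<in> borel_measurable M"
  shows "(\<lambda>\<omega>. row_density (A \<omega>) S (e \<omega>) (w \<omega>)) \<in> borel_measurable M"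
proof -
  have fS: "finite S" using S finite_subset by blast
  note P = mat_measurable_principal_mat[OF A S]
  note [measurable] = borel_measurable_det[OF P]
  have I: "mat_measurable M (card S) (card S) (\<lambda>\<omega>. inv_mat (principal_mat (A \<omega>) S))"
    by (intro mat_measurable_inv_mat[OF P] spd_mats_det_nonzero[OF spd_mats_principal_mat[OF spd S]])
  have [measurable]: "(\<lambda>\<omega>. inv_form (principal_mat (A \<omega>) S) (subvec (e \<omega>) S)) \<in> borel_measurable M"
    unfolding inv_form_def
  proof (rule borel_measurable_quadratic_form[OF I])
    fix a assume "a < card S"
    moreover from this have "sorted_list_of_set S ! a \<in> S"
      using fS by (metis nth_mem length_sorted_list_of_set set_sorted_list_of_set)
    ultimately show "(\<lambda>\<omega>. subvec (e \<omega>) S $ a) \<in> borel_measurable M" using e by (simp add: subvec_def)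
  qed simp
  show ?thesis unfolding row_density_def by measurable
qed

text \<open>Nonnegativity of the quadratic form needs to be checked on rational vectors only; this makes
  positive definiteness a countable condition once it is split into semidefiniteness and
  invertibility.\<close>

lemma quadratic_form_nonneg_if_rational:
  fixes A :: "real mat"
  assumes A: "A \<in> carrier_mat d d"
    and q: "\<And>l :: rat list. (\<Sum>i\<in>{0..<d}. real_of_rat (l ! i) * (\<Sum>j\<in>{0..<d}. A $$ (i, j) * real_of_rat (l ! j))) \<ge> 0"
    and v: "v \<in> carrier_vec d"
  shows "scalar_prod v (A *\<^sub>v v) \<ge> 0"
proof -
  \<comment> \<open>Each coordinate is approximated from above by rationals within
    \<open>1 / (n + 1)\<close>; the form is continuous in the vector.\<close>
  have "\<exists>r::rat. v $ i < real_of_rat r \<and> real_of_rat r < v $ i + 1 / real (Suc n)" for n i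
    using of_rat_dense[of "v $ i" "v $ i + 1 / real (Suc n)"] by simp
  then have "\<forall>n i. \<exists>r::rat. v $ i < real_of_rat r \<and> real_of_rat r < v $ i + 1 / real (Suc n)" by blast
  from this[unfolded choice_iff] obtain r :: "nat \<Rightarrow> nat \<Rightarrow> rat" where
    r: "\<And>n i. v $ i < real_of_rat (r n i) \<and> real_of_rat (r n i) < v $ i + 1 / real (Suc n)" by blast
  have lim: "(\<lambda>n. real_of_rat (r n i)) \<longlonglongrightarrow> v $ i" for i
  proof (rule real_tendsto_sandwich[of "\<lambda>_. v $ i" _ _ "\<lambda>n. v $ i + 1 / real (Suc n)"])
    show "(\<lambda>n. v $ i + 1 / real (Suc n)) \<longlonglongrightarrow> v $ i"
      using tendsto_add[OF tendsto_const LIMSEQ_Suc[OF lim_1_over_n], of "v $ i"] by simp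
  qed (use r in \<open>auto intro!: always_eventually less_imp_le\<close>)
  have "(\<lambda>n. \<Sum>i\<in>{0..<d}. real_of_rat (r n i) * (\<Sum>j\<in>{0..<d}. A $$ (i, j) * real_of_rat (r n j)))
     \<longlonglongrightarrow> (\<Sum>i\<in>{0..<d}. v $ i * (\<Sum>j\<in>{0..<d}. A $$ (i, j) * v $ j))"
    by (intro tendsto_intros lim)
  moreover have "(\<Sum>i\<in>{0..<d}. real_of_rat (r n i) * (\<Sum>j\<in>{0..<d}. A $$ (i, j) * real_of_rat (r n j))) \<ge> 0" for n
    using q[of "map (r n) [0..<d]"] by simp
  ultimately have "(\<Sum>i\<in>{0..<d}. v $ i * (\<Sum>j\<in>{0..<d}. A $$ (i, j) * v $ j)) \<ge> 0"
    by (intro LIMSEQ_le_const) auto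
  also have "(\<Sum>i\<in>{0..<d}. v $ i * (\<Sum>j\<in>{0..<d}. A $$ (i, j) * v $ j)) = scalar_prod v (A *\<^sub>v v)"
    by (rule quadratic_form_sum[OF A v, symmetric])
  finally show ?thesis .
qed

text \<open>If the form vanished at some nonzero \<open>v\<close>, then \<open>u = A v\<close> would
  be nonzero and a step from \<open>v\<close> against \<open>u\<close> would make the form negative:
  with \<open>s\<close> the squared norm of \<open>u\<close>, it equals
  \<open>2 * t * s + t * t * c\<close> at \<open>v + t u\<close>.\<close>

lemma psd_det_nonzero_imp_spd:
  assumes A: "A \<in> carrier_mat d d" "transpose_mat A = A" "det A \<noteq> 0"
    and psd: "\<And>v. v \<in> carrier_vec d \<Longrightarrow> scalar_prod v (A *\<^sub>v v) \<ge> 0"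
  shows "A \<in> spd_mats d"
proof -
  have "scalar_prod v (A *\<^sub>v v) > 0" if v: "v \<in> carrier_vec d" "v \<noteq> 0\<^sub>v d" for v
  proof (rule ccontr)
    assume "\<not> scalar_prod v (A *\<^sub>v v) > 0"
    then have z: "scalar_prod v (A *\<^sub>v v) = 0" using psd[OF v(1)] by simp
    define u where "u = A *\<^sub>v v"
    define s where "s = scalar_prod u u"
    define c where "c = scalar_prod u (A *\<^sub>v u)"
    have u: "u \<in> carrier_vec d" using A v by (simp add: u_def)
    have "u \<noteq> 0\<^sub>v d" using det_0_iff_vec_prod_zero_field[OF A(1)] A(3) v by (auto simp: u_def)
    then obtain i where i: "i < d" "u $ i \<noteq> 0" using u by (metis carrier_vecD eq_vecI index_zero_vec)
    have "(\<Sum>i\<in>{0..<d}. u $ i * u $ i) > 0"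
      by (rule sum_pos2[of _ i]) (use i in \<open>auto simp: zero_less_mult_iff linorder_neq_iff\<close>)
    then have s: "s > 0" using u by (simp add: s_def scalar_prod_def)
    have c: "c \<ge> 0" unfolding c_def by (rule psd[OF u])
    \<comment> \<open>The added 1 avoids a division by 0 when \<open>c = 0\<close>, and
      \<open>t * c\<close> still exceeds \<open>- s\<close>.\<close>
    define t where "t = - s / (c + 1)"
    have tu: "t \<cdot>\<^sub>v u \<in> carrier_vec d" using u by simp
    have Atu: "A *\<^sub>v (v + t \<cdot>\<^sub>v u) = u + t \<cdot>\<^sub>v (A *\<^sub>v u)"
      using mult_add_distrib_mat_vec[OF A(1) v(1) tu] mult_mat_vec[OF A(1) u] by (simp add: u_def)
    have vAu: "scalar_prod v (A *\<^sub>v u) = s" using symmetric_scalar_prod[OF A(1,2) v(1) u] by (simp add: u_def s_def)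
    have Au: "A *\<^sub>v u \<in> carrier_vec d" using A u by simp
    have "scalar_prod (v + t \<cdot>\<^sub>v u) (A *\<^sub>v (v + t \<cdot>\<^sub>v u)) = 2 * t * s + t * t * c"
      unfolding Atu using u v tu Au vAu z
      by (simp add: add_scalar_prod_distrib[of _ d] scalar_prod_add_distrib[of _ d] s_def c_def u_def[symmetric])
    then have nonneg: "t * (2 * s + t * c) \<ge> 0" using psd[of "v + t \<cdot>\<^sub>v u"] v tu by (simp add: algebra_simps)
    have t: "t < 0" using s c by (simp add: t_def divide_neg_pos)
    have "t * (c + 1) = - s" using c by (simp add: t_def)
    then have "2 * s + t * c > 0" using t s by (simp add: algebra_simps)
    then have "t * (2 * s + t * c) < 0" using t by (rule mult_neg_pos[rotated])
    with nonneg show False by simp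
  qed
  then show ?thesis using A by (simp add: spd_mats_def)
qed

text \<open>Measurability of the cone makes the restricted measure sigma-finite, as Tonelli's
  theorem on the parameter space demands. Nonvanishing of the determinant removes the boundary of
  the semidefinite cone.\<close>

lemma spd_mats_in_sets: "spd_mats d \<in> sets (lebesgue_sym d)"
proof -
  have sp: "A \<in> carrier_mat d d \<and> transpose_mat A = A" if "A \<in> space (lebesgue_sym d)" for A
    using that by (auto simp: space_embed_measure min.commute max.commute)
  have sub: "A \<in> space (lebesgue_sym d)" if A: "A \<in> spd_mats d" for A
  proof -
    have c: "A \<in> carrier_mat d d" "transpose_mat A = A" using A by (auto simp: spd_mats_def)
    have sym: "A $$ (i, j) = A $$ (j, i)" if "i < d" "j < d" for i j
      using arg_cong[OF c(2), of "\<lambda>B. B $$ (i, j)"] c(1) that by simp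
    have "A = sym_mat d (restrict (\<lambda>ij. A $$ ij) (upper_ix d))"
      using c(1) by (intro eq_matI) (auto simp: min_def max_def sym)
    then show ?thesis unfolding space_embed_measure by (rule image_eqI[where x="restrict (\<lambda>ij. A $$ ij) (upper_ix d)"]) (simp add: space_PiM)
  qed
  have M: "mat_measurable (lebesgue_sym d) d d (\<lambda>A. A)"
    using sp measurable_lebesgue_sym_entry by (auto simp: mat_measurable_def)
  \<comment> \<open>Lists of rationals form a countable type and code all rational vectors. A list
    that is too short stands for a vector with some unspecified rational entries, which is harmless
    because every rational vector is tested anyway.\<close>
  let ?Q = "\<lambda>A (l :: rat list). (\<Sum>i\<in>{0..<d}. real_of_rat (l ! i) * (\<Sum>j\<in>{0..<d}. A $$ (i, j) * real_of_rat (l ! j)))"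
  have "spd_mats d = {A \<in> space (lebesgue_sym d). (\<forall>l. ?Q A l \<ge> 0) \<and> det A \<noteq> 0}"
  proof (intro equalityI subsetI)
    fix A assume A: "A \<in> spd_mats d"
    have c: "A \<in> carrier_mat d d" using A by (simp add: spd_mats_def)
    have "?Q A l \<ge> 0" for l
    proof -
      define v where "v = vec d (\<lambda>i. real_of_rat (l ! i))"
      have v: "v \<in> carrier_vec d" by (simp add: v_def)
      have "?Q A l = scalar_prod v (A *\<^sub>v v)" unfolding quadratic_form_sum[OF c v] by (simp add: v_def)
      also have "\<dots> \<ge> 0" using A c v unfolding spd_mats_def
        by (cases "v = 0\<^sub>v d") (auto intro: less_imp_le)
      finally show ?thesis .
    qed
    then show "A \<in> {A \<in> space (lebesgue_sym d). (\<forall>l. ?Q A l \<ge> 0) \<and> det A \<noteq> 0}"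
      using sub[OF A] spd_mats_det_nonzero[OF A] by simp
  next
    fix A assume "A \<in> {A \<in> space (lebesgue_sym d). (\<forall>l. ?Q A l \<ge> 0) \<and> det A \<noteq> 0}"
    then show "A \<in> spd_mats d"
      using sp[of A] quadratic_form_nonneg_if_rational[of A d] by (intro psd_det_nonzero_imp_spd) auto
  qed
  also have "\<dots> \<in> sets (lebesgue_sym d)"
  proof (intro sets.sets_Collect_conj sets.sets_Collect_countable_All)
    fix l :: "rat list"
    have [measurable]: "(\<lambda>A. ?Q A l) \<in> borel_measurable (lebesgue_sym d)"
      using mat_measurable_entry[OF M]
      by (intro borel_measurable_sum borel_measurable_times borel_measurable_const) auto
    show "{A \<in> space (lebesgue_sym d). 0 \<le> ?Q A l} \<in> sets (lebesgue_sym d)" by measurable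
  next
    note [measurable] = borel_measurable_det[OF M]
    show "{A \<in> space (lebesgue_sym d). det A \<noteq> 0} \<in> sets (lebesgue_sym d)" by measurable
  qed
  finally show ?thesis .
qed

lemma space_lebesgue_spd: "space (lebesgue_spd d) \<subseteq> spd_mats d"
  by (auto simp: lebesgue_spd_def space_restrict_space)

lemma sigma_finite_lebesgue_spd: "sigma_finite_measure (lebesgue_spd d)"
  unfolding lebesgue_spd_def
  by (intro sigma_finite_measure_restrict_space sigma_finite_embed_measure_inj_on sigma_finite_PiM_lborel
      inj_on_sym_mat spd_mats_in_sets finite_upper_ix)

lemma mat_measurable_lebesgue_spd: "mat_measurable (lebesgue_spd d) d d (\<lambda>A. A)"
  using space_lebesgue_spd[of d] measurable_lebesgue_sym_entry[of _ d]
  by (auto simp: mat_measurable_def spd_mats_def lebesgue_spd_def intro!: measurable_restrict_space1)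

lemma mat_measurable_lebesgue_mat: "mat_measurable (lebesgue_mat p d) p d (\<lambda>A. A)"
  using space_lebesgue_mat[of p d] measurable_lebesgue_mat_entry[of _ p _ d] by (auto simp: mat_measurable_def)

lemma sigma_finite_param_space: "sigma_finite_measure (param_space p d)"
  unfolding param_space_def
  by (intro sigma_finite_pair_measure sigma_finite_lebesgue_mat sigma_finite_lebesgue_spd)

lemma space_param_space:
  "\<theta> \<in> space (param_space p d) \<Longrightarrow> fst \<theta> \<in> carrier_mat p d \<and> snd \<theta> \<in> spd_mats d"
  using space_lebesgue_spd[of d] space_lebesgue_mat[of p d] by (auto simp: param_space_def space_pair_measure)

lemma mat_measurable_param_space:
  "mat_measurable (param_space p d) p d fst" "mat_measurable (param_space p d) d d snd"
  unfolding param_space_def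
  by (rule mat_measurable_compose[OF mat_measurable_lebesgue_mat] mat_measurable_compose[OF mat_measurable_lebesgue_spd], simp)+

section \<open>The model\<close>

locale dai_model =
  fixes n p d :: nat and x a :: "real mat" and m :: real and Pmix :: "real measure"
  assumes x: "x \<in> carrier_mat n p" and a: "a \<in> carrier_mat d d"
    and Pmix: "prob_space Pmix" and sets_Pmix: "sets Pmix = sets (restrict_space borel {0<..})"
    and moment: "(\<integral>\<^sup>+ w. ennreal (w powr (d / 2)) \<partial>Pmix) < \<infinity>"
begin

abbreviation "cells \<equiv> {..<n} \<times> {..<d}"
abbreviation "W \<equiv> weight_space n Pmix"
abbreviation "\<Theta> \<equiv> param_space p d"

definition obs_row :: "(nat \<times> nat) set \<Rightarrow> nat \<Rightarrow> nat set" where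
  "obs_row K i = {j. (i, j) \<in> K}"

definition mean :: "real mat \<Rightarrow> nat \<Rightarrow> nat \<Rightarrow> real" where
  "mean \<beta> i j = (\<Sum>l<p. \<beta> $$ (l, j) * x $$ (i, l))"

text \<open>The density of \<open>(Y\<^sub>(\<^sub>k\<^sub>), W, B, \<Sigma>)\<close> up to a power of \<open>2 * pi\<close>.\<close>
definition marginal :: "(nat \<times> nat) set \<Rightarrow> (nat \<times> nat \<Rightarrow> real) \<Rightarrow> (nat \<Rightarrow> real) \<Rightarrow> real mat \<times> real mat \<Rightarrow> real" where
  "marginal K y w \<theta> = prior_density a m \<theta> *
     (\<Prod>i<n. row_density (snd \<theta>) (obs_row K i) (\<lambda>j. y (i, j) - mean (fst \<theta>) i j) (w i))"

lemma space_Pmix: "space Pmix = {0<..}"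
  using sets_eq_imp_space_eq[OF sets_Pmix] by (simp add: space_restrict_space)

lemma measurable_Pmix: "f \<in> borel_measurable borel \<Longrightarrow> f \<in> borel_measurable Pmix"
  unfolding measurable_cong_sets[OF sets_Pmix refl] by (rule measurable_restrict_space1)

lemma space_W: "w \<in> space W \<Longrightarrow> i < n \<Longrightarrow> w i > 0"
  by (auto simp: weight_space_def space_PiM space_Pmix PiE_iff)

lemma measurable_W_component[measurable]: "i < n \<Longrightarrow> (\<lambda>w. w i) \<in> borel_measurable W"
  unfolding weight_space_def
  using measurable_compose[OF measurable_component_singleton[of i "{..<n}" "\<lambda>_. Pmix"] measurable_Pmix[of "\<lambda>x. x"]]
  by simp

lemma product_sigma_finite_Pmix: "product_sigma_finite (\<lambda>_. Pmix)"
  using Pmix by (simp add: product_sigma_finite_def prob_space_imp_sigma_finite)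

lemma prob_space_W: "prob_space W"
  unfolding weight_space_def by (rule prob_space_PiM) (rule Pmix)

lemma obs_row_subset: "K \<subseteq> cells \<Longrightarrow> obs_row K i \<subseteq> {..<d}"
  by (auto simp: obs_row_def)

section \<open>Selection matrices rewritten as principal submatrices\<close>

lemma obs_dim_eq: "obs_dim K i = card (obs_row K i)"
  by (simp add: obs_dim_def obs_cols_def obs_row_def)

lemma obs_cols_nth:
  assumes K: "K \<subseteq> cells" and a: "l < card (obs_row K i)"
  shows "sorted_list_of_set (obs_row K i) ! l < d"
proof -
  have "finite (obs_row K i)" using obs_row_subset[OF K] finite_subset by blast
  then have "sorted_list_of_set (obs_row K i) ! l \<in> obs_row K i"
    using a by (metis nth_mem length_sorted_list_of_set set_sorted_list_of_set)
  then show ?thesis using obs_row_subset[OF K] by auto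
qed

lemma c_mat_mult_vec:
  assumes K: "K \<subseteq> cells" and v: "v \<in> carrier_vec d"
  shows "c_mat d K i *\<^sub>v v = vec (card (obs_row K i)) (\<lambda>l. v $ (sorted_list_of_set (obs_row K i) ! l))"
proof (rule eq_vecI)
  fix l assume "l < dim_vec (vec (card (obs_row K i)) (\<lambda>l. v $ (sorted_list_of_set (obs_row K i) ! l)))"
  then have l: "l < card (obs_row K i)" by simp
  let ?j = "sorted_list_of_set (obs_row K i) ! l"
  have j: "?j < d" by (rule obs_cols_nth[OF K l])
  have "(c_mat d K i *\<^sub>v v) $ l = (\<Sum>b\<in>{0..<d}. (if b = ?j then 1 else 0) * v $ b)"
    using l v by (auto simp: c_mat_def obs_dim_eq obs_cols_def obs_row_def scalar_prod_def intro!: sum.cong)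
  also have "\<dots> = v $ ?j" using j by (simp add: if_distrib[of "\<lambda>c. c * _"] sum.delta cong: if_cong)
  finally show "(c_mat d K i *\<^sub>v v) $ l =
      vec (card (obs_row K i)) (\<lambda>l. v $ (sorted_list_of_set (obs_row K i) ! l)) $ l" using l by simp
qed (simp add: c_mat_def obs_dim_eq)

text \<open>The rows of \<open>c_mat\<close> are unit vectors, so multiplying from both sides picks
  out entries of \<sigma>.\<close>

lemma obs_cov_eq:
  assumes K: "K \<subseteq> cells" and \<sigma>: "\<sigma> \<in> carrier_mat d d"
  shows "obs_cov d K i \<sigma> = principal_mat \<sigma> (obs_row K i)"
proof -
  define C where "C = c_mat d K i"
  let ?k = "card (obs_row K i)"
  let ?c = "\<lambda>l. sorted_list_of_set (obs_row K i) ! l"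
  have C: "C \<in> carrier_mat ?k d" by (simp add: C_def c_mat_def obs_dim_eq)
  have row: "Matrix.row C l = unit_vec d (?c l)" if "l < ?k" for l
    using that obs_cols_nth[OF K that]
    by (intro eq_vecI) (auto simp: C_def c_mat_def obs_dim_eq obs_cols_def obs_row_def unit_vec_def)
  have "C * \<sigma> * transpose_mat C = principal_mat \<sigma> (obs_row K i)"
  proof (rule eq_matI)
    fix u v assume "u < dim_row (principal_mat \<sigma> (obs_row K i))" "v < dim_col (principal_mat \<sigma> (obs_row K i))"
    then have u: "u < ?k" and v: "v < ?k" by (simp_all add: principal_mat_def)
    have "(C * \<sigma> * transpose_mat C) $$ (u, v) = (C * (\<sigma> * transpose_mat C)) $$ (u, v)"
      using C \<sigma> by (subst assoc_mult_mat) auto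
    also have "\<dots> = scalar_prod (unit_vec d (?c u)) (\<sigma> *\<^sub>v unit_vec d (?c v))"
      using C \<sigma> u v by (simp add: row col_mult2[of _ d d _ ?k])
    also have "\<dots> = \<sigma> $$ (?c u, ?c v)"
      using \<sigma> obs_cols_nth[OF K u] obs_cols_nth[OF K v]
      by (simp add: scalar_prod_left_unit[of _ d] scalar_prod_right_unit)
    finally show "(C * \<sigma> * transpose_mat C) $$ (u, v) = principal_mat \<sigma> (obs_row K i) $$ (u, v)"
      using u v by (simp add: principal_mat_def)
  qed (use C in \<open>simp_all add: principal_mat_def\<close>)
  then show ?thesis by (simp add: obs_cov_def C_def)
qed

lemma mean_eq:
  assumes "\<beta> \<in> carrier_mat p d" "i < n" "j < d"
  shows "(transpose_mat \<beta> *\<^sub>v Matrix.row x i) $ j = mean \<beta> i j"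
  using assms x by (simp add: mean_def scalar_prod_def lessThan_atLeast0)

lemma resid_eq:
  assumes K: "K \<subseteq> cells" and \<theta>: "\<theta> \<in> space \<Theta>" and i: "i < n"
  shows "resid d x K y i \<theta> =
    inv_form (principal_mat (snd \<theta>) (obs_row K i)) (subvec (\<lambda>j. y (i, j) - mean (fst \<theta>) i j) (obs_row K i))"
proof -
  obtain \<beta> \<sigma> where \<theta>eq: "\<theta> = (\<beta>, \<sigma>)" by (cases \<theta>)
  have \<beta>: "\<beta> \<in> carrier_mat p d" and \<sigma>: "\<sigma> \<in> carrier_mat d d"
    using space_param_space[OF \<theta>] by (auto simp: \<theta>eq spd_mats_def)
  have v: "transpose_mat \<beta> *\<^sub>v Matrix.row x i \<in> carrier_vec d" using \<beta> by (auto intro!: carrier_vecI)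
  have y: "data_row d y i \<in> carrier_vec d" by (simp add: data_row_def)
  have "c_mat d K i *\<^sub>v data_row d y i - c_mat d K i *\<^sub>v (transpose_mat \<beta> *\<^sub>v Matrix.row x i) =
    subvec (\<lambda>j. y (i, j) - mean \<beta> i j) (obs_row K i)"
    unfolding c_mat_mult_vec[OF K v] c_mat_mult_vec[OF K y]
    using obs_cols_nth[OF K] mean_eq[OF \<beta> i]
    by (intro eq_vecI) (auto simp: subvec_def data_row_def simp del: index_mult_mat_vec)
  then show ?thesis by (simp add: \<theta>eq resid_def Let_def obs_cov_eq[OF K \<sigma>] inv_form_def)
qed

lemma row_density_eq:
  assumes K: "K \<subseteq> cells" and \<theta>: "\<theta> \<in> space \<Theta>" and i: "i < n"
  shows "row_density (snd \<theta>) (obs_row K i) (\<lambda>j. y (i, j) - mean (fst \<theta>) i j) w =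
    w powr (obs_dim K i / 2) / sqrt (det (obs_cov d K i (snd \<theta>))) * exp (- (resid d x K y i \<theta> * w / 2))"
proof -
  have "snd \<theta> \<in> carrier_mat d d" using space_param_space[OF \<theta>] by (simp add: spd_mats_def)
  then show ?thesis unfolding row_density_def resid_eq[OF assms] by (simp add: obs_dim_eq obs_cov_eq[OF K])
qed

lemma det_obs_cov_pos:
  assumes "K \<subseteq> cells" "\<theta> \<in> space \<Theta>"
  shows "det (obs_cov d K i (snd \<theta>)) > 0"
proof -
  have s: "snd \<theta> \<in> spd_mats d" using space_param_space[OF assms(2)] by simp
  then show ?thesis
    using spd_mats_det_pos[OF spd_mats_principal_mat[OF s obs_row_subset[OF assms(1)]]] obs_cov_eq[OF assms(1)]
    by (simp add: spd_mats_def)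
qed

lemma resid_nonneg:
  assumes "K \<subseteq> cells" "\<theta> \<in> space \<Theta>" "i < n"
  shows "resid d x K y i \<theta> \<ge> 0"
  unfolding resid_eq[OF assms] using space_param_space[OF assms(2)] obs_row_subset[OF assms(1)]
  by (intro inv_form_nonneg[of _ "card (obs_row K i)"] spd_mats_principal_mat) auto

lemma row_density_pos:
  assumes "K \<subseteq> cells" "\<theta> \<in> space \<Theta>" "i < n" "w > 0"
  shows "row_density (snd \<theta>) (obs_row K i) (\<lambda>j. y (i, j) - mean (fst \<theta>) i j) w > 0"
  unfolding row_density_eq[OF assms(1-3)] using det_obs_cov_pos[OF assms(1,2)] assms(4) by simp

section \<open>Marginal densities of the observed cells\<close>

lemma prior_density_pos: "\<theta> \<in> space \<Theta> \<Longrightarrow> prior_density a m \<theta> > 0"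
  using space_param_space[of \<theta> p d] spd_mats_det_pos[of "snd \<theta>" d]
  by (cases \<theta>) (auto simp: prior_density_def)

lemma marginal_pos:
  assumes "K \<subseteq> cells" "\<theta> \<in> space \<Theta>" "w \<in> space W"
  shows "marginal K y w \<theta> > 0"
  unfolding marginal_def
  using prior_density_pos row_density_pos space_W assms by (intro mult_pos_pos prod_pos) auto

lemma marginal_cong:
  assumes "K \<subseteq> cells" "\<And>c. c \<in> K \<Longrightarrow> y c = y' c"
  shows "marginal K y w \<theta> = marginal K y' w \<theta>"
proof -
  have "subvec (\<lambda>j. y (i, j) - mean (fst \<theta>) i j) (obs_row K i) =
        subvec (\<lambda>j. y' (i, j) - mean (fst \<theta>) i j) (obs_row K i)" for i
  proof -
    have fin: "finite (obs_row K i)" using obs_row_subset[OF assms(1)] finite_subset by blast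
    have "sorted_list_of_set (obs_row K i) ! l \<in> obs_row K i" if "l < card (obs_row K i)" for l
      using that fin by (metis nth_mem length_sorted_list_of_set set_sorted_list_of_set)
    then show ?thesis using assms(2) by (intro eq_vecI) (auto simp: subvec_def obs_row_def)
  qed
  then show ?thesis by (simp add: marginal_def row_density_def)
qed

text \<open>With every cell observed, the principal submatrix of each row is \<sigma> itself. All
  other marginals arise from this case by integrating cells out.\<close>

lemma joint_density_eq_marginal:
  assumes \<theta>: "\<theta> \<in> space \<Theta>"
  shows "joint_density n d x a m y w \<theta> = marginal cells y w \<theta>"
proof -
  obtain \<beta> \<sigma> where \<theta>eq: "\<theta> = (\<beta>, \<sigma>)" by (cases \<theta>)
  have \<beta>: "\<beta> \<in> carrier_mat p d" and \<sigma>: "\<sigma> \<in> carrier_mat d d"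
    using space_param_space[OF \<theta>] by (auto simp: \<theta>eq spd_mats_def)
  have "w i powr (d / 2) / sqrt (det \<sigma>) *
        (let e = data_row d y i - transpose_mat \<beta> *\<^sub>v Matrix.row x i
         in exp (- (w i / 2) * scalar_prod e (inv_mat \<sigma> *\<^sub>v e))) =
      row_density \<sigma> (obs_row cells i) (\<lambda>j. y (i, j) - mean \<beta> i j) (w i)" if i: "i < n" for i
  proof -
    have row: "obs_row cells i = {..<d}" using i by (auto simp: obs_row_def)
    have "data_row d y i - transpose_mat \<beta> *\<^sub>v Matrix.row x i = subvec (\<lambda>j. y (i, j) - mean \<beta> i j) {..<d}"
      using \<beta> mean_eq[OF \<beta> i]
      by (intro eq_vecI) (auto simp: subvec_def data_row_def lessThan_atLeast0 simp del: index_mult_mat_vec)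
    then show ?thesis
      by (simp add: row_density_def row principal_mat_full[OF \<sigma>] Let_def inv_form_def mult.commute)
  qed
  then show ?thesis by (simp add: joint_density_def marginal_def \<theta>eq)
qed

text \<open>Only the factor of one row involves the cell \<open>c\<close>; the prior and the other
  rows leave the integral as a constant \<open>R\<close>, and the remaining factor is
  \<open>nn_integral_row_density\<close>.\<close>

lemma nn_integral_marginal_insert:
  assumes K: "K \<subseteq> cells" and c: "c \<in> cells" "c \<notin> K" and \<theta>: "\<theta> \<in> space \<Theta>" and w: "w \<in> space W"
  shows "(\<integral>\<^sup>+ t. ennreal (marginal (insert c K) (y(c := t)) w \<theta>) \<partial>lborel) =
    ennreal (sqrt (2 * pi)) * ennreal (marginal K y w \<theta>)"
proof -
  obtain i j where cij: "c = (i, j)" "i < n" "j < d" using c by auto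
  let ?r = "\<lambda>K y i. row_density (snd \<theta>) (obs_row K i) (\<lambda>j. y (i, j) - mean (fst \<theta>) i j) (w i)"
  define R where "R = prior_density a m \<theta> * (\<Prod>i\<in>{..<n} - {i}. ?r K y i)"
  have R: "R \<ge> 0" unfolding R_def
    using prior_density_pos[OF \<theta>] row_density_pos[OF K \<theta> _ space_W[OF w]]
    by (intro mult_nonneg_nonneg prod_nonneg) (auto intro: less_imp_le)
  have split: "marginal K y w \<theta> = R * ?r K y i"
    unfolding marginal_def R_def using cij by (subst prod.remove[of _ i]) (auto simp: mult_ac)
  have split': "marginal (insert c K) (y(c := t)) w \<theta> =
      R * row_density (snd \<theta>) (insert j (obs_row K i)) ((\<lambda>j. y (i, j) - mean (fst \<theta>) i j)(j := t - mean (fst \<theta>) i j)) (w i)" for t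
  proof -
    have "?r (insert c K) (y(c := t)) i' = ?r K y i'" if "i' \<noteq> i" for i'
      using that by (simp add: obs_row_def cij)
    then have "(\<Prod>i\<in>{..<n} - {i}. ?r (insert c K) (y(c := t)) i) = (\<Prod>i\<in>{..<n} - {i}. ?r K y i)" by simp
    moreover have "obs_row (insert c K) i = insert j (obs_row K i)" by (auto simp: obs_row_def cij)
    moreover have "(\<lambda>j'. (y(c := t)) (i, j') - mean (fst \<theta>) i j') =
        (\<lambda>j. y (i, j) - mean (fst \<theta>) i j)(j := t - mean (fst \<theta>) i j)"
      by (auto simp: cij)
    ultimately show ?thesis
      unfolding marginal_def R_def using cij by (subst prod.remove[of _ i]) (auto simp: mult_ac)
  qed
  have s: "snd \<theta> \<in> spd_mats d" using space_param_space[OF \<theta>] by simp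
  have j: "j \<notin> obs_row K i" using c by (simp add: obs_row_def cij)
  note int = nn_integral_row_density[OF s obs_row_subset[OF K] j cij(3) space_W[OF w cij(2)],
      of "\<lambda>j. y (i, j) - mean (fst \<theta>) i j" "mean (fst \<theta>) i j"]
  have meas: "(\<lambda>t. row_density (snd \<theta>) (insert j (obs_row K i))
      ((\<lambda>j. y (i, j) - mean (fst \<theta>) i j)(j := t - mean (fst \<theta>) i j)) (w i)) \<in> borel_measurable lborel"
    by (rule borel_measurable_row_density[of _ d])
       (use s cij obs_row_subset[OF K] in \<open>auto simp: mat_measurable_def spd_mats_def\<close>)
  have "(\<integral>\<^sup>+ t. ennreal (marginal (insert c K) (y(c := t)) w \<theta>) \<partial>lborel) =
    ennreal R * (ennreal (sqrt (2 * pi)) * ennreal (?r K y i))"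
    unfolding split' ennreal_mult'[OF R] using meas by (subst nn_integral_cmult) (auto simp: int)
  also have "\<dots> = ennreal (sqrt (2 * pi)) * ennreal (marginal K y w \<theta>)"
    unfolding split ennreal_mult'[OF R] by (simp add: mult_ac)
  finally show ?thesis .
qed

lemma borel_measurable_prior_density: "prior_density a m \<in> borel_measurable \<Theta>"
proof -
  note M = mat_measurable_param_space(2)[of p d]
  have sp: "\<And>\<theta>. \<theta> \<in> space \<Theta> \<Longrightarrow> snd \<theta> \<in> spd_mats d" using space_param_space by auto
  note [measurable] = borel_measurable_det[OF M]
  have I: "mat_measurable \<Theta> d d (\<lambda>\<theta>. inv_mat (snd \<theta>))"
    by (rule mat_measurable_inv_mat[OF M spd_mats_det_nonzero[OF sp]])
  have [measurable]: "(\<lambda>\<theta>. \<Sum>i<d. \<Sum>j<d. inv_mat (snd \<theta>) $$ (i, j) * a $$ (j, i)) \<in> borel_measurable \<Theta>"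
    using mat_measurable_entry[OF I] by (intro borel_measurable_sum borel_measurable_times) auto
  have "(\<lambda>\<theta>. det (snd \<theta>) powr (- (m + 1) / 2) *
      exp (- (1 / 2) * (\<Sum>i<d. \<Sum>j<d. inv_mat (snd \<theta>) $$ (i, j) * a $$ (j, i)))) \<in> borel_measurable \<Theta>"
    by measurable
  then show ?thesis
  proof (rule measurable_cong[THEN iffD1, rotated])
    fix \<theta> assume "\<theta> \<in> space \<Theta>"
    then have c: "inv_mat (snd \<theta>) \<in> carrier_mat d d" using spd_mats_inv_mat(1)[OF sp] by simp
    have "mat_trace (inv_mat (snd \<theta>) * a) = (\<Sum>i<d. \<Sum>j<d. inv_mat (snd \<theta>) $$ (i, j) * a $$ (j, i))"
      using c a by (simp add: mat_trace_def scalar_prod_def lessThan_atLeast0)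
    then show "det (snd \<theta>) powr (- (m + 1) / 2) *
      exp (- (1 / 2) * (\<Sum>i<d. \<Sum>j<d. inv_mat (snd \<theta>) $$ (i, j) * a $$ (j, i))) = prior_density a m \<theta>"
      by (simp add: prior_density_def case_prod_beta)
  qed
qed

lemma borel_measurable_marginal:
  assumes K: "K \<subseteq> cells" and y: "\<And>c. c \<in> K \<Longrightarrow> (\<lambda>\<omega>. y \<omega> c) \<in> borel_measurable N"
    and w: "w \<in> N \<rightarrow>\<^sub>M W" and \<theta>: "\<theta> \<in> N \<rightarrow>\<^sub>M \<Theta>"
  shows "(\<lambda>\<omega>. marginal K (y \<omega>) (w \<omega>) (\<theta> \<omega>)) \<in> borel_measurable N"
  unfolding marginal_def
proof (intro borel_measurable_times borel_measurable_prod)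
  show "(\<lambda>\<omega>. prior_density a m (\<theta> \<omega>)) \<in> borel_measurable N"
    by (rule measurable_compose[OF \<theta> borel_measurable_prior_density])
  fix i assume i: "i \<in> {..<n}"
  note M1 = mat_measurable_compose[OF mat_measurable_param_space(1) \<theta>]
    and M2 = mat_measurable_compose[OF mat_measurable_param_space(2) \<theta>]
  show "(\<lambda>\<omega>. row_density (snd (\<theta> \<omega>)) (obs_row K i) (\<lambda>j. y \<omega> (i, j) - mean (fst (\<theta> \<omega>)) i j) (w \<omega> i)) \<in> borel_measurable N"
  proof (rule borel_measurable_row_density[OF M2 _ obs_row_subset[OF K]])
    fix j assume j: "j \<in> obs_row K i"
    then have "j < d" using obs_row_subset[OF K] by auto
    then have "(\<lambda>\<omega>. mean (fst (\<theta> \<omega>)) i j) \<in> borel_measurable N"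
      unfolding mean_def using mat_measurable_entry[OF M1] by (intro borel_measurable_sum borel_measurable_times) auto
    then show "(\<lambda>\<omega>. y \<omega> (i, j) - mean (fst (\<theta> \<omega>)) i j) \<in> borel_measurable N"
      using y j by (intro borel_measurable_diff) (auto simp: obs_row_def)
  next
    show "(\<lambda>\<omega>. w \<omega> i) \<in> borel_measurable N"
      using i by (intro measurable_compose[OF w measurable_W_component]) auto
  qed (use measurable_space[OF \<theta>] space_param_space[of _ p d] w in auto)
qed

lemma product_sigma_finite_lborel: "product_sigma_finite (\<lambda>_. lborel :: real measure)"
  by (simp add: product_sigma_finite_def lborel.sigma_finite_measure_axioms)

lemma borel_measurable_merge:
  assumes "c \<in> K \<union> L" "v \<in> N \<rightarrow>\<^sub>M data_space L"
  shows "(\<lambda>\<omega>. merge K L (y, v \<omega>) c) \<in> borel_measurable N"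
proof (cases "c \<in> K")
  case False
  then have "c \<in> L" using assms by simp
  then have "(\<lambda>v. v c) \<in> borel_measurable (data_space L)" unfolding data_space_def
    using measurable_component_singleton[of c L "\<lambda>_. lborel :: real measure"] by simp
  then have "(\<lambda>\<omega>. v \<omega> c) \<in> borel_measurable N" by (rule measurable_compose[OF assms(2)])
  then show ?thesis using False \<open>c \<in> L\<close> by (simp add: merge_def)
qed (simp add: merge_def)

text \<open>By induction over the cells of \<open>L\<close>: the product measure splits off one
  coordinate, and each removed cell contributes one factor \<open>sqrt (2 * pi)\<close>.\<close>

lemma nn_integral_marginal_merge:
  assumes "finite L" "K \<inter> L = {}" "K \<union> L \<subseteq> cells" and \<theta>: "\<theta> \<in> space \<Theta>" and w: "w \<in> space W"
  shows "(\<integral>\<^sup>+ v. ennreal (marginal (K \<union> L) (merge K L (y, v)) w \<theta>) \<partial>data_space L) =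
    ennreal (sqrt (2 * pi)) ^ card L * ennreal (marginal K y w \<theta>)"
  using assms(1-3)
proof (induction L rule: finite_induct)
  case empty
  have "marginal K (merge K {} (y, v)) w \<theta> = marginal K y w \<theta>" for v
    using empty by (intro marginal_cong) (auto simp: merge_def)
  then show ?case by (simp add: data_space_def space_PiM_empty nn_integral_count_space_finite PiM_empty)
next
  case (insert c L)
  interpret product_sigma_finite "\<lambda>_ :: nat \<times> nat. lborel :: real measure" by (rule product_sigma_finite_lborel)
  have c: "c \<in> cells" "c \<notin> K \<union> L" "K \<union> L \<subseteq> cells" using insert by auto
  \<comment> \<open>Since \<open>c\<close> lies outside \<open>K\<close> and \<open>L\<close>, its
    value can be written into the merged data last, which is the form that the one-cell integral
    expects.\<close>
  have upd: "merge K (Set.insert c L) (y, v(c := t)) = (merge K L (y, v))(c := t)" for v t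
    using c by (auto simp: merge_def)
  have m: "(\<lambda>v. marginal (K \<union> Set.insert c L) (merge K (Set.insert c L) (y, v)) w \<theta>) \<in> borel_measurable (data_space (Set.insert c L))"
    using insert \<theta> w by (intro borel_measurable_marginal borel_measurable_merge) auto
  have m': "(\<lambda>v. marginal (K \<union> L) (merge K L (y, v)) w \<theta>) \<in> borel_measurable (data_space L)"
    using c \<theta> w by (intro borel_measurable_marginal borel_measurable_merge) auto
  have "(\<integral>\<^sup>+ v. ennreal (marginal (K \<union> Set.insert c L) (merge K (Set.insert c L) (y, v)) w \<theta>) \<partial>data_space (Set.insert c L)) =
    (\<integral>\<^sup>+ v. (\<integral>\<^sup>+ t. ennreal (marginal (Set.insert c (K \<union> L)) ((merge K L (y, v))(c := t)) w \<theta>) \<partial>lborel) \<partial>data_space L)"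
    using m insert(1,2) unfolding data_space_def by (subst product_nn_integral_insert) (auto simp: upd)
  also have "\<dots> = (\<integral>\<^sup>+ v. ennreal (sqrt (2 * pi)) * ennreal (marginal (K \<union> L) (merge K L (y, v)) w \<theta>) \<partial>data_space L)"
    by (simp add: nn_integral_marginal_insert[OF c(3,1,2) \<theta> w])
  also have "\<dots> = ennreal (sqrt (2 * pi)) * (ennreal (sqrt (2 * pi)) ^ card L * ennreal (marginal K y w \<theta>))"
    using m' insert by (subst nn_integral_cmult) auto
  finally show ?case using insert by (simp add: mult_ac)
qed

lemma obs_joint_density_eq:
  assumes K: "K \<subseteq> cells" and \<theta>: "\<theta> \<in> space \<Theta>" and w: "w \<in> space W"
  shows "obs_joint_density n d x a m K y w \<theta> =
    ennreal (sqrt (2 * pi)) ^ card (cells - K) * ennreal (marginal K y w \<theta>)"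
proof -
  have "K \<union> (cells - K) = cells" using K by auto
  then show ?thesis
    using nn_integral_marginal_merge[of "cells - K" K \<theta> w y] K \<theta> w
    by (simp add: obs_joint_density_def Let_def joint_density_eq_marginal[OF \<theta>])
qed

text \<open>The weights are independent under \<open>W\<close> and each enters the factor of its own
  row only, so the integral of the product is the product of the integrals in the
  definition.\<close>

lemma posterior_density_eq:
  assumes K: "K \<subseteq> cells" and \<theta>: "\<theta> \<in> space \<Theta>"
  shows "posterior_density n d x a m Pmix K y \<theta> = (\<integral>\<^sup>+ w. ennreal (marginal K y w \<theta>) \<partial>W)"
proof -
  interpret product_sigma_finite "\<lambda>_ :: nat. Pmix" by (rule product_sigma_finite_Pmix)
  let ?r = "\<lambda>i. row_density (snd \<theta>) (obs_row K i) (\<lambda>j. y (i, j) - mean (fst \<theta>) i j)"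
  have s: "snd \<theta> \<in> spd_mats d" using space_param_space[OF \<theta>] by simp
  have m: "(\<lambda>w. ennreal (?r i w)) \<in> borel_measurable Pmix" for i
    by (intro measurable_Pmix measurable_compose[OF borel_measurable_row_density[of _ d] measurable_ennreal])
       (use s obs_row_subset[OF K] in \<open>auto simp: mat_measurable_def spd_mats_def\<close>)
  have "(\<integral>\<^sup>+ w. ennreal (marginal K y w \<theta>) \<partial>W) = (\<integral>\<^sup>+ w. ennreal (prior_density a m \<theta>) * (\<Prod>i<n. ennreal (?r i (w i))) \<partial>W)"
  proof (rule nn_integral_cong)
    fix w assume w: "w \<in> space W"
    have "ennreal (\<Prod>i<n. ?r i (w i)) = (\<Prod>i<n. ennreal (?r i (w i)))"
      using row_density_pos[OF K \<theta> _ space_W[OF w]] by (intro prod_ennreal[symmetric]) (auto intro: less_imp_le)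
    then show "ennreal (marginal K y w \<theta>) = ennreal (prior_density a m \<theta>) * (\<Prod>i<n. ennreal (?r i (w i)))"
      using prior_density_pos[OF \<theta>] by (simp add: marginal_def ennreal_mult')
  qed
  also have "\<dots> = ennreal (prior_density a m \<theta>) * (\<integral>\<^sup>+ w. (\<Prod>i<n. ennreal (?r i (w i))) \<partial>W)"
    unfolding weight_space_def
    by (intro nn_integral_cmult borel_measurable_prod_ennreal measurable_compose[OF measurable_component_singleton[where M="\<lambda>_. Pmix"] m]) auto
  also have "(\<integral>\<^sup>+ w. (\<Prod>i<n. ennreal (?r i (w i))) \<partial>W) = (\<Prod>i<n. \<integral>\<^sup>+ w. ennreal (?r i w) \<partial>Pmix)"
    unfolding weight_space_def by (rule product_nn_integral_prod) (use m in auto)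
  also have "ennreal (prior_density a m \<theta>) * \<dots> = posterior_density n d x a m Pmix K y \<theta>"
    by (cases \<theta>) (use row_density_eq[OF K \<theta>, of _ y] in \<open>simp add: posterior_density_def\<close>)
  finally show ?thesis by simp
qed

lemma posterior_density_pos:
  assumes K: "K \<subseteq> cells" and \<theta>: "\<theta> \<in> space \<Theta>"
  shows "posterior_density n d x a m Pmix K y \<theta> > 0"
proof (rule ccontr)
  assume "\<not> ?thesis"
  then have "(\<integral>\<^sup>+ w. ennreal (marginal K y w \<theta>) \<partial>W) = 0" using posterior_density_eq[OF assms] by simp
  moreover have "(\<lambda>w. marginal K y w \<theta>) \<in> borel_measurable W"
    using \<theta> by (intro borel_measurable_marginal[OF K]) auto
  ultimately have "AE w in W. ennreal (marginal K y w \<theta>) = 0" by (subst (asm) nn_integral_0_iff_AE) auto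
  then have "AE w in W. False" using AE_space
    by eventually_elim (use marginal_pos[OF K \<theta>, of _ y] in \<open>fastforce simp: ennreal_eq_0_iff\<close>)
  then show False using prob_space.AE_False[OF prob_space_W] by simp
qed

text \<open>Rows may have fewer than \<open>d\<close> observed entries, so lower powers must be
  dominated too; the summand 1 covers weights up to 1.\<close>

lemma powr_le_moment:
  fixes w :: real
  assumes "0 < w" "k \<le> d"
  shows "w powr (k / 2) \<le> 1 + w powr (d / 2)"
proof (cases "w \<le> 1")
  case True
  then have "w powr (k / 2) \<le> 1" using assms by (simp add: powr_le1)
  then show ?thesis by (simp add: add_increasing2)
next
  case False
  then have "w powr (k / 2) \<le> w powr (d / 2)" using assms by (intro powr_mono) auto
  then show ?thesis by simp
qed

text \<open>The residual form is nonnegative, so the exponential is at most 1 and only a moment of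
  the weights remains. The bound holds at every \<theta>, hence I1 is well defined from every
  state.\<close>

lemma posterior_density_fin:
  assumes K: "K \<subseteq> cells" and \<theta>: "\<theta> \<in> space \<Theta>"
  shows "posterior_density n d x a m Pmix K y \<theta> < \<infinity>"
proof -
  interpret prob_space Pmix by (rule Pmix)
  have "(\<integral>\<^sup>+ w. ennreal (w powr (obs_dim K i / 2) / sqrt (det (obs_cov d K i (snd \<theta>))) *
        exp (- (resid d x K y i \<theta> * w / 2))) \<partial>Pmix) < \<infinity>" if i: "i < n" for i
  proof -
    let ?D = "sqrt (det (obs_cov d K i (snd \<theta>)))"
    have D: "?D > 0" using det_obs_cov_pos[OF assms] by simp
    have k: "obs_dim K i \<le> d"
      using card_mono[OF _ obs_row_subset[OF K]] by (simp add: obs_dim_eq)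
    have "(\<integral>\<^sup>+ w. ennreal (w powr (obs_dim K i / 2) / ?D * exp (- (resid d x K y i \<theta> * w / 2))) \<partial>Pmix) \<le>
      (\<integral>\<^sup>+ w. ennreal (1 / ?D) * (1 + ennreal (w powr (d / 2))) \<partial>Pmix)"
    proof (rule nn_integral_mono)
      fix w assume "w \<in> space Pmix"
      then have w: "w > 0" by (simp add: space_Pmix)
      have "w powr (obs_dim K i / 2) / ?D * exp (- (resid d x K y i \<theta> * w / 2)) \<le>
         (1 + w powr (d / 2)) / ?D * 1"
        using powr_le_moment[OF w k] D w resid_nonneg[OF K \<theta> i, of y]
        by (intro mult_mono divide_right_mono) auto
      then have "ennreal (w powr (obs_dim K i / 2) / ?D * exp (- (resid d x K y i \<theta> * w / 2))) \<le>
         ennreal (1 / ?D * (1 + w powr (d / 2)))" by (intro ennreal_leI) simp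
      also have "\<dots> = ennreal (1 / ?D) * (1 + ennreal (w powr (d / 2)))"
        using D by (subst ennreal_mult) auto
      finally show "ennreal (w powr (obs_dim K i / 2) / ?D * exp (- (resid d x K y i \<theta> * w / 2))) \<le>
         ennreal (1 / ?D) * (1 + ennreal (w powr (d / 2)))" .
    qed
    also have "\<dots> = ennreal (1 / ?D) * (1 + (\<integral>\<^sup>+ w. ennreal (w powr (d / 2)) \<partial>Pmix))"
    proof -
      have [measurable]: "(\<lambda>w. w powr (real d / 2)) \<in> borel_measurable Pmix"
        by (rule measurable_Pmix) measurable
      show ?thesis by (subst nn_integral_cmult) (auto simp: nn_integral_add emeasure_space_1)
    qed
    also have "\<dots> < \<infinity>" using moment by (auto simp: ennreal_mult_less_top)
    finally show ?thesis .
  qed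
  then have "(\<Prod>i<n. \<integral>\<^sup>+ w. ennreal (w powr (obs_dim K i / 2) / sqrt (det (obs_cov d K i (snd \<theta>))) *
        exp (- (resid d x K y i \<theta> * w / 2))) \<partial>Pmix) < \<infinity>"
    by (auto simp: less_top[symmetric] ennreal_prod_eq_top)
  then show ?thesis by (cases \<theta>) (auto simp: posterior_density_def ennreal_mult_less_top)
qed

section \<open>Properness and recurrence\<close>

lemma sigma_finite_data_space: "L \<subseteq> cells \<Longrightarrow> sigma_finite_measure (data_space L)"
  unfolding data_space_def by (intro sigma_finite_PiM_lborel) (auto dest: finite_subset)

lemma borel_measurable_marginal_merge:
  assumes "K \<union> L \<subseteq> cells" and v: "v \<in> N \<rightarrow>\<^sub>M data_space L"
    and "w \<in> N \<rightarrow>\<^sub>M W" and "\<theta> \<in> N \<rightarrow>\<^sub>M \<Theta>"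
  shows "(\<lambda>\<omega>. ennreal (marginal (K \<union> L) (merge K L (y, v \<omega>)) (w \<omega>) (\<theta> \<omega>))) \<in> borel_measurable N"
  using assms
  by (intro measurable_compose[OF _ measurable_ennreal] borel_measurable_marginal borel_measurable_merge)

lemma sqrt_2pi_power: "0 < ennreal (sqrt (2 * pi)) ^ k" "ennreal (sqrt (2 * pi)) ^ k < \<infinity>"
  by (simp_all add: ennreal_power)

lemma borel_measurable_posterior_density:
  assumes "K \<subseteq> cells"
  shows "posterior_density n d x a m Pmix K y \<in> borel_measurable \<Theta>"
proof -
  interpret W: prob_space W by (rule prob_space_W)
  have "(\<lambda>\<theta>. \<integral>\<^sup>+ w. ennreal (marginal K y w \<theta>) \<partial>W) \<in> borel_measurable \<Theta>"
    by (rule W.borel_measurable_nn_integral)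
       (unfold case_prod_beta, intro measurable_compose[OF _ measurable_ennreal] borel_measurable_marginal assms, auto)
  then show ?thesis
    by (rule measurable_cong[THEN iffD1, rotated]) (simp add: posterior_density_eq[OF assms])
qed

lemma AE_posterior_proper:
  assumes disj: "K \<inter> L = {}" and sub: "K \<union> L \<subseteq> cells"
    and proper: "posterior_proper n p d x a m Pmix K z"
  shows "AE v in data_space L. posterior_proper n p d x a m Pmix (K \<union> L) (merge K L (z, v))"
proof -
  let ?D = "data_space L"
  let ?g = "\<lambda>v \<theta> w. ennreal (marginal (K \<union> L) (merge K L (z, v)) w \<theta>)"
  have L: "L \<subseteq> cells" and K: "K \<subseteq> cells" using sub by auto
  interpret W: prob_space W by (rule prob_space_W)
  interpret D: sigma_finite_measure ?D by (rule sigma_finite_data_space[OF L])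
  interpret Th: sigma_finite_measure \<Theta> by (rule sigma_finite_param_space)
  interpret DT: pair_sigma_finite ?D \<Theta> ..
  interpret DW: pair_sigma_finite ?D W ..
  \<comment> \<open>Measurability is joint in data, parameter and weights because Tonelli is applied
    twice: to data and parameter, then to data and weights for a fixed parameter.\<close>
  have g: "(\<lambda>q. ?g (fst (fst q)) (snd (fst q)) (snd q)) \<in> borel_measurable ((?D \<Otimes>\<^sub>M \<Theta>) \<Otimes>\<^sub>M W)"
    by (rule borel_measurable_marginal_merge[OF sub]) auto
  then have gW[measurable]: "(\<lambda>(v, \<theta>). \<integral>\<^sup>+ w. ?g v \<theta> w \<partial>W) \<in> borel_measurable (?D \<Otimes>\<^sub>M \<Theta>)"
    unfolding case_prod_beta by (intro W.borel_measurable_nn_integral) (simp add: case_prod_beta)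
  have fin: "finite L" using L by (rule finite_subset) simp
  have "(\<integral>\<^sup>+ v. (\<integral>\<^sup>+ \<theta>. (\<integral>\<^sup>+ w. ?g v \<theta> w \<partial>W) \<partial>\<Theta>) \<partial>?D) = (\<integral>\<^sup>+ \<theta>. (\<integral>\<^sup>+ v. (\<integral>\<^sup>+ w. ?g v \<theta> w \<partial>W) \<partial>?D) \<partial>\<Theta>)"
    by (rule DT.Fubini'[OF gW, symmetric])
  also have "\<dots> = (\<integral>\<^sup>+ \<theta>. ennreal (sqrt (2 * pi)) ^ card L * posterior_density n d x a m Pmix K z \<theta> \<partial>\<Theta>)"
  proof (rule nn_integral_cong)
    fix \<theta> assume \<theta>: "\<theta> \<in> space \<Theta>"
    have "(\<lambda>q. ?g (fst q) \<theta> (snd q)) \<in> borel_measurable (?D \<Otimes>\<^sub>M W)"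
      by (rule borel_measurable_marginal_merge[OF sub]) (use \<theta> in auto)
    then have "(\<integral>\<^sup>+ v. (\<integral>\<^sup>+ w. ?g v \<theta> w \<partial>W) \<partial>?D) = (\<integral>\<^sup>+ w. (\<integral>\<^sup>+ v. ?g v \<theta> w \<partial>?D) \<partial>W)"
      by (intro DW.Fubini'[symmetric]) (simp add: case_prod_beta)
    also have "\<dots> = (\<integral>\<^sup>+ w. ennreal (sqrt (2 * pi)) ^ card L * ennreal (marginal K z w \<theta>) \<partial>W)"
      by (rule nn_integral_cong) (rule nn_integral_marginal_merge[OF fin disj sub \<theta>])
    also have "\<dots> = ennreal (sqrt (2 * pi)) ^ card L * (\<integral>\<^sup>+ w. ennreal (marginal K z w \<theta>) \<partial>W)"
      using \<theta> by (intro nn_integral_cmult measurable_compose[OF _ measurable_ennreal] borel_measurable_marginal[OF K]) auto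
    finally show "(\<integral>\<^sup>+ v. (\<integral>\<^sup>+ w. ?g v \<theta> w \<partial>W) \<partial>?D) =
        ennreal (sqrt (2 * pi)) ^ card L * posterior_density n d x a m Pmix K z \<theta>"
      by (simp add: posterior_density_eq[OF K \<theta>])
  qed
  also have "\<dots> = ennreal (sqrt (2 * pi)) ^ card L * (\<integral>\<^sup>+ \<theta>. posterior_density n d x a m Pmix K z \<theta> \<partial>\<Theta>)"
    by (rule nn_integral_cmult[OF borel_measurable_posterior_density[OF K]])
  also have "\<dots> < \<infinity>"
    using proper sqrt_2pi_power by (simp add: posterior_proper_def ennreal_mult_less_top)
  finally have "(\<integral>\<^sup>+ v. (\<integral>\<^sup>+ \<theta>. (\<integral>\<^sup>+ w. ?g v \<theta> w \<partial>W) \<partial>\<Theta>) \<partial>?D) \<noteq> \<infinity>" by simp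
  then have "AE v in ?D. (\<integral>\<^sup>+ \<theta>. (\<integral>\<^sup>+ w. ?g v \<theta> w \<partial>W) \<partial>\<Theta>) \<noteq> \<infinity>"
    by (intro nn_integral_PInf_AE Th.borel_measurable_nn_integral[OF gW])
  then show ?thesis
    by eventually_elim
       (simp add: posterior_proper_def posterior_density_eq[OF sub] less_top[symmetric] cong: nn_integral_cong)
qed

section \<open>The DAI chain as data augmentation\<close>

lemma I1_step_eq:
  assumes K: "K \<subseteq> cells" and \<theta>: "\<theta> \<in> space \<Theta>"
  shows "I1_step n d x Pmix K y \<theta> = normalized (density W (\<lambda>w. ennreal (marginal K y w \<theta>)))"
proof -
  \<comment> \<open>The factors of the joint density that do not depend on the weights and are
    omitted in I1.\<close>
  define s where "s = prior_density a m \<theta> * (\<Prod>i<n. 1 / sqrt (det (obs_cov d K i (snd \<theta>))))"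
  let ?g = "\<lambda>w. \<Prod>i<n. ennreal (w i powr (obs_dim K i / 2) * exp (- (resid d x K y i \<theta> * w i / 2)))"
  have s: "s > 0" unfolding s_def
    using prior_density_pos[OF \<theta>] det_obs_cov_pos[OF K \<theta>] by (intro mult_pos_pos prod_pos) auto
  have "ennreal (marginal K y w \<theta>) = ennreal s * ?g w" for w
  proof -
    have "marginal K y w \<theta> = s * (\<Prod>i<n. w i powr (obs_dim K i / 2) * exp (- (resid d x K y i \<theta> * w i / 2)))"
      by (simp add: marginal_def row_density_eq[OF K \<theta>] s_def prod.distrib prod_dividef)
    moreover have "(\<Prod>i<n. ennreal (w i powr (obs_dim K i / 2) * exp (- (resid d x K y i \<theta> * w i / 2)))) =
        ennreal (\<Prod>i<n. w i powr (obs_dim K i / 2) * exp (- (resid d x K y i \<theta> * w i / 2)))"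
      by (intro prod_ennreal) simp
    ultimately show ?thesis using s by (simp only: ennreal_mult'[OF less_imp_le])
  qed
  moreover have "?g \<in> borel_measurable W"
    by (intro borel_measurable_prod_ennreal) measurable
  ultimately show ?thesis using s
    by (simp add: I1_step_def normalized_density_cmult)
qed

lemma I2_step_eq:
  assumes K: "K \<subseteq> Kt" and Kt: "Kt \<subseteq> cells" and \<theta>: "\<theta> \<in> space \<Theta>" and w: "w \<in> space W"
  shows "I2_step n d x a m K Kt y \<theta> w =
    normalized (density (data_space (Kt - K)) (\<lambda>u. ennreal (marginal Kt (merge K (Kt - K) (y, u)) w \<theta>)))"
proof -
  have "K \<union> (Kt - K) = Kt" using K by auto
  then have "(\<lambda>u. ennreal (marginal Kt (merge K (Kt - K) (y, u)) w \<theta>)) \<in> borel_measurable (data_space (Kt - K))"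
    using borel_measurable_marginal_merge[of K "Kt - K" "\<lambda>u. u" "data_space (Kt - K)" "\<lambda>_. w" "\<lambda>_. \<theta>" y] Kt \<theta> w by simp
  then show ?thesis unfolding I2_step_def obs_joint_density_eq[OF Kt \<theta> w]
    by (rule normalized_density_cmult[OF _ sqrt_2pi_power])
qed

text \<open>The augmented datum is the pair of weights and imputed entries. The normalizing constant
  of I2 is, up to \<open>c\<close>, the unnormalized density of I1, so by the chain rule the two
  draws amount to a single draw of the pair from the slice \<open>f \<theta>\<close> of the joint
  density.\<close>

theorem DAI_kernel_Harris_recurrent:
  assumes K: "K \<subseteq> Kt" and Kt: "Kt \<subseteq> cells"
    and proper: "posterior_proper n p d x a m Pmix K y"
    and version: "P_step_version n p d x a m Pmix K Kt y Q"
  shows "Harris_recurrent \<Theta> (DAI_kernel n d x a m Pmix K Kt y Q)"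
proof -
  define L where "L = Kt - K"
  let ?D = "data_space L"
  define c where "c = ennreal (sqrt (2 * pi)) ^ card L"
  define f where "f \<theta> v = ennreal (marginal Kt (merge K L (y, snd v)) (fst v) \<theta>)" for \<theta> v
  have KL: "K \<union> L = Kt" "K \<inter> L = {}" using K by (auto simp: L_def)
  have L: "L \<subseteq> cells" and Kc: "K \<subseteq> cells" using K Kt by (auto simp: L_def)
  have finL: "finite L" using L by (rule finite_subset) simp
  have c: "0 < c" "c < \<infinity>" unfolding c_def by (rule sqrt_2pi_power)+
  interpret W: prob_space W by (rule prob_space_W)
  interpret D: sigma_finite_measure ?D by (rule sigma_finite_data_space[OF L])
  interpret WD: pair_sigma_finite W ?D ..
  have meas: "(\<lambda>\<omega>. f (\<theta> \<omega>) (w \<omega>, u \<omega>)) \<in> borel_measurable N"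
    if "\<theta> \<in> N \<rightarrow>\<^sub>M \<Theta>" "w \<in> N \<rightarrow>\<^sub>M W" "u \<in> N \<rightarrow>\<^sub>M ?D" for \<theta> w u and N :: "'n measure"
    using borel_measurable_marginal_merge[of K L u N w \<theta> y] that Kt by (simp add: f_def KL)
  have int_u: "(\<integral>\<^sup>+ u. f \<theta> (w, u) \<partial>?D) = c * ennreal (marginal K y w \<theta>)"
    if "\<theta> \<in> space \<Theta>" "w \<in> space W" for \<theta> w
    using nn_integral_marginal_merge[OF finL KL(2) _ that, of y] Kt by (simp add: f_def KL c_def)
  have mK: "(\<lambda>w. ennreal (marginal K y w \<theta>)) \<in> borel_measurable W" if "\<theta> \<in> space \<Theta>" for \<theta>
    using that by (intro measurable_compose[OF _ measurable_ennreal] borel_measurable_marginal[OF Kc]) auto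
  have mV: "f \<theta> \<in> borel_measurable (W \<Otimes>\<^sub>M ?D)" if "\<theta> \<in> space \<Theta>" for \<theta>
    using meas[of "\<lambda>_. \<theta>" "W \<Otimes>\<^sub>M ?D" fst snd] that by simp
  let ?Z = "posterior_density n d x a m Pmix K y"
  have int_v: "(\<integral>\<^sup>+ v. f \<theta> v \<partial>(W \<Otimes>\<^sub>M ?D)) = c * ?Z \<theta>" if \<theta>: "\<theta> \<in> space \<Theta>" for \<theta>
  proof -
    have "(\<integral>\<^sup>+ v. f \<theta> v \<partial>(W \<Otimes>\<^sub>M ?D)) = (\<integral>\<^sup>+ w. (\<integral>\<^sup>+ u. f \<theta> (w, u) \<partial>?D) \<partial>W)"
      by (rule D.nn_integral_fst[OF mV[OF \<theta>], symmetric])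
    also have "\<dots> = (\<integral>\<^sup>+ w. c * ennreal (marginal K y w \<theta>) \<partial>W)"
      by (rule nn_integral_cong) (rule int_u[OF \<theta>])
    also have "\<dots> = c * ?Z \<theta>"
      unfolding posterior_density_eq[OF Kc \<theta>] by (rule nn_integral_cmult[OF mK[OF \<theta>]])
    finally show ?thesis .
  qed
  have Z: "0 < ?Z \<theta>" "?Z \<theta> < \<infinity>" if "\<theta> \<in> space \<Theta>" for \<theta>
    using posterior_density_pos[OF Kc that] posterior_density_fin[OF Kc that] by auto
  have mpos: "0 < ennreal (marginal K y w \<theta>)" if "\<theta> \<in> space \<Theta>" "w \<in> space W" for \<theta> w
    using marginal_pos[OF Kc that] by simp
  have Q: "Q \<in> W \<Otimes>\<^sub>M ?D \<rightarrow>\<^sub>M prob_algebra \<Theta>"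
    using version by (simp add: P_step_version_def L_def)
  \<comment> \<open>The steps are restated through the joint density, which is jointly measurable.
    Agreement with the original steps holds on the state space, and \<open>\<kappa>_bind\<close>
    transfers the kernel property.\<close>
  define I1 where "I1 \<theta> = normalized (density W (\<lambda>w. ennreal (marginal K y w \<theta>)))" for \<theta>
  define I2 where "I2 \<theta> w = normalized (density ?D (\<lambda>u. f \<theta> (w, u)))" for \<theta> w
  have I1: "I1 \<in> \<Theta> \<rightarrow>\<^sub>M prob_algebra W"
    unfolding I1_def
  proof (rule measurable_normalized_density)
    show "(\<lambda>(\<theta>, w). ennreal (marginal K y w \<theta>)) \<in> borel_measurable (\<Theta> \<Otimes>\<^sub>M W)"
      unfolding case_prod_beta
      by (intro measurable_compose[OF _ measurable_ennreal] borel_measurable_marginal[OF Kc]) auto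
  qed (use Z posterior_density_eq[OF Kc] W.sigma_finite_measure_axioms in auto)
  have I2: "(\<lambda>\<omega>. I2 (fst \<omega>) (snd \<omega>)) \<in> \<Theta> \<Otimes>\<^sub>M W \<rightarrow>\<^sub>M prob_algebra ?D"
    unfolding I2_def
  proof (rule measurable_normalized_density[OF D.sigma_finite_measure_axioms])
    show "(\<lambda>(\<omega>, u). f (fst \<omega>) (snd \<omega>, u)) \<in> borel_measurable ((\<Theta> \<Otimes>\<^sub>M W) \<Otimes>\<^sub>M ?D)"
      unfolding case_prod_beta by (rule meas) auto
    fix \<omega> assume "\<omega> \<in> space (\<Theta> \<Otimes>\<^sub>M W)"
    then have \<omega>: "fst \<omega> \<in> space \<Theta>" "snd \<omega> \<in> space W" by (auto simp: space_pair_measure)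
    show "0 < (\<integral>\<^sup>+ u. f (fst \<omega>) (snd \<omega>, u) \<partial>?D)" "(\<integral>\<^sup>+ u. f (fst \<omega>) (snd \<omega>, u) \<partial>?D) < \<infinity>"
      unfolding int_u[OF \<omega>] using c mpos[OF \<omega>] by (auto simp: ennreal_mult_less_top ennreal_zero_less_mult_iff)
  qed
  have I2': "(\<lambda>(\<theta>, w). I2 \<theta> w \<bind> (\<lambda>u. Q (w, u))) \<in> \<Theta> \<Otimes>\<^sub>M W \<rightarrow>\<^sub>M prob_algebra \<Theta>"
    unfolding case_prod_beta
  proof (rule measurable_bind_prob_space2[OF I2])
    show "(\<lambda>(\<omega>, u). Q (snd \<omega>, u)) \<in> (\<Theta> \<Otimes>\<^sub>M W) \<Otimes>\<^sub>M ?D \<rightarrow>\<^sub>M prob_algebra \<Theta>"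
      unfolding case_prod_beta by (rule measurable_compose[OF _ Q]) measurable
  qed
  let ?\<kappa> = "DAI_kernel n d x a m Pmix K Kt y Q"
  have \<kappa>_bind: "?\<kappa> \<theta> = I1 \<theta> \<bind> (\<lambda>w. I2 \<theta> w \<bind> (\<lambda>u. Q (w, u)))" if \<theta>: "\<theta> \<in> space \<Theta>" for \<theta>
    unfolding DAI_kernel_def
    by (rule bind_cong)
       (auto simp: I1_step_eq[OF Kc \<theta>] I2_step_eq[OF K Kt \<theta>] I1_def I2_def f_def L_def)
  have \<kappa>: "?\<kappa> \<in> \<Theta> \<rightarrow>\<^sub>M prob_algebra \<Theta>"
    using measurable_bind_prob_space2[OF I1 I2'] by (rule measurable_cong[THEN iffD1, rotated]) (simp add: \<kappa>_bind)
  show ?thesis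
  proof (rule data_augmentation_Harris_recurrent[where V="W \<Otimes>\<^sub>M ?D" and f=f and Q=Q])
    show "sigma_finite_measure \<Theta>" by (rule sigma_finite_param_space)
    show "sigma_finite_measure (W \<Otimes>\<^sub>M ?D)" by (rule WD.sigma_finite_measure_axioms)
    show "space (W \<Otimes>\<^sub>M ?D) \<noteq> {}"
      using W.not_empty by (simp add: space_pair_measure data_space_def space_PiM PiE_eq_empty_iff)
    show "(\<lambda>(\<theta>, v). f \<theta> v) \<in> borel_measurable (\<Theta> \<Otimes>\<^sub>M (W \<Otimes>\<^sub>M ?D))"
      using meas[of fst "\<Theta> \<Otimes>\<^sub>M (W \<Otimes>\<^sub>M ?D)" "\<lambda>q. fst (snd q)" "\<lambda>q. snd (snd q)"] by (simp add: case_prod_beta)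
    show "f \<theta> v > 0" if "\<theta> \<in> space \<Theta>" "v \<in> space (W \<Otimes>\<^sub>M ?D)" for \<theta> v
      using marginal_pos[OF Kt that(1), of "fst v"] that(2) by (auto simp: f_def space_pair_measure)
    show "0 < (\<integral>\<^sup>+ v. f \<theta> v \<partial>(W \<Otimes>\<^sub>M ?D))" "(\<integral>\<^sup>+ v. f \<theta> v \<partial>(W \<Otimes>\<^sub>M ?D)) < \<infinity>" if "\<theta> \<in> space \<Theta>" for \<theta>
      unfolding int_v[OF that] using c Z[OF that] by (auto simp: ennreal_mult_less_top ennreal_zero_less_mult_iff)
    have "(\<integral>\<^sup>+ \<theta>. (\<integral>\<^sup>+ v. f \<theta> v \<partial>(W \<Otimes>\<^sub>M ?D)) \<partial>\<Theta>) = c * (\<integral>\<^sup>+ \<theta>. ?Z \<theta> \<partial>\<Theta>)"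
      using nn_integral_cmult[OF borel_measurable_posterior_density[OF Kc]] by (simp add: int_v cong: nn_integral_cong)
    then show "(\<integral>\<^sup>+ \<theta>. (\<integral>\<^sup>+ v. f \<theta> v \<partial>(W \<Otimes>\<^sub>M ?D)) \<partial>\<Theta>) < \<infinity>"
      using proper c by (simp add: posterior_proper_def ennreal_mult_less_top)
    show "Q \<in> W \<Otimes>\<^sub>M ?D \<rightarrow>\<^sub>M prob_algebra \<Theta>" by (rule Q)
    show "Q v = normalized (density \<Theta> (\<lambda>\<theta>. f \<theta> v))"
      if v: "v \<in> space (W \<Otimes>\<^sub>M ?D)" and fin: "(\<integral>\<^sup>+ \<theta>. f \<theta> v \<partial>\<Theta>) < \<infinity>" for v
    proof -
      obtain w u where vwu: "v = (w, u)" and w: "w \<in> space W" and u: "u \<in> space ?D"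
        using v by (auto simp: space_pair_measure)
      \<comment> \<open>The cells outside \<open>Kt\<close> are integrated out in
        \<open>P_measure\<close>, so its density is \<open>f\<close> times this constant. It is
        positive and finite, hence neither finiteness of the mass nor normalization is
        affected.\<close>
      define C where "C = ennreal (sqrt (2 * pi)) ^ card (cells - Kt)"
      have C: "0 < C" "C < \<infinity>" unfolding C_def by (rule sqrt_2pi_power)+
      have mf: "(\<lambda>\<theta>. f \<theta> v) \<in> borel_measurable \<Theta>"
        using meas[of "\<lambda>\<theta>. \<theta>" \<Theta> "\<lambda>_. w" "\<lambda>_. u"] w u by (simp add: vwu)
      have P: "P_measure n p d x a m K Kt y w u = density \<Theta> (\<lambda>\<theta>. C * f \<theta> v)"
      proof -
        have eq: "obs_joint_density n d x a m Kt (merge K L (y, u)) w \<theta> = C * f \<theta> v" if "\<theta> \<in> space \<Theta>" for \<theta>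
          using obs_joint_density_eq[OF Kt that w] by (simp add: f_def vwu C_def)
        have m1: "(\<lambda>\<theta>. C * f \<theta> v) \<in> borel_measurable \<Theta>" using mf by simp
        then have "obs_joint_density n d x a m Kt (merge K L (y, u)) w \<in> borel_measurable \<Theta>"
          by (rule measurable_cong[THEN iffD1, rotated]) (simp add: eq)
        then show ?thesis unfolding P_measure_def L_def[symmetric]
          using m1 by (intro density_cong) (auto simp: eq)
      qed
      have "emeasure (P_measure n p d x a m K Kt y w u) (space \<Theta>) = C * (\<integral>\<^sup>+ \<theta>. f \<theta> v \<partial>\<Theta>)"
        unfolding P using mf by (simp add: emeasure_density nn_integral_cmult cong: nn_integral_cong)
      also have "\<dots> < \<infinity>" using fin C by (simp add: ennreal_mult_less_top)
      finally have "Q v = normalized (P_measure n p d x a m K Kt y w u)"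
        using version w u by (simp add: P_step_version_def vwu L_def)
      then show ?thesis unfolding P normalized_density_cmult[OF mf C] .
    qed
    show "?\<kappa> \<in> \<Theta> \<rightarrow>\<^sub>M prob_algebra \<Theta>" by (rule \<kappa>)
    fix \<theta> A assume \<theta>: "\<theta> \<in> space \<Theta>" and A: "A \<in> sets \<Theta>"
    have QA: "(\<lambda>v. emeasure (Q v) A) \<in> borel_measurable (W \<Otimes>\<^sub>M ?D)"
      by (rule measurable_compose[OF measurable_prob_algebraD[OF Q] measurable_emeasure_subprob_algebra[OF A]])
    have I1s: "I1 \<theta> \<in> space (prob_algebra W)" using measurable_space[OF I1 \<theta>] .
    have B: "(\<lambda>w. I2 \<theta> w \<bind> (\<lambda>u. Q (w, u))) \<in> W \<rightarrow>\<^sub>M prob_algebra \<Theta>"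
      using measurable_compose[OF measurable_Pair1'[OF \<theta>] I2'] by simp
    have fQ: "(\<lambda>v. f \<theta> v * emeasure (Q v) A) \<in> borel_measurable (W \<Otimes>\<^sub>M ?D)"
      using mV[OF \<theta>] QA by (rule borel_measurable_times_ennreal)
    \<comment> \<open>The chain rule: the I1 density cancels against the same factor in the
      normalizing constant of I2 and only \<open>inverse c\<close> is left. The cancellation in
      \<open>ennreal\<close> needs the marginal positive and finite, which holds at every state and
      weight.\<close>
    have inner: "ennreal (marginal K y w \<theta>) * emeasure (I2 \<theta> w \<bind> (\<lambda>u. Q (w, u))) A =
       inverse c * (\<integral>\<^sup>+ u. f \<theta> (w, u) * emeasure (Q (w, u)) A \<partial>?D)" if w: "w \<in> space W" for w
    proof -
      have I2s: "I2 \<theta> w \<in> space (prob_algebra ?D)"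
        using measurable_space[OF I2, of "(\<theta>, w)"] \<theta> w by (simp add: space_pair_measure)
      have Qw: "(\<lambda>u. Q (w, u)) \<in> ?D \<rightarrow>\<^sub>M prob_algebra \<Theta>"
        by (rule measurable_compose[OF measurable_Pair1'[OF w] Q])
      have "emeasure (I2 \<theta> w \<bind> (\<lambda>u. Q (w, u))) A = (\<integral>\<^sup>+ u. emeasure (Q (w, u)) A \<partial>I2 \<theta> w)"
        by (rule emeasure_bind_prob_algebra[OF I2s Qw A])
      also have "\<dots> = inverse (c * ennreal (marginal K y w \<theta>)) * (\<integral>\<^sup>+ u. f \<theta> (w, u) * emeasure (Q (w, u)) A \<partial>?D)"
        unfolding I2_def int_u[OF \<theta> w, symmetric]
        by (rule nn_integral_normalized_density)
           (use measurable_compose[OF measurable_Pair1'[OF w] mV[OF \<theta>]] measurable_compose[OF measurable_Pair1'[OF w] QA] in auto)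
      also have "inverse (c * ennreal (marginal K y w \<theta>)) = inverse c * inverse (ennreal (marginal K y w \<theta>))"
        using c mpos[OF \<theta> w] by (intro ennreal_inverse_mult) auto
      finally have "ennreal (marginal K y w \<theta>) * emeasure (I2 \<theta> w \<bind> (\<lambda>u. Q (w, u))) A =
         (inverse (ennreal (marginal K y w \<theta>)) * ennreal (marginal K y w \<theta>)) *
         (inverse c * (\<integral>\<^sup>+ u. f \<theta> (w, u) * emeasure (Q (w, u)) A \<partial>?D))"
        by (simp add: mult_ac)
      then show ?thesis using ennreal_inverse_mult_self[OF mpos[OF \<theta> w]] by simp
    qed
    have "emeasure (?\<kappa> \<theta>) A = (\<integral>\<^sup>+ w. emeasure (I2 \<theta> w \<bind> (\<lambda>u. Q (w, u))) A \<partial>I1 \<theta>)"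
      unfolding \<kappa>_bind[OF \<theta>] by (rule emeasure_bind_prob_algebra[OF I1s B A])
    also have "\<dots> = inverse (?Z \<theta>) * (\<integral>\<^sup>+ w. ennreal (marginal K y w \<theta>) * emeasure (I2 \<theta> w \<bind> (\<lambda>u. Q (w, u))) A \<partial>W)"
      unfolding I1_def posterior_density_eq[OF Kc \<theta>]
      by (rule nn_integral_normalized_density[OF mK[OF \<theta>]])
         (rule measurable_compose[OF measurable_prob_algebraD[OF B] measurable_emeasure_subprob_algebra[OF A]])
    also have "\<dots> = inverse (?Z \<theta>) * (\<integral>\<^sup>+ w. inverse c * (\<integral>\<^sup>+ u. f \<theta> (w, u) * emeasure (Q (w, u)) A \<partial>?D) \<partial>W)"
      by (simp add: inner cong: nn_integral_cong)
    also have "\<dots> = inverse (?Z \<theta>) * (inverse c * (\<integral>\<^sup>+ v. f \<theta> v * emeasure (Q v) A \<partial>(W \<Otimes>\<^sub>M ?D)))"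
      using D.nn_integral_fst[OF fQ] D.borel_measurable_nn_integral_fst[OF fQ] by (simp add: nn_integral_cmult)
    also have "\<dots> = inverse (c * ?Z \<theta>) * (\<integral>\<^sup>+ v. f \<theta> v * emeasure (Q v) A \<partial>(W \<Otimes>\<^sub>M ?D))"
      using c Z[OF \<theta>] by (subst ennreal_inverse_mult) (auto simp: mult_ac)
    finally show "emeasure (?\<kappa> \<theta>) A =
        inverse (\<integral>\<^sup>+ v. f \<theta> v \<partial>(W \<Otimes>\<^sub>M ?D)) * (\<integral>\<^sup>+ v. f \<theta> v * emeasure (Q v) A \<partial>(W \<Otimes>\<^sub>M ?D))"
      unfolding int_v[OF \<theta>] .
  qed
qed

end

theorem theorem7:
  fixes n p d :: nat and x a :: "real mat" and m :: real and Pmix :: "real measure"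
    and K K' :: "(nat \<times> nat) set" and z :: "(nat \<times> nat) \<Rightarrow> real"
  assumes "n \<ge> 1" and "p \<ge> 1" and "d \<ge> 1"
    and "x \<in> carrier_mat n p" and "a \<in> psd_mats d"
    and "prob_space Pmix" and "sets Pmix = sets (restrict_space borel {0<..})"
    and "(\<integral>\<^sup>+ w. ennreal (w powr (d / 2)) \<partial>Pmix) < \<infinity>"
    and "missing_structure n d K"
    and "missing_structure n d K'" and "K' \<subset> K"
    and "z \<in> space (data_space K')"
    and "posterior_proper n p d x a m Pmix K' z"
  shows "AE z' in data_space (K - K').
    (let y = merge K' (K - K') (z, z') in
       posterior_proper n p d x a m Pmix K y \<and>
       (\<forall>\<kappa>. DAI_chain n p d x a m Pmix K y \<kappa> \<longrightarrow> Harris_recurrent (param_space p d) \<kappa>))"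
proof -
  interpret dai_model n p d x a m Pmix
    using assms by (intro dai_model.intro) (auto simp: psd_mats_def)
  have K: "K \<subseteq> cells" "K' \<inter> (K - K') = {}" "K' \<union> (K - K') = K"
    using assms by (auto simp: missing_structure_def)
  \<comment> \<open>Only properness has an exceptional null set. Once it holds, recurrence follows
    for every chain, so a single null set serves all \<open>\<kappa>\<close> at once.\<close>
  have "AE z' in data_space (K - K'). posterior_proper n p d x a m Pmix K (merge K' (K - K') (z, z'))"
    using AE_posterior_proper[OF K(2) _ assms(13)] K(1) unfolding K(3) by blast
  then show ?thesis
  proof eventually_elim
    case (elim z')
    have "Harris_recurrent (param_space p d) \<kappa>"
      if chain: "DAI_chain n p d x a m Pmix K (merge K' (K - K') (z, z')) \<kappa>" for \<kappa>
    proof -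
      obtain Kt Q where "missing_structure n d Kt" "K \<subset> Kt"
        "P_step_version n p d x a m Pmix K Kt (merge K' (K - K') (z, z')) Q"
        "\<kappa> = DAI_kernel n d x a m Pmix K Kt (merge K' (K - K') (z, z')) Q"
        using chain unfolding DAI_chain_def by blast
      then show ?thesis using DAI_kernel_Harris_recurrent[OF _ _ elim] by (auto simp: missing_structure_def)
    qed
    with elim show ?case by (simp add: Let_def)
  qed
qed

end
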